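(* A repetitive Meyer set $\Lambda$ in $\mathbb{R}^d$ is a regular inter-model set with Euclidean internal space if and only if $\operatorname{rank}(\langle\Lambda-\Lambda\rangle)>d$, the address system of $\Lambda$ is a topological factor of $(\Omega_\Lambda,\mathbb{R}^d)$ such that there is one point (of the address system) with a unique preimage under the factor map, and the boundary of the minimal window of $\Lambda$ has measure zero.
   Context: Delone sets and hull. A Delone set in $\mathbb{R}^d$ is a subset that is uniformly discrete (for some $r>0$ every closed ball of radius $r$ contains at most one of its points) and relatively dense (for some $R>0$ every closed ball of radius $R$ contains at least one of its points). A $\rho$-patch of $\Lambda$ centered at $t\in\mathbb{R}^d$ is $\Lambda\cap\overline{B(t,\rho)}$. $\Lambda$ is repetitive if for each $\rho>0$ there is $M>0$ such that every closed ball of radius $M$ contains the center of a translated copy of every $\rho$-patch of $\Lambda$. A Meyer set is a Delone set $\Lambda$ such that $\Lambda-\Lambda$ is a Delone set. $\langle A\rangle$ is the subgroup of $\mathbb{R}^d$ generated by $A$; for a repetitive Meyer set, $\langle\Lambda-\Lambda\rangle$ is a finitely generated free Abelian group. The hull $\Omega_\Lambda$ is the set of all Delone sets whose $\rho$-patches, for every $\rho>0$, are $\rho$-patches of $\Lambda$ up to translation. A basis of neighborhoods of $\Lambda'\in\Omega_\Lambda$ is given by the sets $\{\widetilde\Lambda-t : \widetilde\Lambda\in\Omega_\Lambda,\ \widetilde\Lambda\cap\overline{B(0,R)}=\Lambda'\cap\overline{B(0,R)},\ t\in B(0,\varepsilon)\}$, $0<\varepsilon<R/2$; then $\Omega_\Lambda$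 is compact metrizable and $\mathbb{R}^d$ acts continuously by $(\Lambda',t)\mapsto\Lambda'-t$. The transversal is $\Xi_\Lambda=\{\Lambda'\in\Omega_\Lambda:0\in\Lambda'\}$; each $\Lambda_0\in\Xi_\Lambda$ is contained in $\langle\Lambda-\Lambda\rangle$. Address system. Let $s=\operatorname{rank}\langle\Lambda-\Lambda\rangle$, let $\mathcal{B}=\{v_1,\dots,v_s\}$ be a basis of $\langle\Lambda-\Lambda\rangle$ and $\varphi:\langle\Lambda-\Lambda\rangle\to\mathbb{Z}^s$ the coordinate map in this basis. There is a unique linear map $\ell:\mathbb{R}^d\to\mathbb{R}^s$ for which there is $C>0$ with $\|\varphi(t)-\ell(t)\|\le C$ for all $\Lambda_0\in\Xi_\Lambda$ and $t\in\Lambda_0$. The address system of $\Lambda$ is the torus $\mathbb{T}^s=\mathbb{R}^s/\mathbb{Z}^s$ with the $\mathbb{R}^d$-action $(w,t)\mapsto w+[\ell(t)]_{\mathbb{Z}^s}$. There is a continuous map (the address homomorphism) $\pi_{\mathrm{Ad}}:\Omega_\Lambda\to\mathbb{T}^s$ with $\pi_{\mathrm{Ad}}(\Lambda'-t)=\pi_{\mathrm{Ad}}(\Lambda')+[\ell(t)]_{\mathbb{Z}^s}$ for all $\Lambda'\in\Omega_\Lambda$, $t\in\mathbb{R}^d$. The address system and $\pi_{\mathrm{Ad}}$ are well defined up to topological conjugacy. The address system is a topological factor of $(\Omega_\Lambda,\mathbb{R}^d)$ when $\pi_{\mathrm{Ad}}$ is surjective, and then $\pi_{\mathrm{Ad}}$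 is the factor map. Minimal window. Assume $s>d$, put $n=s-d$, and let $\phi:\mathbb{R}^s\to\mathbb{R}^d$, $\phi(u_1,\dots,u_s)=u_1v_1+\cdots+u_sv_s$. One has $\phi\circ\ell=\mathrm{id}$, and $\operatorname{Ker}(\phi)$ has dimension $n$. Fix an orthonormal basis of $\operatorname{Ker}(\phi)$. For each $j$ let $v_j^\star\in\mathbb{R}^n$ be the coordinate vector of $\ell(v_j)-e_j\in\operatorname{Ker}(\phi)$ in this basis ($e_j$ is the $j$-th canonical vector of $\mathbb{R}^s$), and let $s_L:\langle\Lambda-\Lambda\rangle\to\mathbb{R}^n$ be the group morphism with $s_L(v_j)=v_j^\star$. When the address system is a topological factor of $(\Omega_\Lambda,\mathbb{R}^d)$, the triple $(\mathbb{R}^n,\langle\Lambda-\Lambda\rangle,s_L)$ is a Euclidean CPS (defined below), the Lagarias CPS of $\Lambda$. The minimal window of $\Lambda$ is $\overline{s_L(\Lambda_0)}\subseteq\mathbb{R}^n$ for a fixed $\Lambda_0\in\Xi_\Lambda$ (changing $\Lambda_0$ only translates it, and changing the bases only applies a linear isomorphism). Measure means Lebesgue measure on $\mathbb{R}^n$. Inter-model sets. A Euclidean cut and project scheme (CPS) over $\mathbb{R}^d$ is a triple $(\mathbb{R}^n,\Gamma,s_{\mathbb{R}^n})$ with $n$ a positive integer, $\Gamma$ a countable subgroup of $\mathbb{R}^d$ and $s_{\mathbb{R}^n}:\Gamma\to\mathbb{R}^n$ a group morphism with dense range whose graph $\{(\gamma,s_{\mathbb{R}^n}(\gamma)):\gamma\in\Gamma\}$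 is discrete and co-compact in $\mathbb{R}^d\times\mathbb{R}^n$. A window is a compact set $W\subseteq\mathbb{R}^n$ that is the closure of its interior. For $V\subseteq\mathbb{R}^n$ and $w\in\mathbb{R}^n$ put $\curlywedge(w+V)=\{t\in\Gamma: s_{\mathbb{R}^n}(t)\in w+V\}$. A Delone set $\Lambda\subseteq\mathbb{R}^d$ is an inter-model set with Euclidean internal space if for some Euclidean CPS, some window $W$, and some $t\in\mathbb{R}^d$, $w\in\mathbb{R}^n$, one has $\curlywedge(w+\operatorname{int}(W))-t\subseteq\Lambda\subseteq\curlywedge(w+W)-t$. It is regular if these can be chosen so that the boundary of $w+W$ has zero Haar (Lebesgue) measure. *)

theory Defs
  imports "HOL-Analysis.Analysis"
begin

definition difference_set :: "'a::euclidean_space set \<Rightarrow> 'a set" where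
  "difference_set \<Lambda> = {x - y |x y. x \<in> \<Lambda> \<and> y \<in> \<Lambda>}"

definition shift :: "'a::euclidean_space set \<Rightarrow> 'a \<Rightarrow> 'a set" where
  "shift \<Lambda> t = (\<lambda>x. x - t) ` \<Lambda>"

definition uniformly_discrete_set :: "'a::euclidean_space set \<Rightarrow> bool" where
  "uniformly_discrete_set \<Lambda> \<longleftrightarrow>
     (\<exists>r>0. \<forall>c. \<forall>x \<in> \<Lambda> \<inter> cball c r. \<forall>y \<in> \<Lambda> \<inter> cball c r. x = y)"

definition relatively_dense_set :: "'a::euclidean_space set \<Rightarrow> bool" where
  "relatively_dense_set \<Lambda> \<longleftrightarrow> (\<exists>R>0. \<forall>c. \<Lambda> \<inter> cball c R \<noteq> {})"

definition delone :: "'a::euclidean_space set \<Rightarrow> bool" where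
  "delone \<Lambda> \<longleftrightarrow> uniformly_discrete_set \<Lambda> \<and> relatively_dense_set \<Lambda>"

definition meyer :: "'a::euclidean_space set \<Rightarrow> bool" where
  "meyer \<Lambda> \<longleftrightarrow> delone \<Lambda> \<and> delone (difference_set \<Lambda>)"

definition patch :: "'a::euclidean_space set \<Rightarrow> real \<Rightarrow> 'a \<Rightarrow> 'a set" where
  "patch \<Lambda> \<rho> t = \<Lambda> \<inter> cball t \<rho>"

text \<open>A patch is compared together with its center: the \<open>\<rho>\<close>-patch of \<open>\<Lambda>'\<close> at \<open>t\<close> is a
  translated copy of the \<open>\<rho>\<close>-patch of \<open>\<Lambda>\<close> at \<open>u\<close> if the translation by \<open>t - u\<close> carries the
  latter to the former.\<close>

definition same_patch ::
  "real \<Rightarrow> 'a::euclidean_space set \<Rightarrow> 'a \<Rightarrow> 'a set \<Rightarrow> 'a \<Rightarrow> bool" where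
  "same_patch \<rho> \<Lambda> u \<Lambda>' t \<longleftrightarrow> patch \<Lambda>' \<rho> t = (\<lambda>x. x + (t - u)) ` patch \<Lambda> \<rho> u"

definition repetitive :: "'a::euclidean_space set \<Rightarrow> bool" where
  "repetitive \<Lambda> \<longleftrightarrow>
     (\<forall>\<rho>>0. \<exists>M>0. \<forall>c. \<forall>u. \<exists>t \<in> cball c M. same_patch \<rho> \<Lambda> u \<Lambda> t)"

definition delone_hull :: "'a::euclidean_space set \<Rightarrow> 'a set set" where
  "delone_hull \<Lambda> = {\<Lambda>'. delone \<Lambda>' \<and> (\<forall>\<rho>>0. \<forall>t. \<exists>u. same_patch \<rho> \<Lambda> u \<Lambda>' t)}"

definition hull_nbhd ::
  "'a::euclidean_space set \<Rightarrow> 'a set \<Rightarrow> real \<Rightarrow> real \<Rightarrow> 'a set set" where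
  "hull_nbhd \<Lambda> \<Lambda>' R \<epsilon> =
     {shift M t |M t. M \<in> delone_hull \<Lambda> \<and> M \<inter> cball 0 R = \<Lambda>' \<inter> cball 0 R \<and> t \<in> ball 0 \<epsilon>}"

definition hull_topology :: "'a::euclidean_space set \<Rightarrow> 'a set topology" where
  "hull_topology \<Lambda> = topology (\<lambda>U. U \<subseteq> delone_hull \<Lambda> \<and>
     (\<forall>\<Lambda>'\<in>U. \<exists>R \<epsilon>. 0 < \<epsilon> \<and> \<epsilon> < R / 2 \<and> hull_nbhd \<Lambda> \<Lambda>' R \<epsilon> \<subseteq> U))"

definition transversal :: "'a::euclidean_space set \<Rightarrow> 'a set set" where
  "transversal \<Lambda> = {\<Lambda>' \<in> delone_hull \<Lambda>. 0 \<in> \<Lambda>'}"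

lemma hull_nbhd_mono:
  assumes "R \<le> R'" "\<epsilon>' \<le> \<epsilon>"
  shows "hull_nbhd \<Lambda> \<Lambda>' R' \<epsilon>' \<subseteq> hull_nbhd \<Lambda> \<Lambda>' R \<epsilon>"
proof
  fix N assume "N \<in> hull_nbhd \<Lambda> \<Lambda>' R' \<epsilon>'"
  then obtain M t where M: "N = shift M t" "M \<in> delone_hull \<Lambda>"
      "M \<inter> cball 0 R' = \<Lambda>' \<inter> cball 0 R'" "t \<in> ball 0 \<epsilon>'"
    by (auto simp: hull_nbhd_def)
  have "cball (0::'a) R \<subseteq> cball 0 R'"
    using assms(1) by auto
  then have "M \<inter> cball 0 R = \<Lambda>' \<inter> cball 0 R"
    using M(3) by blast
  moreover have "t \<in> ball 0 \<epsilon>"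
    using M(4) assms(2) by auto
  ultimately show "N \<in> hull_nbhd \<Lambda> \<Lambda>' R \<epsilon>"
    using M(1,2) unfolding hull_nbhd_def by blast
qed

lemma shift_0 [simp]: "shift \<Lambda> 0 = \<Lambda>"
  by (simp add: shift_def)

lemma shift_shift: "shift (shift \<Lambda> s) t = shift \<Lambda> (s + t)"
  by (simp add: shift_def image_image diff_diff_eq)

lemma mem_shift: "x \<in> shift \<Lambda> t \<longleftrightarrow> x + t \<in> \<Lambda>"
  unfolding shift_def by (auto intro!: image_eqI[of _ _ "x + t"])

lemma mem_hull_nbhd_self:
  assumes "\<Lambda>' \<in> delone_hull \<Lambda>" "0 < \<epsilon>"
  shows "\<Lambda>' \<in> hull_nbhd \<Lambda> \<Lambda>' R \<epsilon>"
proof -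
  have "\<Lambda>' = shift \<Lambda>' 0" "(0::'a) \<in> ball 0 \<epsilon>"
    using assms by simp_all
  then show ?thesis
    using assms unfolding hull_nbhd_def by blast
qed

lemma istopology_hull:
  "istopology (\<lambda>U. U \<subseteq> delone_hull \<Lambda> \<and>
     (\<forall>\<Lambda>'\<in>U. \<exists>R \<epsilon>. 0 < \<epsilon> \<and> \<epsilon> < R / 2 \<and> hull_nbhd \<Lambda> \<Lambda>' R \<epsilon> \<subseteq> U))"
  (is "istopology ?P")
  unfolding istopology_def
proof (intro conjI allI impI)
  fix S T assume S: "?P S" and T: "?P T"
  show "S \<inter> T \<subseteq> delone_hull \<Lambda>"
    using S by blast
  show "\<forall>\<Lambda>'\<in>S \<inter> T. \<exists>R \<epsilon>. 0 < \<epsilon> \<and> \<epsilon> < R / 2 \<and> hull_nbhd \<Lambda> \<Lambda>' R \<epsilon> \<subseteq> S \<inter> T"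
  proof
    fix L assume L: "L \<in> S \<inter> T"
    obtain R1 e1 where 1: "0 < e1" "e1 < R1 / 2" "hull_nbhd \<Lambda> L R1 e1 \<subseteq> S"
      using S L by blast
    obtain R2 e2 where 2: "0 < e2" "e2 < R2 / 2" "hull_nbhd \<Lambda> L R2 e2 \<subseteq> T"
      using T L by blast
    have "hull_nbhd \<Lambda> L (max R1 R2) (min e1 e2) \<subseteq> S \<inter> T"
      using 1(3) 2(3) hull_nbhd_mono[of R1 "max R1 R2" "min e1 e2" e1 \<Lambda> L]
        hull_nbhd_mono[of R2 "max R1 R2" "min e1 e2" e2 \<Lambda> L] by auto
    moreover have "0 < min e1 e2" "min e1 e2 < max R1 R2 / 2"
      using 1 2 by auto
    ultimately show "\<exists>R \<epsilon>. 0 < \<epsilon> \<and> \<epsilon> < R / 2 \<and> hull_nbhd \<Lambda> L R \<epsilon> \<subseteq> S \<inter> T"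
      by blast
  qed
next
  fix K assume K: "\<forall>S\<in>K. ?P S"
  show "\<Union>K \<subseteq> delone_hull \<Lambda>"
    using K by blast
  show "\<forall>\<Lambda>'\<in>\<Union>K. \<exists>R \<epsilon>. 0 < \<epsilon> \<and> \<epsilon> < R / 2 \<and> hull_nbhd \<Lambda> \<Lambda>' R \<epsilon> \<subseteq> \<Union>K"
  proof
    fix L assume "L \<in> \<Union>K"
    then obtain S where S: "S \<in> K" "L \<in> S"
      by blast
    then obtain R e where "0 < e" "e < R / 2" "hull_nbhd \<Lambda> L R e \<subseteq> S"
      using K by blast
    then show "\<exists>R \<epsilon>. 0 < \<epsilon> \<and> \<epsilon> < R / 2 \<and> hull_nbhd \<Lambda> L R \<epsilon> \<subseteq> \<Union>K"
      using S(1) by blast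
  qed
qed

lemma openin_hull_topology:
  "openin (hull_topology \<Lambda>) U \<longleftrightarrow> U \<subseteq> delone_hull \<Lambda> \<and>
     (\<forall>\<Lambda>'\<in>U. \<exists>R \<epsilon>. 0 < \<epsilon> \<and> \<epsilon> < R / 2 \<and> hull_nbhd \<Lambda> \<Lambda>' R \<epsilon> \<subseteq> U)"
  unfolding hull_topology_def topology_inverse'[OF istopology_hull] ..

lemma same_patch_shift: "same_patch \<rho> \<Lambda> u (shift \<Lambda>' a) t \<longleftrightarrow> same_patch \<rho> \<Lambda> u \<Lambda>' (t + a)"
proof -
  have 1: "patch \<Lambda>' \<rho> (t + a) = (\<lambda>x. x + a) ` patch (shift \<Lambda>' a) \<rho> t"
  proof (intro set_eqI iffI)
    fix x assume "x \<in> patch \<Lambda>' \<rho> (t + a)"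
    then have "x - a \<in> patch (shift \<Lambda>' a) \<rho> t"
      by (simp add: patch_def mem_shift dist_norm algebra_simps)
    then show "x \<in> (\<lambda>x. x + a) ` patch (shift \<Lambda>' a) \<rho> t"
      by (rule image_eqI[rotated]) simp
  next
    fix x assume "x \<in> (\<lambda>x. x + a) ` patch (shift \<Lambda>' a) \<rho> t"
    then show "x \<in> patch \<Lambda>' \<rho> (t + a)"
      by (auto simp: patch_def mem_shift dist_norm algebra_simps)
  qed
  have 2: "(\<lambda>x. x + (t + a - u)) ` P = (\<lambda>x. x + a) ` (\<lambda>x. x + (t - u)) ` P" for P
    by (simp add: image_image algebra_simps)
  show ?thesis
    unfolding same_patch_def 1 2 by (rule inj_image_eq_iff[symmetric]) (simp add: inj_def)
qed

lemma delone_shift: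
  assumes "delone \<Lambda>"
  shows "delone (shift \<Lambda> a)"
proof -
  obtain r where r: "r > 0"
      "\<And>c x y. x \<in> \<Lambda> \<inter> cball c r \<Longrightarrow> y \<in> \<Lambda> \<inter> cball c r \<Longrightarrow> x = y"
    using assms unfolding delone_def uniformly_discrete_set_def by blast
  obtain R where R: "R > 0" "\<And>c. \<Lambda> \<inter> cball c R \<noteq> {}"
    using assms unfolding delone_def relatively_dense_set_def by blast
  have trans: "x \<in> shift \<Lambda> a \<inter> cball c q \<longleftrightarrow> x + a \<in> \<Lambda> \<inter> cball (c + a) q" for x c q
    by (simp add: mem_shift)
  have "uniformly_discrete_set (shift \<Lambda> a)"
    unfolding uniformly_discrete_set_def
  proof (intro exI[of _ r] conjI allI ballI)
    fix c x y assume "x \<in> shift \<Lambda> a \<inter> cball c r" "y \<in> shift \<Lambda> a \<inter> cball c r"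
    then have "x + a = y + a"
      unfolding trans by (rule r(2))
    then show "x = y"
      by simp
  qed (fact r(1))
  moreover have "relatively_dense_set (shift \<Lambda> a)"
    unfolding relatively_dense_set_def
  proof (intro exI[of _ R] conjI allI)
    fix c
    obtain z where "z \<in> \<Lambda> \<inter> cball (c + a) R"
      using R(2) by blast
    then have "z - a \<in> shift \<Lambda> a \<inter> cball c R"
      unfolding trans by simp
    then show "shift \<Lambda> a \<inter> cball c R \<noteq> {}"
      by blast
  qed (fact R(1))
  ultimately show ?thesis
    by (simp add: delone_def)
qed

lemma shift_in_delone_hull:
  assumes "\<Lambda>' \<in> delone_hull \<Lambda>"
  shows "shift \<Lambda>' t \<in> delone_hull \<Lambda>"
  using assms by (simp add: delone_hull_def same_patch_shift delone_shift)

lemma topspace_hull_topology [simp]: "topspace (hull_topology \<Lambda>) = delone_hull \<Lambda>"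
proof
  show "topspace (hull_topology \<Lambda>) \<subseteq> delone_hull \<Lambda>"
    using openin_topspace[of "hull_topology \<Lambda>"] unfolding openin_hull_topology by blast
  have "hull_nbhd \<Lambda> L R e \<subseteq> delone_hull \<Lambda>" for L R e
    by (auto simp: hull_nbhd_def shift_in_delone_hull)
  moreover have "(0::real) < 1" "(1::real) < 3 / 2"
    by simp_all
  ultimately have "openin (hull_topology \<Lambda>) (delone_hull \<Lambda>)"
    unfolding openin_hull_topology by blast
  then show "delone_hull \<Lambda> \<subseteq> topspace (hull_topology \<Lambda>)"
    by (rule openin_subset)
qed

definition add_subgroup :: "'a::euclidean_space set \<Rightarrow> bool" where
  "add_subgroup G \<longleftrightarrow> 0 \<in> G \<and> (\<forall>x\<in>G. \<forall>y\<in>G. x - y \<in> G)"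

definition generated_subgroup :: "'a::euclidean_space set \<Rightarrow> 'a set" where
  "generated_subgroup A = add_subgroup hull A"

text \<open>Vectors in \<open>\<int>\<^sup>s\<close> and \<open>\<real>\<^sup>s\<close> are functions on \<open>nat\<close> vanishing from index \<open>s\<close> on, as in
  \<^const>\<open>Euclidean_space\<close>. Only the values \<open>v i\<close> with \<open>i < s\<close> matter for a basis \<open>v\<close>.\<close>

definition int_coord ::
  "nat \<Rightarrow> (nat \<Rightarrow> 'a::euclidean_space) \<Rightarrow> 'a \<Rightarrow> (nat \<Rightarrow> int) \<Rightarrow> bool" where
  "int_coord s v g c \<longleftrightarrow> (\<forall>i\<ge>s. c i = 0) \<and> g = (\<Sum>i<s. of_int (c i) *\<^sub>R v i)"

definition zbasis :: "nat \<Rightarrow> (nat \<Rightarrow> 'a::euclidean_space) \<Rightarrow> 'a set \<Rightarrow> bool" where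
  "zbasis s v G \<longleftrightarrow> (\<forall>i<s. v i \<in> G) \<and> (\<forall>g\<in>G. \<exists>!c. int_coord s v g c)"

definition zrank :: "'a::euclidean_space set \<Rightarrow> nat" where
  "zrank G = (THE s. \<exists>v. zbasis s v G)"

definition zcoord :: "nat \<Rightarrow> (nat \<Rightarrow> 'a::euclidean_space) \<Rightarrow> 'a \<Rightarrow> nat \<Rightarrow> int" where
  "zcoord s v g = (THE c. int_coord s v g c)"

definition quotient_topology :: "'b topology \<Rightarrow> ('b \<Rightarrow> 'c) \<Rightarrow> 'c topology" where
  "quotient_topology X q =
     topology (\<lambda>U. U \<subseteq> q ` topspace X \<and> openin X {x \<in> topspace X. q x \<in> U})"

lemma istopology_quotient:
  "istopology (\<lambda>U. U \<subseteq> q ` topspace X \<and> openin X {x \<in> topspace X. q x \<in> U})"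
  (is "istopology ?P")
  unfolding istopology_def
proof (intro conjI allI impI)
  fix S T assume S: "?P S" and T: "?P T"
  show "S \<inter> T \<subseteq> q ` topspace X"
    using S by blast
  have "{x \<in> topspace X. q x \<in> S \<inter> T} = {x \<in> topspace X. q x \<in> S} \<inter> {x \<in> topspace X. q x \<in> T}"
    by blast
  then show "openin X {x \<in> topspace X. q x \<in> S \<inter> T}"
    using S T by (simp add: openin_Int)
next
  fix K assume K: "\<forall>S\<in>K. ?P S"
  show "\<Union>K \<subseteq> q ` topspace X"
    using K by blast
  have "{x \<in> topspace X. q x \<in> \<Union>K} = (\<Union>S\<in>K. {x \<in> topspace X. q x \<in> S})"
    by blast
  then show "openin X {x \<in> topspace X. q x \<in> \<Union>K}"
    using K by (metis (no_types, lifting) openin_Union imageE)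
qed

lemma openin_quotient_topology:
  "openin (quotient_topology X q) U \<longleftrightarrow>
     U \<subseteq> q ` topspace X \<and> openin X {x \<in> topspace X. q x \<in> U}"
  unfolding quotient_topology_def topology_inverse'[OF istopology_quotient] ..

lemma topspace_quotient_topology [simp]: "topspace (quotient_topology X q) = q ` topspace X"
proof
  show "topspace (quotient_topology X q) \<subseteq> q ` topspace X"
    using openin_topspace[of "quotient_topology X q"] unfolding openin_quotient_topology by blast
  have "{x \<in> topspace X. q x \<in> q ` topspace X} = topspace X"
    by blast
  then have "openin (quotient_topology X q) (q ` topspace X)"
    unfolding openin_quotient_topology by simp
  then show "q ` topspace X \<subseteq> topspace (quotient_topology X q)"
    by (rule openin_subset)
qed

lemma quotient_map_quotient_topology: "quotient_map X (quotient_topology X q) q"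
  unfolding quotient_map_def by (simp add: openin_quotient_topology)

text \<open>The points of \<open>\<real>\<^sup>s / \<int>\<^sup>s\<close> are the cosets of \<open>\<int>\<^sup>s\<close>, and they are added as subsets of
  \<open>\<real>\<^sup>s\<close>.\<close>

definition torus_class :: "nat \<Rightarrow> (nat \<Rightarrow> real) \<Rightarrow> (nat \<Rightarrow> real) set" where
  "torus_class s x = {y \<in> topspace (Euclidean_space s). \<forall>i. y i - x i \<in> \<int>}"

definition torus :: "nat \<Rightarrow> (nat \<Rightarrow> real) set topology" where
  "torus s = quotient_topology (Euclidean_space s) (torus_class s)"

definition torus_add ::
  "(nat \<Rightarrow> real) set \<Rightarrow> (nat \<Rightarrow> real) set \<Rightarrow> (nat \<Rightarrow> real) set" where
  "torus_add w z = {\<lambda>i. x i + y i |x y. x \<in> w \<and> y \<in> z}"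

definition address_linear_map ::
  "'a::euclidean_space set \<Rightarrow> nat \<Rightarrow> (nat \<Rightarrow> 'a) \<Rightarrow> ('a \<Rightarrow> nat \<Rightarrow> real) \<Rightarrow> bool" where
  "address_linear_map \<Lambda> s v ell \<longleftrightarrow>
     (\<forall>t. ell t \<in> topspace (Euclidean_space s)) \<and>
     (\<forall>i<s. linear (\<lambda>t. ell t i)) \<and>
     (\<exists>C>0. \<forall>\<Lambda>\<^sub>0 \<in> transversal \<Lambda>. \<forall>t\<in>\<Lambda>\<^sub>0.
        L2_set (\<lambda>i. of_int (zcoord s v t i) - ell t i) {..<s} \<le> C)"

definition address_homomorphism ::
  "'a::euclidean_space set \<Rightarrow> nat \<Rightarrow> ('a \<Rightarrow> nat \<Rightarrow> real) \<Rightarrow>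
     ('a set \<Rightarrow> (nat \<Rightarrow> real) set) \<Rightarrow> bool" where
  "address_homomorphism \<Lambda> s ell \<pi> \<longleftrightarrow>
     continuous_map (hull_topology \<Lambda>) (torus s) \<pi> \<and>
     (\<forall>\<Lambda>' \<in> delone_hull \<Lambda>. \<forall>t. \<pi> (shift \<Lambda>' t) = torus_add (\<pi> \<Lambda>') (torus_class s (ell t)))"

definition address_factor_map ::
  "'a::euclidean_space set \<Rightarrow> nat \<Rightarrow> ('a \<Rightarrow> nat \<Rightarrow> real) \<Rightarrow>
     ('a set \<Rightarrow> (nat \<Rightarrow> real) set) \<Rightarrow> bool" where
  "address_factor_map \<Lambda> s ell \<pi> \<longleftrightarrow>
     address_homomorphism \<Lambda> s ell \<pi> \<and> \<pi> ` delone_hull \<Lambda> = topspace (torus s)"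

definition address_kernel :: "nat \<Rightarrow> (nat \<Rightarrow> 'a::euclidean_space) \<Rightarrow> (nat \<Rightarrow> real) set" where
  "address_kernel s v = {u \<in> topspace (Euclidean_space s). (\<Sum>i<s. u i *\<^sub>R v i) = 0}"

definition orthonormal_basis ::
  "nat \<Rightarrow> nat \<Rightarrow> (nat \<Rightarrow> nat \<Rightarrow> real) \<Rightarrow> (nat \<Rightarrow> real) set \<Rightarrow> bool" where
  "orthonormal_basis s n b K \<longleftrightarrow>
     (\<forall>j<n. b j \<in> K) \<and>
     (\<forall>j<n. \<forall>k<n. (\<Sum>i<s. b j i * b k i) = (if j = k then 1 else 0)) \<and>
     (\<forall>u\<in>K. \<exists>c. \<forall>i. u i = (\<Sum>j<n. c j * b j i))"

text \<open>Coordinates in an orthonormal basis are inner products with the basis vectors.\<close>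

definition orthonormal_coords ::
  "nat \<Rightarrow> nat \<Rightarrow> (nat \<Rightarrow> nat \<Rightarrow> real) \<Rightarrow> (nat \<Rightarrow> real) \<Rightarrow> nat \<Rightarrow> real" where
  "orthonormal_coords s n b u = (\<lambda>j. if j < n then \<Sum>i<s. u i * b j i else 0)"

definition basis_star ::
  "nat \<Rightarrow> nat \<Rightarrow> (nat \<Rightarrow> 'a::euclidean_space) \<Rightarrow> ('a \<Rightarrow> nat \<Rightarrow> real) \<Rightarrow>
     (nat \<Rightarrow> nat \<Rightarrow> real) \<Rightarrow> nat \<Rightarrow> nat \<Rightarrow> real" where
  "basis_star s n v ell b j =
     orthonormal_coords s n b (\<lambda>i. ell (v j) i - (if i = j then 1 else 0))"

definition lagarias_star ::
  "nat \<Rightarrow> nat \<Rightarrow> (nat \<Rightarrow> 'a::euclidean_space) \<Rightarrow> ('a \<Rightarrow> nat \<Rightarrow> real) \<Rightarrow>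
     (nat \<Rightarrow> nat \<Rightarrow> real) \<Rightarrow> 'a \<Rightarrow> nat \<Rightarrow> real" where
  "lagarias_star s n v ell b g =
     (\<lambda>k. \<Sum>j<s. of_int (zcoord s v g j) * basis_star s n v ell b j k)"

definition minimal_window ::
  "nat \<Rightarrow> nat \<Rightarrow> (nat \<Rightarrow> 'a::euclidean_space) \<Rightarrow> ('a \<Rightarrow> nat \<Rightarrow> real) \<Rightarrow>
     (nat \<Rightarrow> nat \<Rightarrow> real) \<Rightarrow> 'a set \<Rightarrow> (nat \<Rightarrow> real) set" where
  "minimal_window s n v ell b \<Lambda>\<^sub>0 = Euclidean_space n closure_of (lagarias_star s n v ell b ` \<Lambda>\<^sub>0)"

text \<open>Lebesgue null sets of \<^term>\<open>Euclidean_space n\<close>: the product measure \<open>\<Pi>\<^sub>M\<close> lives on functions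
  that are \<^const>\<open>undefined\<close> rather than \<open>0\<close> outside \<^term>\<open>{..<n}\<close>, hence the restriction.\<close>

definition null_Euclidean :: "nat \<Rightarrow> (nat \<Rightarrow> real) set \<Rightarrow> bool" where
  "null_Euclidean n S \<longleftrightarrow>
     (\<lambda>x. restrict x {..<n}) ` S \<in> null_sets (\<Pi>\<^sub>M i\<in>{..<n}. (lborel :: real measure))"

definition graph_coset ::
  "'a::euclidean_space set \<Rightarrow> ('a \<Rightarrow> nat \<Rightarrow> real) \<Rightarrow> 'a \<times> (nat \<Rightarrow> real) \<Rightarrow>
     ('a \<times> (nat \<Rightarrow> real)) set" where
  "graph_coset \<Gamma> \<sigma> p = (\<lambda>\<gamma>. (fst p + \<gamma>, \<lambda>i. snd p i + \<sigma> \<gamma> i)) ` \<Gamma>"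

definition euclidean_CPS ::
  "nat \<Rightarrow> 'a::euclidean_space set \<Rightarrow> ('a \<Rightarrow> nat \<Rightarrow> real) \<Rightarrow> bool" where
  "euclidean_CPS n \<Gamma> \<sigma> \<longleftrightarrow>
     0 < n \<and> add_subgroup \<Gamma> \<and> countable \<Gamma> \<and>
     \<sigma> ` \<Gamma> \<subseteq> topspace (Euclidean_space n) \<and>
     (\<forall>x\<in>\<Gamma>. \<forall>y\<in>\<Gamma>. \<forall>i. \<sigma> (x + y) i = \<sigma> x i + \<sigma> y i) \<and>
     Euclidean_space n closure_of (\<sigma> ` \<Gamma>) = topspace (Euclidean_space n) \<and>
     (let X = prod_topology euclidean (Euclidean_space n); G = (\<lambda>\<gamma>. (\<gamma>, \<sigma> \<gamma>)) ` \<Gamma>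
      in subtopology X G = discrete_topology G \<and>
         compact_space (quotient_topology X (graph_coset \<Gamma> \<sigma>)))"

definition window :: "nat \<Rightarrow> (nat \<Rightarrow> real) set \<Rightarrow> bool" where
  "window n W \<longleftrightarrow> compactin (Euclidean_space n) W \<and>
     W = Euclidean_space n closure_of (Euclidean_space n interior_of W)"

definition translate :: "(nat \<Rightarrow> real) \<Rightarrow> (nat \<Rightarrow> real) set \<Rightarrow> (nat \<Rightarrow> real) set" where
  "translate w V = (\<lambda>x i. w i + x i) ` V"

definition model_points ::
  "'a::euclidean_space set \<Rightarrow> ('a \<Rightarrow> nat \<Rightarrow> real) \<Rightarrow> (nat \<Rightarrow> real) set \<Rightarrow> 'a set" where
  "model_points \<Gamma> \<sigma> V = {t \<in> \<Gamma>. \<sigma> t \<in> V}"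

definition inter_model_data ::
  "'a::euclidean_space set \<Rightarrow> nat \<Rightarrow> 'a set \<Rightarrow> ('a \<Rightarrow> nat \<Rightarrow> real) \<Rightarrow>
     (nat \<Rightarrow> real) set \<Rightarrow> 'a \<Rightarrow> (nat \<Rightarrow> real) \<Rightarrow> bool" where
  "inter_model_data \<Lambda> n \<Gamma> \<sigma> W t w \<longleftrightarrow>
     euclidean_CPS n \<Gamma> \<sigma> \<and> window n W \<and> w \<in> topspace (Euclidean_space n) \<and>
     shift (model_points \<Gamma> \<sigma> (translate w (Euclidean_space n interior_of W))) t \<subseteq> \<Lambda> \<and>
     \<Lambda> \<subseteq> shift (model_points \<Gamma> \<sigma> (translate w W)) t"

definition regular_inter_model_set :: "'a::euclidean_space set \<Rightarrow> bool" where
  "regular_inter_model_set \<Lambda> \<longleftrightarrow> delone \<Lambda> \<and>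
     (\<exists>n \<Gamma> \<sigma> W t w. inter_model_data \<Lambda> n \<Gamma> \<sigma> W t w \<and>
        null_Euclidean n (Euclidean_space n frontier_of (translate w W)))"

end

theory Submission
  imports Defs "HOL-Complex_Analysis.Great_Picard"
begin

text \<open>
  Write \<open>L = \<langle>\<Lambda> - \<Lambda>\<rangle>\<close> and let \<open>S : L \<rightarrow> \<real>\<^sup>n\<close> be the star map of the Lagarias scheme.
  Every element \<open>N\<close> of the hull that lies in \<open>L\<close> has a bounded image \<open>S(N)\<close>; the lower corner \<open>c(N)\<close>
  of its bounding box satisfies \<open>c(N - g) = c(N) - S(g)\<close>, and repetitivity makes \<open>c\<close> continuous and
  makes all closures of \<open>S(N) - c(N)\<close> equal to one set. Hence \<open>c\<close> is the address homomorphism in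
  disguise: two elements of the hull lying in \<open>L\<close> have the same address iff they have the same
  corner, and each of them is a limit of \<open>L\<close>-translates of any other.

  If an address has a single preimage \<open>N\<close>, compactness of the hull forces \<open>N\<close> to consist of all points
  of \<open>L\<close> whose star lies in the closure of \<open>S(N)\<close>, and forces \<open>S(N)\<close> to lie in the interior of that
  closure; the inter-model property then passes from \<open>N\<close> to \<open>\<Lambda>\<close> by approximation. Conversely, in a
  cut and project scheme for \<open>\<Lambda>\<close> the physical lattice projection is \<open>L\<close> and its star map is a linear
  image of \<open>S\<close>, so the window may be transported to the Lagarias scheme. Density of \<open>S(L)\<close> gives
  surjectivity of the address map, and a translate of the window whose null boundary avoids the
  countable set \<open>S(L)\<close> gives a singleton fibre.
\<close>

section \<open>Euclidean spaces with the supremum norm\<close>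

text \<open>The map \<open>\<pi>\<close> of the statement is an arbitrary factor map, so the
  direction that starts from it has no formula to compute with. Only two facts are drawn from it:
  equal corners force equal values, and surjectivity forces \<open>S\<close> to have dense image.
  The explicit \<open>addr\<close> serves as witness in the other direction. Both rest on the
  identity zc g = ell g - comb (S g): modulo integer vectors, shifting by \<open>g\<close> in
  \<open>L\<close> moves an address by \<open>comb (S g)\<close>, so a small star means a small move
  on the torus.

  The corner is continuous because it can be read off from a bounded patch. A difference of points
  of \<Lambda> whose k-th star coordinate is nearly maximal recurs in every large ball, and the
  lower end of each copy nearly attains the infimum.

  An arbitrary scheme for \<Lambda> has an internal space of unknown dimension \<open>m\<close>.
  Discreteness of its graph gives n \<le> m, density of its star map gives m \<le> n.

  Window boundaries are compact, and a compact null set needs few dyadic cells; this count survives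
  Lipschitz maps, which is how null boundaries are moved between schemes.\<close>

abbreviation Euc :: "nat \<Rightarrow> (nat \<Rightarrow> real) topology" where
  "Euc \<equiv> Euclidean_space"

abbreviation euc :: "nat \<Rightarrow> (nat \<Rightarrow> real) set" where
  "euc n \<equiv> topspace (Euc n)"

lemma mem_euc: "x \<in> euc n \<longleftrightarrow> (\<forall>i\<ge>n. x i = 0)"
  by (simp add: topspace_Euclidean_space)

lemma euc_add: "x \<in> euc n \<Longrightarrow> y \<in> euc n \<Longrightarrow> (\<lambda>i. x i + y i) \<in> euc n"
  and euc_diff: "x \<in> euc n \<Longrightarrow> y \<in> euc n \<Longrightarrow> (\<lambda>i. x i - y i) \<in> euc n"
  and euc_uminus: "x \<in> euc n \<Longrightarrow> (\<lambda>i. - x i) \<in> euc n"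
  and euc_scale: "x \<in> euc n \<Longrightarrow> (\<lambda>i. c * x i) \<in> euc n"
  and euc_zero: "(\<lambda>i. 0) \<in> euc n"
  by (simp_all add: mem_euc)

lemma euc_eqI: "x \<in> euc n \<Longrightarrow> y \<in> euc n \<Longrightarrow> (\<And>i. i < n \<Longrightarrow> x i = y i) \<Longrightarrow> x = y"
  unfolding mem_euc by (metis ext not_le)

text \<open>Estimates on stars are made coordinate by coordinate, hence cubes instead of Euclidean
  balls.\<close>

definition sup_ball :: "nat \<Rightarrow> (nat \<Rightarrow> real) \<Rightarrow> real \<Rightarrow> (nat \<Rightarrow> real) set" where
  "sup_ball n x e = {y \<in> euc n. \<forall>i<n. \<bar>y i - x i\<bar> < e}"

lemma sup_ballI: "y \<in> euc n \<Longrightarrow> (\<And>i. i < n \<Longrightarrow> \<bar>y i - x i\<bar> < e) \<Longrightarrow> y \<in> sup_ball n x e"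
  by (simp add: sup_ball_def)

lemma sup_ball_mono: "d \<le> e \<Longrightarrow> sup_ball n x d \<subseteq> sup_ball n x e"
  by (force simp: sup_ball_def)

lemma mem_sup_ball_self: "x \<in> euc n \<Longrightarrow> 0 < e \<Longrightarrow> x \<in> sup_ball n x e"
  by (simp add: sup_ball_def)

lemma uniform_bound_below:
  fixes e :: "nat \<Rightarrow> real"
  assumes "\<And>i. i < n \<Longrightarrow> e i > 0"
  obtains d where "d > 0" "\<And>i. i < n \<Longrightarrow> d \<le> e i"
proof
  \<comment> \<open>The extra element 1 keeps the set nonempty when \<open>n = 0\<close>.\<close>
  show "Min (insert 1 (e ` {..<n})) > 0"
    using assms by (subst Min_gr_iff) auto
  show "Min (insert 1 (e ` {..<n})) \<le> e i" if "i < n" for i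
    using that by (intro Min_le) auto
qed

lemma continuous_map_Euclidean_coordinate:
  "continuous_map (Euc n) euclideanreal (\<lambda>x. x i)"
  unfolding Euclidean_space_def
  by (intro continuous_map_from_subtopology continuous_map_product_projection) auto

lemma openin_sup_ball: "openin (Euc n) (sup_ball n x e)"
proof -
  have "openin (Euc n) {y \<in> euc n. y i \<in> ball (x i) e}" for i
    by (rule openin_continuous_map_preimage[OF continuous_map_Euclidean_coordinate]) simp
  then have "openin (Euc n) (euc n \<inter> (\<Inter>i<n. {y \<in> euc n. y i \<in> ball (x i) e}))"
    by (cases "n = 0") (auto intro!: openin_Int openin_INT)
  also have "euc n \<inter> (\<Inter>i<n. {y \<in> euc n. y i \<in> ball (x i) e}) = sup_ball n x e"
    by (auto simp: sup_ball_def dist_real_def abs_minus_commute)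
  finally show ?thesis .
qed

text \<open>A basic neighbourhood in the product may restrict any coordinate, but those from
  \<open>n\<close> on are fixed at 0, so the smallest of the first \<open>n\<close> radii
  suffices.\<close>

lemma openin_Euclidean_space_iff:
  "openin (Euc n) U \<longleftrightarrow> U \<subseteq> euc n \<and> (\<forall>x\<in>U. \<exists>e>0. sup_ball n x e \<subseteq> U)"
proof (intro iffI conjI ballI)
  assume U: "openin (Euc n) U"
  then show "U \<subseteq> euc n"
    by (rule openin_subset)
  fix x assume x: "x \<in> U"
  obtain T where T: "openin (powertop_real UNIV) T" "U = T \<inter> {x. \<forall>i\<ge>n. x i = 0}"
    using U by (auto simp: Euclidean_space_def openin_subtopology)
  obtain V where V: "\<And>i. open (V i)" "x \<in> PiE UNIV V" "PiE UNIV V \<subseteq> T"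
    using bspec[OF T(1)[unfolded openin_product_topology_alt], of x] x T(2) by auto
  have "\<exists>e>0. ball (x i) e \<subseteq> V i" for i
    using V(1,2) by (metis PiE_mem UNIV_I open_contains_ball)
  then obtain e where e: "\<And>i. e i > 0" "\<And>i. ball (x i) (e i) \<subseteq> V i"
    by metis
  obtain d where d: "d > 0" "\<And>i. i < n \<Longrightarrow> d \<le> e i"
    using uniform_bound_below[of n e] e(1) by blast
  have "sup_ball n x d \<subseteq> U"
  proof
    fix y assume y: "y \<in> sup_ball n x d"
    have "y i \<in> V i" for i
    proof (cases "i < n")
      case True
      then have "y i \<in> ball (x i) (e i)"
        using y d(2)[OF True] by (auto simp: sup_ball_def dist_real_def abs_minus_commute)
      then show ?thesis
        using e(2) by blast
    next
      case False
      then have "y i = x i"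
        using y x T(2) by (auto simp: sup_ball_def mem_euc)
      then show ?thesis
        using V(2) by auto
    qed
    then have "y \<in> T"
      using V(3) by auto
    then show "y \<in> U"
      using y T(2) by (auto simp: sup_ball_def mem_euc)
  qed
  then show "\<exists>e>0. sup_ball n x e \<subseteq> U"
    using d(1) by blast
next
  assume U: "U \<subseteq> euc n \<and> (\<forall>x\<in>U. \<exists>e>0. sup_ball n x e \<subseteq> U)"
  then obtain e where e: "\<And>x. x \<in> U \<Longrightarrow> e x > 0 \<and> sup_ball n x (e x) \<subseteq> U"
    by metis
  have "x \<in> sup_ball n x (e x)" if "x \<in> U" for x
    using that e U by (intro mem_sup_ball_self) auto
  then have "U = (\<Union>x\<in>U. sup_ball n x (e x))"
    using e by (intro equalityI UN_least subsetI UN_I) auto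
  moreover have "openin (Euc n) (\<Union>x\<in>U. sup_ball n x (e x))"
    by (intro openin_Union) (auto simp: openin_sup_ball)
  ultimately show "openin (Euc n) U"
    by simp
qed

lemma in_closure_of_Euclidean:
  "x \<in> Euc n closure_of A \<longleftrightarrow> x \<in> euc n \<and> (\<forall>e>0. \<exists>y\<in>A. y \<in> sup_ball n x e)"
proof (intro iffI conjI allI impI)
  assume x: "x \<in> Euc n closure_of A"
  then show "x \<in> euc n"
    by (simp add: in_closure_of)
  fix e :: real assume "e > 0"
  then have "x \<in> sup_ball n x e"
    using \<open>x \<in> euc n\<close> by (rule mem_sup_ball_self[rotated])
  then show "\<exists>y\<in>A. y \<in> sup_ball n x e"
    using x[unfolded in_closure_of] openin_sup_ball[of n x e] by blast
next
  assume *: "x \<in> euc n \<and> (\<forall>e>0. \<exists>y\<in>A. y \<in> sup_ball n x e)"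
  have "\<exists>y\<in>A. y \<in> T" if T: "x \<in> T" "openin (Euc n) T" for T
  proof -
    obtain e where "e > 0" "sup_ball n x e \<subseteq> T"
      using T unfolding openin_Euclidean_space_iff by blast
    moreover obtain y where "y \<in> A" "y \<in> sup_ball n x e"
      using * \<open>e > 0\<close> by blast
    ultimately show ?thesis
      by blast
  qed
  then show "x \<in> Euc n closure_of A"
    using * unfolding in_closure_of by blast
qed

lemma in_interior_of_Euclidean:
  "x \<in> Euc n interior_of A \<longleftrightarrow> x \<in> euc n \<and> (\<exists>e>0. sup_ball n x e \<subseteq> A)"
proof
  assume "x \<in> Euc n interior_of A"
  then obtain T where "openin (Euc n) T" "x \<in> T" "T \<subseteq> A"
    by (auto simp: interior_of_def)
  then show "x \<in> euc n \<and> (\<exists>e>0. sup_ball n x e \<subseteq> A)"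
    unfolding openin_Euclidean_space_iff by (fast intro: subset_trans)
next
  assume "x \<in> euc n \<and> (\<exists>e>0. sup_ball n x e \<subseteq> A)"
  then obtain e where "x \<in> euc n" "e > 0" "sup_ball n x e \<subseteq> A"
    by blast
  then show "x \<in> Euc n interior_of A"
    using openin_sup_ball[of n x e] mem_sup_ball_self[of x n e] unfolding interior_of_def by auto
qed

definition sup_bounded :: "nat \<Rightarrow> (nat \<Rightarrow> real) set \<Rightarrow> bool" where
  "sup_bounded n A \<longleftrightarrow> (\<exists>C. \<forall>x\<in>A. \<forall>i<n. \<bar>x i\<bar> \<le> C)"

lemma sup_bounded_subset: "sup_bounded n B \<Longrightarrow> A \<subseteq> B \<Longrightarrow> sup_bounded n A"
  unfolding sup_bounded_def by blast

lemma sup_bounded_closure_of: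
  assumes "sup_bounded n A"
  shows "sup_bounded n (Euc n closure_of A)"
proof -
  obtain C where C: "\<And>x i. x \<in> A \<Longrightarrow> i < n \<Longrightarrow> \<bar>x i\<bar> \<le> C"
    using assms unfolding sup_bounded_def by blast
  have "\<bar>x i\<bar> \<le> C + 1" if x: "x \<in> Euc n closure_of A" and i: "i < n" for x i
  proof -
    obtain y where "y \<in> A" "y \<in> sup_ball n x 1"
      using x zero_less_one[where 'a = real] unfolding in_closure_of_Euclidean by blast
    then have "\<bar>y i\<bar> \<le> C" "\<bar>y i - x i\<bar> < 1"
      using C i by (auto simp: sup_ball_def)
    then show ?thesis
      by linarith
  qed
  then show ?thesis
    unfolding sup_bounded_def by blast
qed

text \<open>Heine-Borel: boundedness puts \<open>W\<close> into a product of intervals with factor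
  {0} from index \<open>n\<close> on, which is compact by Tychonoff and lies inside the
  space.\<close>

lemma compactin_Euclidean_space_iff:
  "compactin (Euc n) W \<longleftrightarrow> closedin (Euc n) W \<and> sup_bounded n W"
proof (intro iffI conjI)
  assume W: "compactin (Euc n) W"
  have "Hausdorff_space (Euc n)"
    unfolding Euclidean_space_def
    by (intro Hausdorff_space_subtopology) (simp add: Hausdorff_space_product_topology)
  then show "closedin (Euc n) W"
    using W by (rule compactin_imp_closedin)
  have "\<exists>C. \<forall>x\<in>W. \<bar>x i\<bar> \<le> C" for i
  proof -
    have "compact ((\<lambda>x. x i) ` W)"
      using image_compactin[OF W continuous_map_Euclidean_coordinate] by simp
    then show ?thesis
      using compact_imp_bounded bounded_real by (metis imageI)
  qed
  then obtain C where C: "\<And>i x. x \<in> W \<Longrightarrow> \<bar>x i\<bar> \<le> C i"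
    by metis
  have "\<bar>x i\<bar> \<le> (\<Sum>i<n. \<bar>C i\<bar>)" if "x \<in> W" "i < n" for x i
  proof -
    have "\<bar>C i\<bar> \<le> (\<Sum>i<n. \<bar>C i\<bar>)"
      using that(2) by (intro member_le_sum) auto
    then show ?thesis
      using C[OF that(1), of i] by linarith
  qed
  then show "sup_bounded n W"
    unfolding sup_bounded_def by blast
next
  assume W: "closedin (Euc n) W \<and> sup_bounded n W"
  then obtain C where C: "\<And>x i. x \<in> W \<Longrightarrow> i < n \<Longrightarrow> \<bar>x i\<bar> \<le> C"
    unfolding sup_bounded_def by blast
  let ?K = "PiE UNIV (\<lambda>i. if i < n then {-C..C} else {0::real})"
  have "compactin (powertop_real UNIV) ?K"
    by (auto simp: compactin_PiE)
  moreover have "x i = 0" if "x \<in> ?K" "i \<ge> n" for x i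
    using that(2) PiE_mem[OF that(1) UNIV_I, of i] by simp
  then have "?K \<subseteq> {x. \<forall>i\<ge>n. x i = 0}"
    by blast
  ultimately have K: "compactin (Euc n) ?K"
    unfolding Euclidean_space_def by (simp add: compactin_subtopology)
  have "W \<subseteq> ?K"
  proof
    fix x assume x: "x \<in> W"
    then have "x \<in> euc n"
      using W closedin_subset by blast
    then have "x i \<in> (if i < n then {-C..C} else {0::real})" for i
      using C[OF x, of i] by (cases "i < n") (auto simp: mem_euc abs_le_iff)
    then show "x \<in> ?K"
      by (simp add: PiE_iff)
  qed
  then show "compactin (Euc n) W"
    using closed_compactin[OF K] W by blast
qed

section \<open>Lipschitz maps for the supremum distance\<close>

definition sup_lipschitz :: "nat \<Rightarrow> nat \<Rightarrow> ((nat \<Rightarrow> real) \<Rightarrow> nat \<Rightarrow> real) \<Rightarrow> real \<Rightarrow> bool" where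
  "sup_lipschitz m n f C \<longleftrightarrow> C > 0 \<and> f ` euc m \<subseteq> euc n \<and>
     (\<forall>x\<in>euc m. \<forall>y\<in>euc m. \<forall>d\<ge>0. (\<forall>i<m. \<bar>x i - y i\<bar> \<le> d) \<longrightarrow> (\<forall>i<n. \<bar>f x i - f y i\<bar> \<le> C * d))"

lemma sup_lipschitzD:
  "sup_lipschitz m n f C \<Longrightarrow> x \<in> euc m \<Longrightarrow> y \<in> euc m \<Longrightarrow> 0 \<le> d \<Longrightarrow> (\<And>i. i < m \<Longrightarrow> \<bar>x i - y i\<bar> \<le> d)
    \<Longrightarrow> i < n \<Longrightarrow> \<bar>f x i - f y i\<bar> \<le> C * d"
  unfolding sup_lipschitz_def by blast

lemma sup_lipschitz_continuous_map:
  assumes f: "sup_lipschitz m n f C"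
  shows "continuous_map (Euc m) (Euc n) f"
proof -
  have "openin (Euc m) {x \<in> euc m. f x \<in> U}" if U: "openin (Euc n) U" for U
    unfolding openin_Euclidean_space_iff
  proof (intro conjI ballI)
    fix x assume x: "x \<in> {x \<in> euc m. f x \<in> U}"
    then obtain e where e: "e > 0" "sup_ball n (f x) e \<subseteq> U"
      using U unfolding openin_Euclidean_space_iff by blast
    have C: "C > 0"
      using f by (simp add: sup_lipschitz_def)
    have "sup_ball m x (e / (2 * C)) \<subseteq> {x \<in> euc m. f x \<in> U}"
    proof
      fix y assume y: "y \<in> sup_ball m x (e / (2 * C))"
      then have y': "y \<in> euc m" "f y \<in> euc n"
        using f by (auto simp: sup_ball_def sup_lipschitz_def)
      have "0 \<le> e / (2 * C)"
        using e(1) C by simp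
      then have "\<bar>f y i - f x i\<bar> \<le> C * (e / (2 * C))" if "i < n" for i
        by (intro sup_lipschitzD[OF f]) (use y x that in \<open>auto simp: sup_ball_def intro: less_imp_le\<close>)
      then have "\<bar>f y i - f x i\<bar> < e" if "i < n" for i
        using that C e(1) by force
      then show "y \<in> {x \<in> euc m. f x \<in> U}"
        using y' e(2) by (auto intro!: sup_ballI)
    qed
    then show "\<exists>e>0. sup_ball m x e \<subseteq> {x \<in> euc m. f x \<in> U}"
      using e(1) C by (metis divide_pos_pos mult_pos_pos zero_less_numeral)
  qed auto
  moreover have "f \<in> euc m \<rightarrow> euc n"
    using f by (auto simp: sup_lipschitz_def)
  ultimately show ?thesis
    by (simp add: continuous_map_def)
qed

lemma sup_lipschitz_bounded:
  assumes f: "sup_lipschitz m n f C" and "A \<subseteq> euc m" "sup_bounded m A"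
  shows "sup_bounded n (f ` A)"
proof -
  obtain D where D: "\<And>x i. x \<in> A \<Longrightarrow> i < m \<Longrightarrow> \<bar>x i\<bar> \<le> D"
    using assms(3) unfolding sup_bounded_def by blast
  define E where "E = (\<Sum>i<n. \<bar>f (\<lambda>i. 0) i\<bar>)"
  have "\<bar>f x i\<bar> \<le> C * \<bar>D\<bar> + E" if "x \<in> A" "i < n" for x i
  proof -
    have "\<bar>f x i - f (\<lambda>i. 0) i\<bar> \<le> C * \<bar>D\<bar>"
      by (rule sup_lipschitzD[OF f]) (use that D assms(2) in \<open>force simp: euc_zero\<close>)+
    moreover have "\<bar>f (\<lambda>i. 0) i\<bar> \<le> E"
      unfolding E_def using that by (intro member_le_sum) auto
    ultimately show ?thesis
      by linarith
  qed
  then show ?thesis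
    unfolding sup_bounded_def by blast
qed

lemma sup_lipschitz_affine:
  assumes w: "w \<in> euc n"
  shows "\<exists>C. sup_lipschitz m n (\<lambda>x k. if k < n then w k + (\<Sum>j<m. a k j * x j) else 0) C"
proof -
  \<comment> \<open>The summand 1 keeps the constant positive for a zero matrix or an empty index
    range.\<close>
  define C where "C = 1 + (\<Sum>k<n. \<Sum>j<m. \<bar>a k j\<bar>)"
  have "C > 0"
    unfolding C_def by (intro add_pos_nonneg sum_nonneg) auto
  moreover have "\<bar>(w k + (\<Sum>j<m. a k j * x j)) - (w k + (\<Sum>j<m. a k j * y j))\<bar> \<le> C * d"
    if d0: "d \<ge> 0" and d: "\<forall>i<m. \<bar>x i - y i\<bar> \<le> d" and k: "k < n" for x y d k
  proof -
    have "\<bar>(w k + (\<Sum>j<m. a k j * x j)) - (w k + (\<Sum>j<m. a k j * y j))\<bar>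
        = \<bar>\<Sum>j<m. a k j * (x j - y j)\<bar>"
      by (simp add: sum_subtractf right_diff_distrib)
    also have "\<dots> \<le> (\<Sum>j<m. \<bar>a k j\<bar> * d)"
      using d by (intro order_trans[OF sum_abs] sum_mono) (auto simp: abs_mult intro!: mult_left_mono)
    also have "\<dots> = (\<Sum>j<m. \<bar>a k j\<bar>) * d"
      by (simp add: sum_distrib_right)
    also have "(\<Sum>j<m. \<bar>a k j\<bar>) \<le> (\<Sum>k<n. \<Sum>j<m. \<bar>a k j\<bar>)"
      using k by (intro member_le_sum) (auto intro: sum_nonneg)
    then have "(\<Sum>j<m. \<bar>a k j\<bar>) * d \<le> C * d"
      using d0 by (intro mult_right_mono) (auto simp: C_def)
    finally show ?thesis .
  qed
  ultimately show ?thesis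
    unfolding sup_lipschitz_def by (intro exI[of _ C]) (auto simp: mem_euc)
qed

section \<open>Null sets and Lipschitz maps\<close>

abbreviation leb :: "nat \<Rightarrow> (nat \<Rightarrow> real) measure" where
  "leb n \<equiv> \<Pi>\<^sub>M i\<in>{..<n}. (lborel :: real measure)"

text \<open>The restriction makes indices extensional, so points of one cell have equal indices and
  \<open>card\<close> counts cells.\<close>

definition cell_index :: "nat \<Rightarrow> real \<Rightarrow> (nat \<Rightarrow> real) \<Rightarrow> nat \<Rightarrow> int" where
  "cell_index n h x = (\<lambda>i\<in>{..<n}. \<lfloor>x i / h\<rfloor>)"

definition cell :: "nat \<Rightarrow> real \<Rightarrow> (nat \<Rightarrow> int) \<Rightarrow> (nat \<Rightarrow> real) set" where
  "cell n h z = PiE {..<n} (\<lambda>i. {of_int (z i) * h ..< (of_int (z i) + 1) * h})"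

definition cell_cover :: "nat \<Rightarrow> real \<Rightarrow> (nat \<Rightarrow> real) set \<Rightarrow> (nat \<Rightarrow> real) set" where
  "cell_cover n h S = (\<Union>z\<in>cell_index n h ` S. cell n h z)"

lemma mem_cell_iff:
  assumes "h > 0"
  shows "y \<in> cell n h z \<longleftrightarrow> y \<in> extensional {..<n} \<and> (\<forall>i<n. \<lfloor>y i / h\<rfloor> = z i)"
  using assms by (auto simp: cell_def PiE_iff floor_eq_iff field_simps)

lemma mem_cell_cover_iff:
  assumes "h > 0"
  shows "y \<in> cell_cover n h S \<longleftrightarrow>
    y \<in> extensional {..<n} \<and> (\<exists>x\<in>S. \<forall>i<n. \<lfloor>y i / h\<rfloor> = \<lfloor>x i / h\<rfloor>)"
  using assms by (auto simp: cell_cover_def mem_cell_iff cell_index_def)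

lemma floor_half: "\<lfloor>a\<rfloor> = \<lfloor>2 * a\<rfloor> div (2::int)" for a :: real
  by linarith

lemma same_floor_close:
  fixes a b h :: real
  assumes "h > 0" "\<lfloor>a / h\<rfloor> = \<lfloor>b / h\<rfloor>"
  shows "\<bar>a - b\<bar> < h"
proof -
  have "\<bar>a / h - b / h\<bar> < 1"
    using assms(2) by linarith
  then show ?thesis
    using assms(1) by (simp add: diff_divide_distrib[symmetric] abs_divide)
qed

lemma finite_cell_index:
  assumes "sup_bounded n S"
  shows "finite (cell_index n h ` S)"
proof -
  obtain C where C: "\<And>x i. x \<in> S \<Longrightarrow> i < n \<Longrightarrow> \<bar>x i\<bar> \<le> C"
    using assms unfolding sup_bounded_def by blast
  have "cell_index n h ` S \<subseteq> PiE {..<n} (\<lambda>i. {\<lfloor>- (C / \<bar>h\<bar>)\<rfloor>..\<lfloor>C / \<bar>h\<bar>\<rfloor>})"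
  proof (clarsimp simp: cell_index_def PiE_iff)
    fix x i assume "x \<in> S" "i < n"
    then have "\<bar>x i / h\<bar> \<le> C / \<bar>h\<bar>"
      using C by (auto simp: abs_divide intro: divide_right_mono)
    then have "- (C / \<bar>h\<bar>) \<le> x i / h" "x i / h \<le> C / \<bar>h\<bar>"
      by linarith+
    then show "\<lfloor>- (C / \<bar>h\<bar>)\<rfloor> \<le> \<lfloor>x i / h\<rfloor> \<and> \<lfloor>x i / h\<rfloor> \<le> \<lfloor>C / \<bar>h\<bar>\<rfloor>"
      by (auto intro: floor_mono)
  qed
  then show ?thesis
    by (rule finite_subset) (auto intro: finite_PiE)
qed

lemma emeasure_leb_box:
  assumes "\<And>i. i < n \<Longrightarrow> A i \<in> sets borel"
  shows "PiE {..<n} A \<in> sets (leb n)"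
    and "emeasure (leb n) (PiE {..<n} A) = (\<Prod>i<n. emeasure lborel (A i))"
proof -
  interpret product_sigma_finite "\<lambda>_::nat. lborel :: real measure"
    by standard
  show "PiE {..<n} A \<in> sets (leb n)"
    using assms by (intro sets_PiM_I_finite) auto
  show "emeasure (leb n) (PiE {..<n} A) = (\<Prod>i<n. emeasure lborel (A i))"
    using assms by (intro emeasure_PiM) auto
qed

lemma emeasure_cell:
  assumes "h > 0"
  shows "cell n h z \<in> sets (leb n)" "emeasure (leb n) (cell n h z) = ennreal (h ^ n)"
proof -
  show "cell n h z \<in> sets (leb n)"
    unfolding cell_def by (rule emeasure_leb_box) auto
  have "emeasure (leb n) (cell n h z) = (\<Prod>i<n. emeasure lborel {of_int (z i) * h ..< (of_int (z i) + 1) * h})"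
    unfolding cell_def by (rule emeasure_leb_box) auto
  also have "\<dots> = (\<Prod>i<n. ennreal h)"
    using assms by (intro prod.cong) (auto simp: field_simps)
  finally show "emeasure (leb n) (cell n h z) = ennreal (h ^ n)"
    using assms by (simp add: ennreal_power)
qed

lemma emeasure_cell_cover:
  fixes h :: real
  assumes "h > 0" "sup_bounded n S"
  shows "cell_cover n h S \<in> sets (leb n)"
    and "emeasure (leb n) (cell_cover n h S) = ennreal (card (cell_index n h ` S) * h ^ n)"
proof -
  have fin: "finite (cell_index n h ` S)"
    using assms(2) by (rule finite_cell_index)
  show "cell_cover n h S \<in> sets (leb n)"
    unfolding cell_cover_def using fin emeasure_cell(1)[OF assms(1)] by (intro sets.finite_UN) auto
  have "disjoint_family_on (cell n h) (cell_index n h ` S)"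
    unfolding disjoint_family_on_def
  proof (intro ballI impI)
    fix z z' assume z: "z \<in> cell_index n h ` S" "z' \<in> cell_index n h ` S" "z \<noteq> z'"
    have "y \<notin> cell n h z'" if "y \<in> cell n h z" for y
    proof
      assume "y \<in> cell n h z'"
      then have "z i = z' i" if "i < n" for i
        using \<open>y \<in> cell n h z\<close> that assms(1) by (auto simp: mem_cell_iff)
      moreover have "z i = z' i" if "\<not> i < n" for i
        using z(1,2) that by (auto simp: cell_index_def)
      ultimately show False
        using z(3) by blast
    qed
    then show "cell n h z \<inter> cell n h z' = {}"
      by blast
  qed
  then have "emeasure (leb n) (cell_cover n h S) = (\<Sum>z\<in>cell_index n h ` S. emeasure (leb n) (cell n h z))"
    unfolding cell_cover_def using fin emeasure_cell(1)[OF assms(1)]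
    by (intro sum_emeasure[symmetric]) auto
  then show "emeasure (leb n) (cell_cover n h S) = ennreal (card (cell_index n h ` S) * h ^ n)"
    using assms(1) by (simp add: emeasure_cell ennreal_mult ennreal_of_nat_eq_real_of_nat)
qed

text \<open>Dyadic cells nest: the floor of 2 a determines the floor of a, so points that share a
  cell share its parent.\<close>

lemma decseq_cell_cover: "decseq (\<lambda>k. cell_cover n (1 / 2 ^ k) S)"
proof (intro decseq_SucI subsetI)
  fix k y assume y: "y \<in> cell_cover n (1 / 2 ^ Suc k) S"
  then obtain x where x: "y \<in> extensional {..<n}" "x \<in> S"
      "\<And>i. i < n \<Longrightarrow> \<lfloor>y i / (1 / 2 ^ Suc k)\<rfloor> = \<lfloor>x i / (1 / 2 ^ Suc k)\<rfloor>"
    by (auto simp: mem_cell_cover_iff)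
  have "\<lfloor>y i / (1 / 2 ^ k)\<rfloor> = \<lfloor>x i / (1 / 2 ^ k)\<rfloor>" if "i < n" for i
  proof -
    have "\<lfloor>2 * (y i * 2 ^ k)\<rfloor> = \<lfloor>2 * (x i * 2 ^ k)\<rfloor>"
      using x(3)[OF that] by (simp add: mult_ac)
    then show ?thesis
      using floor_half[of "y i * 2 ^ k"] floor_half[of "x i * 2 ^ k"] by simp
  qed
  then show "y \<in> cell_cover n (1 / 2 ^ k) S"
    using x(1,2) by (auto simp: mem_cell_cover_iff)
qed

text \<open>A point in every cover has points of \<open>S\<close> in its own cell at each mesh,
  hence is a limit of points of \<open>S\<close>.\<close>

lemma Inter_cell_cover:
  assumes "closedin (Euc n) S"
  shows "(\<Inter>k. cell_cover n (1 / 2 ^ k) S) = (\<lambda>x. restrict x {..<n}) ` S"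
proof (intro equalityI subsetI)
  fix y assume y: "y \<in> (\<Inter>k. cell_cover n (1 / 2 ^ k) S)"
  define x where "x = (\<lambda>i. if i < n then y i else 0)"
  have "\<exists>z\<in>S. z \<in> sup_ball n x e" if "e > 0" for e :: real
  proof -
    obtain k where k: "1 / 2 ^ k < e"
      using \<open>e > 0\<close> real_arch_pow_inv[of e "1/2"] by (auto simp: power_divide)
    have "y \<in> cell_cover n (1 / 2 ^ k) S"
      using y by blast
    then obtain z where z: "z \<in> S" "\<And>i. i < n \<Longrightarrow> \<lfloor>y i / (1 / 2 ^ k)\<rfloor> = \<lfloor>z i / (1 / 2 ^ k)\<rfloor>"
      by (auto simp: mem_cell_cover_iff)
    have "\<bar>z i - x i\<bar> < e" if "i < n" for i
      using same_floor_close[of "1 / 2 ^ k" "y i" "z i"] z(2)[OF that] k that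
      by (simp add: x_def abs_minus_commute)
    then show ?thesis
      using z(1) closedin_subset[OF assms] by (intro bexI[of _ z]) (auto intro!: sup_ballI)
  qed
  then have "x \<in> Euc n closure_of S"
    unfolding in_closure_of_Euclidean by (simp add: x_def mem_euc)
  then have "x \<in> S"
    using closure_of_closedin[OF assms] by simp
  moreover have "y \<in> extensional {..<n}"
    using y by (auto simp: mem_cell_cover_iff)
  then have "y = restrict x {..<n}"
    by (auto simp: x_def restrict_def extensional_def)
  ultimately show "y \<in> (\<lambda>x. restrict x {..<n}) ` S"
    by blast
qed (auto simp: mem_cell_cover_iff)

lemma sets_restrict_image:
  assumes "closedin (Euc n) S" "sup_bounded n S"
  shows "(\<lambda>x. restrict x {..<n}) ` S \<in> sets (leb n)"
  unfolding Inter_cell_cover[OF assms(1), symmetric]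
  by (intro sets.countable_INT) (auto intro!: emeasure_cell_cover assms)

text \<open>Continuity from above along the decreasing covers: a compact null set has Jordan content
  zero, which is a statement about numbers of cells.\<close>

lemma card_cells_tendsto:
  assumes "closedin (Euc n) S" "sup_bounded n S" "null_Euclidean n S"
  shows "(\<lambda>k. card (cell_index n (1 / 2 ^ k) ` S) * (1 / 2 ^ k) ^ n :: real) \<longlonglongrightarrow> 0"
proof -
  have "(\<lambda>k. emeasure (leb n) (cell_cover n (1 / 2 ^ k) S)) \<longlonglongrightarrow>
      emeasure (leb n) (\<Inter>k. cell_cover n (1 / 2 ^ k) S)"
    using assms(2)
    by (intro Lim_emeasure_decseq decseq_cell_cover) (auto simp: emeasure_cell_cover)
  then have "(\<lambda>k. ennreal (card (cell_index n (1 / 2 ^ k) ` S) * (1 / 2 ^ k) ^ n)) \<longlonglongrightarrow> ennreal 0"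
    using assms by (simp add: emeasure_cell_cover Inter_cell_cover null_Euclidean_def null_setsD1)
  then show ?thesis
    by (rule tendsto_ennrealD) (auto simp: always_eventually)
qed

text \<open>A cell of side h that meets \<open>S\<close> contributes an image inside a box of side 2
  C h around the image of one chosen point of \<open>S\<close> in that cell. The boxes have total
  volume at most (2 C)^n times the volume of the cell cover, which tends to 0.\<close>

lemma null_Euclidean_sup_lipschitz_image:
  assumes S: "closedin (Euc n) S" "sup_bounded n S" "null_Euclidean n S"
    and f: "sup_lipschitz n n f C" and fS: "closedin (Euc n) (f ` S)"
  shows "null_Euclidean n (f ` S)"
proof -
  let ?N = "\<lambda>k. card (cell_index n (1 / 2 ^ k) ` S)"
  let ?r = "\<lambda>x::nat \<Rightarrow> real. restrict x {..<n}"
  have C: "C > 0"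
    using f by (simp add: sup_lipschitz_def)
  have meas: "?r ` f ` S \<in> sets (leb n)"
    using fS S by (intro sets_restrict_image sup_lipschitz_bounded[OF f]) (auto dest: closedin_subset)
  have bound: "emeasure (leb n) (?r ` f ` S) \<le> ennreal ((2 * C) ^ n * (?N k * (1 / 2 ^ k) ^ n))" for k
  proof -
    define h :: real where "h = 1 / 2 ^ k"
    have h: "h > 0"
      by (simp add: h_def)
    define Z where "Z = cell_index n h ` S"
    define p where "p = (\<lambda>z. SOME x. x \<in> S \<and> cell_index n h x = z)"
    have p: "p z \<in> S" "cell_index n h (p z) = z" if "z \<in> Z" for z
      using that someI_ex[of "\<lambda>x. x \<in> S \<and> cell_index n h x = z"] by (auto simp: Z_def p_def)
    define B where "B = (\<lambda>z. PiE {..<n} (\<lambda>i. {f (p z) i - C * h .. f (p z) i + C * h}))"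
    have fin: "finite Z"
      unfolding Z_def using S(2) by (rule finite_cell_index)
    have B: "B z \<in> sets (leb n)" "emeasure (leb n) (B z) = ennreal ((2 * C * h) ^ n)" for z
    proof -
      show "B z \<in> sets (leb n)"
        unfolding B_def by (rule emeasure_leb_box) auto
      have "emeasure (leb n) (B z) = (\<Prod>i<n. emeasure lborel {f (p z) i - C * h .. f (p z) i + C * h})"
        unfolding B_def by (rule emeasure_leb_box) auto
      also have "\<dots> = (\<Prod>i<n. ennreal (2 * C * h))"
        using h C by (intro prod.cong) auto
      finally show "emeasure (leb n) (B z) = ennreal ((2 * C * h) ^ n)"
        using h C by (simp add: ennreal_power)
    qed
    have "?r ` f ` S \<subseteq> (\<Union>z\<in>Z. B z)"
    proof clarify
      fix x assume x: "x \<in> S"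
      define z where "z = cell_index n h x"
      have z: "z \<in> Z"
        using x by (simp add: Z_def z_def)
      have "\<bar>x i - p z i\<bar> \<le> h" if "i < n" for i
      proof -
        have "cell_index n h (p z) i = cell_index n h x i"
          using p(2)[OF z] by (simp add: z_def)
        then show ?thesis
          using same_floor_close[OF h, of "x i" "p z i"] that by (simp add: cell_index_def)
      qed
      then have "\<bar>f x i - f (p z) i\<bar> \<le> C * h" if "i < n" for i
        using that x p(1)[OF z] closedin_subset[OF S(1)] h
        by (intro sup_lipschitzD[OF f]) auto
      then have "?r (f x) \<in> B z"
        by (force simp: B_def PiE_iff abs_le_iff)
      then show "?r (f x) \<in> (\<Union>z\<in>Z. B z)"
        using z by blast
    qed
    then have "emeasure (leb n) (?r ` f ` S) \<le> emeasure (leb n) (\<Union>z\<in>Z. B z)"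
      using fin B(1) by (intro emeasure_mono sets.finite_UN) auto
    also have "\<dots> \<le> (\<Sum>z\<in>Z. emeasure (leb n) (B z))"
      using fin B(1) by (intro emeasure_subadditive_finite) auto
    also have "\<dots> = ennreal (card Z * (2 * C * h) ^ n)"
      using h C by (simp add: B ennreal_mult ennreal_of_nat_eq_real_of_nat)
    finally show ?thesis
      by (simp add: Z_def h_def power_mult_distrib power_divide mult_ac)
  qed
  have "(\<lambda>k. (2 * C) ^ n * (?N k * (1 / 2 ^ k) ^ n)) \<longlonglongrightarrow> (2 * C) ^ n * 0"
    by (intro tendsto_mult_left card_cells_tendsto S)
  then have "(\<lambda>k. ennreal ((2 * C) ^ n * (?N k * (1 / 2 ^ k) ^ n))) \<longlonglongrightarrow> ennreal 0"
    by (intro tendsto_ennrealI) simp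
  then have "emeasure (leb n) (?r ` f ` S) \<le> ennreal 0"
    using bound by (intro LIMSEQ_le_const) auto
  then show ?thesis
    using meas by (simp add: null_Euclidean_def null_sets_def)
qed

text \<open>Otherwise a countable union of null sets would cover the unit cell, which has measure
  1.\<close>

lemma exists_outside_null_sets:
  assumes "countable I" "\<And>j. j \<in> I \<Longrightarrow> null_Euclidean n (F j)"
  shows "\<exists>x\<in>euc n. \<forall>j\<in>I. x \<notin> F j"
proof (rule ccontr)
  assume *: "\<not> (\<exists>x\<in>euc n. \<forall>j\<in>I. x \<notin> F j)"
  let ?r = "\<lambda>x::nat \<Rightarrow> real. restrict x {..<n}"
  have null: "(\<Union>j\<in>I. ?r ` F j) \<in> null_sets (leb n)"
    using assms by (intro null_sets_UN') (auto simp: null_Euclidean_def)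
  have "cell n 1 (\<lambda>_. 0) \<subseteq> (\<Union>j\<in>I. ?r ` F j)"
  proof
    fix y assume y: "y \<in> cell n 1 (\<lambda>_. 0)"
    define x where "x = (\<lambda>i. if i < n then y i else 0)"
    have "x \<in> euc n"
      by (simp add: x_def mem_euc)
    then obtain j where "j \<in> I" "x \<in> F j"
      using * by blast
    moreover have "y = ?r x"
      using y by (auto simp: mem_cell_iff x_def restrict_def extensional_def)
    ultimately show "y \<in> (\<Union>j\<in>I. ?r ` F j)"
      by blast
  qed
  then have "emeasure (leb n) (cell n 1 (\<lambda>_. 0)) \<le> emeasure (leb n) (\<Union>j\<in>I. ?r ` F j)"
    using null by (intro emeasure_mono) auto
  then show False
    using null by (simp add: emeasure_cell null_setsD1)
qed

section \<open>The hull of a Delone set\<close>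

text \<open>Patches are compared only around the origin; arbitrary centres are brought there by
  \<open>shift\<close>.\<close>

definition agree :: "real \<Rightarrow> 'a::euclidean_space set \<Rightarrow> 'a set \<Rightarrow> bool" where
  "agree \<rho> A B \<longleftrightarrow> (\<forall>x. norm x \<le> \<rho> \<longrightarrow> (x \<in> A \<longleftrightarrow> x \<in> B))"

lemma agreeD: "agree \<rho> A B \<Longrightarrow> norm x \<le> \<rho> \<Longrightarrow> x \<in> A \<longleftrightarrow> x \<in> B"
  by (simp add: agree_def)

lemma agree_refl [simp]: "agree \<rho> A A"
  and agree_sym: "agree \<rho> A B \<Longrightarrow> agree \<rho> B A"
  and agree_trans [trans]: "agree \<rho> A B \<Longrightarrow> agree \<rho> B C \<Longrightarrow> agree \<rho> A C"
  by (simp_all add: agree_def)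

lemma agree_mono: "agree \<rho> A B \<Longrightarrow> \<rho>' \<le> \<rho> \<Longrightarrow> agree \<rho>' A B"
  unfolding agree_def by (meson order_trans)

lemma agree_shift:
  assumes "agree \<rho> A B" "\<rho>' + norm t \<le> \<rho>"
  shows "agree \<rho>' (shift A t) (shift B t)"
  unfolding agree_def mem_shift
proof (intro allI impI)
  fix x :: 'a assume "norm x \<le> \<rho>'"
  then have "norm (x + t) \<le> \<rho>"
    using assms(2) norm_triangle_ineq[of x t] by linarith
  then show "x + t \<in> A \<longleftrightarrow> x + t \<in> B"
    using assms(1) by (simp add: agree_def)
qed

lemma Int_cball_eq_iff_agree: "A \<inter> cball 0 R = B \<inter> cball 0 R \<longleftrightarrow> agree R A B"
  unfolding agree_def by (auto simp: set_eq_iff)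

lemma same_patch_iff_agree: "same_patch \<rho> A u B t \<longleftrightarrow> agree \<rho> (shift A u) (shift B t)"
proof -
  have *: "patch A \<rho> u = (\<lambda>x. x + u) ` (shift A u \<inter> cball 0 \<rho>)" for A :: "'a set" and u
  proof (intro set_eqI iffI)
    fix x assume "x \<in> patch A \<rho> u"
    then have "x - u \<in> shift A u \<inter> cball 0 \<rho>"
      by (simp add: patch_def mem_shift dist_norm norm_minus_commute)
    then show "x \<in> (\<lambda>x. x + u) ` (shift A u \<inter> cball 0 \<rho>)"
      by (rule image_eqI[rotated]) simp
  qed (auto simp: patch_def mem_shift dist_norm)
  have "same_patch \<rho> A u B t \<longleftrightarrow>
      (\<lambda>x. x + t) ` (shift B t \<inter> cball 0 \<rho>) = (\<lambda>x. x + t) ` (shift A u \<inter> cball 0 \<rho>)"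
    unfolding same_patch_def * by (simp add: image_image)
  also have "\<dots> \<longleftrightarrow> shift B t \<inter> cball 0 \<rho> = shift A u \<inter> cball 0 \<rho>"
    by (rule inj_image_eq_iff) (simp add: inj_def)
  finally show ?thesis
    by (auto simp: Int_cball_eq_iff_agree intro: agree_sym)
qed

lemma delone_hull_iff:
  "N \<in> delone_hull \<Lambda> \<longleftrightarrow> delone N \<and> (\<forall>\<rho>>0. \<forall>t. \<exists>u. agree \<rho> (shift \<Lambda> u) (shift N t))"
  by (simp add: delone_hull_def same_patch_iff_agree)

lemma self_mem_delone_hull: "delone \<Lambda> \<Longrightarrow> \<Lambda> \<in> delone_hull \<Lambda>"
  unfolding delone_hull_iff by (meson agree_refl)

text \<open>Both Delone constants of \<Lambda> speak about balls of one fixed radius, and each such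
  ball of \<open>N\<close> is copied from a ball of \<Lambda>. The same constants therefore work for
  \<open>N\<close>.\<close>

lemma delone_locally_from:
  assumes "delone \<Lambda>" and N: "\<And>\<rho> t. \<rho> > 0 \<Longrightarrow> \<exists>u. agree \<rho> (shift \<Lambda> u) (shift N t)"
  shows "delone N"
proof -
  obtain r where r: "r > 0"
      "\<And>c x y. x \<in> \<Lambda> \<inter> cball c r \<Longrightarrow> y \<in> \<Lambda> \<inter> cball c r \<Longrightarrow> x = y"
    using assms(1) unfolding delone_def uniformly_discrete_set_def by blast
  obtain R where R: "R > 0" "\<And>c. \<Lambda> \<inter> cball c R \<noteq> {}"
    using assms(1) unfolding delone_def relatively_dense_set_def by blast
  have "x = y" if xy: "x \<in> N \<inter> cball c r" "y \<in> N \<inter> cball c r" for c x y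
  proof -
    obtain u where u: "agree r (shift \<Lambda> u) (shift N c)"
      using N r(1) by blast
    have "z - c + u \<in> \<Lambda> \<inter> cball u r" if "z \<in> N \<inter> cball c r" for z
    proof -
      have "norm (z - c) \<le> r"
        using that by (simp add: dist_norm norm_minus_commute)
      then show ?thesis
        using that agreeD[OF u, of "z - c"] by (simp add: mem_shift dist_norm norm_minus_commute)
    qed
    then have "x - c + u = y - c + u"
      using xy by (intro r(2)) blast+
    then show ?thesis
      by simp
  qed
  then have "uniformly_discrete_set N"
    using r(1) unfolding uniformly_discrete_set_def by blast
  moreover have "N \<inter> cball c R \<noteq> {}" for c
  proof -
    obtain u where u: "agree R (shift \<Lambda> u) (shift N c)"
      using N R(1) by blast
    obtain x where x: "x \<in> \<Lambda>" "dist u x \<le> R"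
      using R(2)[of u] by auto
    then have "x - u \<in> shift N c"
      using agreeD[OF u, of "x - u"] by (simp add: mem_shift dist_norm norm_minus_commute)
    then have "x - u + c \<in> N \<inter> cball c R"
      using x(2) by (simp add: mem_shift dist_norm norm_minus_commute)
    then show ?thesis
      by blast
  qed
  then have "relatively_dense_set N"
    using R(1) unfolding relatively_dense_set_def by blast
  ultimately show ?thesis
    by (simp add: delone_def)
qed

text \<open>The constant \<open>M\<close> of \<Lambda> works for every pair: a patch of
  \<open>N\<close> comes from \<Lambda>, and so does a large ball of \<open>N'\<close> around
  \<open>c\<close>, within which repetitivity of \<Lambda> finds the patch again.\<close>

lemma hull_repetitive:
  assumes "repetitive \<Lambda>" "\<rho> > 0"
  shows "\<exists>M>0. \<forall>N\<in>delone_hull \<Lambda>. \<forall>N'\<in>delone_hull \<Lambda>. \<forall>t c.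
    \<exists>u\<in>cball c M. agree \<rho> (shift N t) (shift N' u)"
proof -
  obtain M where M: "M > 0" "\<And>c u. \<exists>t\<in>cball c M. agree \<rho> (shift \<Lambda> u) (shift \<Lambda> t)"
    using assms unfolding repetitive_def same_patch_iff_agree by meson
  have "\<exists>u\<in>cball c M. agree \<rho> (shift N t) (shift N' u)"
    if N: "N \<in> delone_hull \<Lambda>" and N': "N' \<in> delone_hull \<Lambda>" for N N' t c
  proof -
    obtain u1 where u1: "agree \<rho> (shift \<Lambda> u1) (shift N t)"
      using N assms(2) unfolding delone_hull_iff by blast
    \<comment> \<open>Radius M + \<rho> is chosen so that every \<rho>-patch centred within
      \<open>M\<close> of the centre is contained in the copied ball.\<close>
    have "M + \<rho> > 0"
      using M(1) assms(2) by simp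
    then obtain u2 where u2: "agree (M + \<rho>) (shift \<Lambda> u2) (shift N' c)"
      using N' unfolding delone_hull_iff by blast
    obtain t' where t': "t' \<in> cball u2 M" "agree \<rho> (shift \<Lambda> u1) (shift \<Lambda> t')"
      using M(2) by blast
    have "norm (t' - u2) \<le> M"
      using t'(1) by (simp add: dist_norm norm_minus_commute)
    then have "agree \<rho> (shift (shift \<Lambda> u2) (t' - u2)) (shift (shift N' c) (t' - u2))"
      by (intro agree_shift[OF u2]) simp
    then have "agree \<rho> (shift \<Lambda> t') (shift N' (c + (t' - u2)))"
      by (simp add: shift_shift)
    then have "agree \<rho> (shift N t) (shift N' (c + (t' - u2)))"
      using agree_trans agree_sym u1 t'(2) by metis
    moreover have "c + (t' - u2) \<in> cball c M"
      using \<open>norm (t' - u2) \<le> M\<close> by (simp add: dist_norm norm_minus_commute)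
    ultimately show ?thesis
      by blast
  qed
  then show ?thesis
    using M(1) by blast
qed

text \<open>Both points are visible in one patch centred at \<open>y\<close>, which is a copy of a
  patch of \<Lambda>. The added 1 keeps its radius positive when \<open>x = y\<close>.\<close>

lemma hull_difference:
  assumes "N \<in> delone_hull \<Lambda>" "x \<in> N" "y \<in> N"
  shows "x - y \<in> difference_set \<Lambda>"
proof -
  have "norm (x - y) + 1 > 0"
    by (simp add: add_nonneg_pos)
  then obtain u where u: "agree (norm (x - y) + 1) (shift \<Lambda> u) (shift N y)"
    using assms(1) unfolding delone_hull_iff by blast
  have "x - y \<in> shift \<Lambda> u" "0 \<in> shift \<Lambda> u"
    using assms agreeD[OF u, of "x - y"] agreeD[OF u, of 0] by (simp_all add: mem_shift)
  then show ?thesis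
    unfolding difference_set_def mem_shift
    by (intro CollectI exI[of _ "x - y + u"] exI[of _ "0 + u"]) simp
qed

lemma delone_nonempty: "delone N \<Longrightarrow> N \<noteq> {}"
  unfolding delone_def relatively_dense_set_def by blast

section \<open>Additive subgroups, and linear forms bounded on relatively dense sets\<close>

lemma add_subgroup_generated: "add_subgroup (generated_subgroup A)"
proof -
  have "add_subgroup (add_subgroup hull A)"
    by (rule hull_in) (simp add: add_subgroup_def)
  then show ?thesis
    by (simp add: generated_subgroup_def)
qed

lemma generated_subgroup_superset: "A \<subseteq> generated_subgroup A"
  by (simp add: generated_subgroup_def hull_subset)

lemma generated_subgroup_minimal: "A \<subseteq> G \<Longrightarrow> add_subgroup G \<Longrightarrow> generated_subgroup A \<subseteq> G"
  by (simp add: generated_subgroup_def hull_minimal)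

lemma add_subgroup_zero: "add_subgroup G \<Longrightarrow> 0 \<in> G"
  and add_subgroup_diff: "add_subgroup G \<Longrightarrow> x \<in> G \<Longrightarrow> y \<in> G \<Longrightarrow> x - y \<in> G"
  by (simp_all add: add_subgroup_def)

lemma add_subgroup_uminus: "add_subgroup G \<Longrightarrow> x \<in> G \<Longrightarrow> - x \<in> G"
  unfolding add_subgroup_def by (metis diff_0)

lemma add_subgroup_add: "add_subgroup G \<Longrightarrow> x \<in> G \<Longrightarrow> y \<in> G \<Longrightarrow> x + y \<in> G"
  using add_subgroup_uminus[of G y] add_subgroup_diff[of G x "- y"] by simp

lemma add_subgroup_sum: "add_subgroup G \<Longrightarrow> (\<And>i. i \<in> I \<Longrightarrow> f i \<in> G) \<Longrightarrow> sum f I \<in> G"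
  by (induction I rule: infinite_finite_induct) (auto intro: add_subgroup_zero add_subgroup_add)

lemma add_subgroup_scale_nat: "add_subgroup G \<Longrightarrow> x \<in> G \<Longrightarrow> real m *\<^sub>R x \<in> G"
  by (induction m) (auto intro: add_subgroup_zero add_subgroup_add simp: scaleR_add_left)

lemma add_subgroup_scale_int: "add_subgroup G \<Longrightarrow> x \<in> G \<Longrightarrow> of_int m *\<^sub>R x \<in> G"
  by (cases m rule: int_cases2) (auto intro: add_subgroup_scale_nat add_subgroup_uminus)

text \<open>Every multiple of \<open>x\<close> has a point of \<open>N\<close> within distance
  \<open>R\<close>, so \<open>f\<close> is bounded along all multiples of \<open>x\<close>, where it
  grows linearly unless \<open>f x = 0\<close>.\<close>

lemma bounded_linear_on_relatively_dense_imp_zero: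
  fixes f :: "'a::euclidean_space \<Rightarrow> real"
  assumes f: "linear f" and N: "relatively_dense_set N" and C: "\<And>t. t \<in> N \<Longrightarrow> \<bar>f t\<bar> \<le> C"
  shows "f x = 0"
proof -
  obtain R where R: "R > 0" "\<And>c. N \<inter> cball c R \<noteq> {}"
    using N unfolding relatively_dense_set_def by blast
  interpret bounded_linear f
    using f by (simp add: linear_conv_bounded_linear)
  obtain K where K: "\<And>x. norm (f x) \<le> norm x * K"
    using bounded by blast
  have bound: "real m * \<bar>f x\<bar> \<le> C + R * \<bar>K\<bar>" for m :: nat
  proof -
    obtain t where t: "t \<in> N" "norm (real m *\<^sub>R x - t) \<le> R"
      using R(2)[of "real m *\<^sub>R x"] by (auto simp: dist_norm)
    have "\<bar>f (real m *\<^sub>R x - t)\<bar> \<le> norm (real m *\<^sub>R x - t) * K"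
      using K[of "real m *\<^sub>R x - t"] by simp
    also have "\<dots> \<le> norm (real m *\<^sub>R x - t) * \<bar>K\<bar>"
      by (intro mult_left_mono) auto
    also have "\<dots> \<le> R * \<bar>K\<bar>"
      using t(2) by (intro mult_right_mono) auto
    finally have "\<bar>real m * f x - f t\<bar> \<le> R * \<bar>K\<bar>"
      by (simp add: diff scaleR)
    moreover have "\<bar>real m * f x\<bar> \<le> \<bar>real m * f x - f t\<bar> + \<bar>f t\<bar>"
      by linarith
    ultimately show ?thesis
      using C[OF t(1)] by (simp add: abs_mult)
  qed
  show ?thesis
  proof (rule ccontr)
    assume "f x \<noteq> 0"
    then obtain m :: nat where "C + R * \<bar>K\<bar> < real m * \<bar>f x\<bar>"
      using reals_Archimedean3[of "\<bar>f x\<bar>"] by auto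
    then show False
      using bound[of m] by linarith
  qed
qed

section \<open>The star map\<close>

locale address_data =
  fixes \<Lambda> :: "'a::euclidean_space set" and v :: "nat \<Rightarrow> 'a" and ell :: "'a \<Rightarrow> nat \<Rightarrow> real"
    and b :: "nat \<Rightarrow> nat \<Rightarrow> real" and s n :: nat
  assumes delone: "delone \<Lambda>"
    and repetitive: "repetitive \<Lambda>"
    and zbasis: "zbasis s v (generated_subgroup (difference_set \<Lambda>))"
    and ell: "address_linear_map \<Lambda> s v ell"
    and onb: "orthonormal_basis s n b (address_kernel s v)"
begin

definition "L = generated_subgroup (difference_set \<Lambda>)"

definition "S = lagarias_star s n v ell b"

definition phi :: "(nat \<Rightarrow> real) \<Rightarrow> 'a" where
  "phi u = (\<Sum>i<s. u i *\<^sub>R v i)"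

text \<open>Synthesis in the basis \<open>b\<close>: it places star coordinates back into the kernel
  of \<open>phi\<close> and inverts \<open>coords\<close> there.\<close>

definition comb :: "(nat \<Rightarrow> real) \<Rightarrow> nat \<Rightarrow> real" where
  "comb a = (\<lambda>i. \<Sum>k<n. a k * b k i)"

definition coords :: "(nat \<Rightarrow> real) \<Rightarrow> nat \<Rightarrow> real" where
  "coords = orthonormal_coords s n b"

abbreviation zc :: "'a \<Rightarrow> nat \<Rightarrow> real" where
  "zc g \<equiv> \<lambda>i. of_int (zcoord s v g i)"

abbreviation Hull :: "'a set set" where
  "Hull \<equiv> delone_hull \<Lambda>"

lemma subgroup_L: "add_subgroup L"
  by (simp add: L_def add_subgroup_generated)

lemma L_zero [simp]: "0 \<in> L"
  and L_add: "x \<in> L \<Longrightarrow> y \<in> L \<Longrightarrow> x + y \<in> L"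
  and L_diff: "x \<in> L \<Longrightarrow> y \<in> L \<Longrightarrow> x - y \<in> L"
  and L_uminus: "x \<in> L \<Longrightarrow> - x \<in> L"
  using subgroup_L by (auto intro: add_subgroup_zero add_subgroup_add add_subgroup_diff add_subgroup_uminus)

lemma hull_difference_L: "N \<in> Hull \<Longrightarrow> x \<in> N \<Longrightarrow> y \<in> N \<Longrightarrow> x - y \<in> L"
  unfolding L_def using hull_difference generated_subgroup_superset by blast

lemma ex1_int_coord: "g \<in> L \<Longrightarrow> \<exists>!c. int_coord s v g c"
  using zbasis by (simp add: zbasis_def L_def)

lemma int_coord_zcoord: "g \<in> L \<Longrightarrow> int_coord s v g (zcoord s v g)"
  unfolding zcoord_def using theI'[OF ex1_int_coord] by blast

lemma zcoord_eqI: "g \<in> L \<Longrightarrow> int_coord s v g c \<Longrightarrow> zcoord s v g = c"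
  unfolding zcoord_def by (rule the1_equality) (rule ex1_int_coord)

lemma zc_euc: "g \<in> L \<Longrightarrow> zc g \<in> euc s"
  using int_coord_zcoord by (simp add: int_coord_def mem_euc)

lemma phi_zc: "g \<in> L \<Longrightarrow> phi (zc g) = g"
  using int_coord_zcoord by (simp add: int_coord_def phi_def)

lemma v_mem_L: "i < s \<Longrightarrow> v i \<in> L"
  using zbasis by (simp add: zbasis_def L_def)

lemma phi_int_mem_L: "phi (\<lambda>i. of_int (c i)) \<in> L"
  unfolding phi_def
  by (intro add_subgroup_sum[OF subgroup_L] add_subgroup_scale_int[OF subgroup_L] v_mem_L) auto

lemma zcoord_phi: "(\<And>i. i \<ge> s \<Longrightarrow> c i = 0) \<Longrightarrow> zcoord s v (phi (\<lambda>i. of_int (c i))) = c"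
  by (rule zcoord_eqI[OF phi_int_mem_L]) (simp add: int_coord_def phi_def)

lemma zc_diff: "x \<in> L \<Longrightarrow> y \<in> L \<Longrightarrow> zcoord s v (x - y) = (\<lambda>i. zcoord s v x i - zcoord s v y i)"
  using int_coord_zcoord[of x] int_coord_zcoord[of y]
  by (intro zcoord_eqI L_diff) (auto simp: int_coord_def scaleR_diff_left sum_subtractf)

lemma zc_zero: "zcoord s v 0 = (\<lambda>i. 0)"
  by (rule zcoord_eqI) (auto simp: int_coord_def)

lemma phi_add: "phi (\<lambda>i. x i + y i) = phi x + phi y"
  and phi_diff: "phi (\<lambda>i. x i - y i) = phi x - phi y"
  and phi_uminus: "phi (\<lambda>i. - x i) = - phi x"
  and phi_scale: "phi (\<lambda>i. c * x i) = c *\<^sub>R phi x"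
  by (simp_all add: phi_def scaleR_add_left scaleR_diff_left sum.distrib sum_subtractf sum_negf
      scaleR_sum_right)

lemma ell_euc: "ell t \<in> euc s"
  using ell by (simp add: address_linear_map_def)

lemma linear_ell: "linear (\<lambda>t. ell t i)"
proof (cases "i < s")
  case False
  then have "ell t i = 0" for t
    using ell_euc[of t] by (simp add: mem_euc)
  then show ?thesis
    by (simp add: linear_zero)
qed (use ell in \<open>simp add: address_linear_map_def\<close>)

lemma ell_add: "ell (x + y) = (\<lambda>i. ell x i + ell y i)"
  and ell_diff: "ell (x - y) = (\<lambda>i. ell x i - ell y i)"
  by (simp_all add: fun_eq_iff linear_add[OF linear_ell] linear_diff[OF linear_ell])

lemma ell_sum: "ell (\<Sum>j\<in>J. c j *\<^sub>R x j) i = (\<Sum>j\<in>J. c j * ell (x j) i)"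
  using linear_sum[OF linear_ell[of i], of "\<lambda>j. c j *\<^sub>R x j" J] linear_scale[OF linear_ell[of i]]
  by simp

text \<open>Shifting \<open>N\<close> by its point \<open>y\<close> gives an element of the
  transversal that contains \<open>x - y\<close>, so the bound that characterises \<open>ell\<close>
  covers all differences inside hull elements.\<close>

lemma ell_bounded:
  "\<exists>C>0. \<forall>N\<in>Hull. \<forall>x\<in>N. \<forall>y\<in>N. \<forall>i. \<bar>zc (x - y) i - ell (x - y) i\<bar> \<le> C"
proof -
  obtain C where C: "C > 0" "\<And>N t. N \<in> transversal \<Lambda> \<Longrightarrow> t \<in> N \<Longrightarrow>
      L2_set (\<lambda>i. zc t i - ell t i) {..<s} \<le> C"
    using ell unfolding address_linear_map_def by blast
  have "\<bar>zc (x - y) i - ell (x - y) i\<bar> \<le> C"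
    if N: "N \<in> Hull" "x \<in> N" "y \<in> N" for N x y i
  proof (cases "i < s")
    case True
    have "shift N y \<in> transversal \<Lambda>" "x - y \<in> shift N y"
      using N by (simp_all add: transversal_def shift_in_delone_hull mem_shift)
    then have "L2_set (\<lambda>i. zc (x - y) i - ell (x - y) i) {..<s} \<le> C"
      by (rule C(2))
    moreover have "\<bar>zc (x - y) i - ell (x - y) i\<bar> \<le> L2_set (\<lambda>i. \<bar>zc (x - y) i - ell (x - y) i\<bar>) {..<s}"
      using True by (intro member_le_L2_set) auto
    ultimately show ?thesis
      by (simp add: L2_set_def)
  next
    case False
    then show ?thesis
      using C(1) zc_euc[OF hull_difference_L[OF N]] ell_euc[of "x - y"] by (simp add: mem_euc)
  qed
  then show ?thesis
    using C(1) by blast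
qed

lemma zero_if_bounded_on_differences:
  assumes f: "linear f" and K: "\<And>x y. x \<in> \<Lambda> \<Longrightarrow> y \<in> \<Lambda> \<Longrightarrow> \<bar>f (x - y)\<bar> \<le> K"
  shows "f t = (0::real)"
proof -
  obtain y where y: "y \<in> \<Lambda>"
    using delone delone_nonempty by blast
  have "relatively_dense_set (shift \<Lambda> y)"
    using delone_shift[OF delone, of y] by (simp add: delone_def)
  moreover have "\<bar>f t\<bar> \<le> K" if "t \<in> shift \<Lambda> y" for t
    using K[OF _ y, of "t + y"] that by (simp add: mem_shift)
  ultimately show ?thesis
    by (rule bounded_linear_on_relatively_dense_imp_zero[OF f])
qed

text \<open>On differences \<open>zc\<close> and \<open>ell\<close> stay boundedly close. A form
  bounded on the integer coordinates is thus bounded on \<open>ell\<close> over a relatively dense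
  set, where linearity makes it vanish.\<close>

lemma zero_if_bounded_on_coordinates:
  assumes K: "\<And>x y. x \<in> \<Lambda> \<Longrightarrow> y \<in> \<Lambda> \<Longrightarrow> \<bar>\<Sum>i<s. zc (x - y) i * a i\<bar> \<le> K"
  shows "(\<Sum>i<s. ell t i * a i) = 0"
proof -
  obtain C where "C > 0" and C: "\<And>N x y i. N \<in> Hull \<Longrightarrow> x \<in> N \<Longrightarrow> y \<in> N \<Longrightarrow>
      \<bar>zc (x - y) i - ell (x - y) i\<bar> \<le> C"
    using ell_bounded by meson
  have "linear (\<lambda>t. ell t i * a i)" for i
    by (rule linearI) (simp_all add: ell_add linear_scale[OF linear_ell] distrib_right)
  then have "linear (\<lambda>t. \<Sum>i<s. ell t i * a i)"
    by (intro linear_compose_sum) blast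
  moreover have "\<bar>\<Sum>i<s. ell (x - y) i * a i\<bar> \<le> K + (\<Sum>i<s. C * \<bar>a i\<bar>)" if xy: "x \<in> \<Lambda>" "y \<in> \<Lambda>" for x y
  proof -
    have "(\<Sum>i<s. ell (x - y) i * a i)
        = (\<Sum>i<s. zc (x - y) i * a i) - (\<Sum>i<s. (zc (x - y) i - ell (x - y) i) * a i)"
      by (simp add: left_diff_distrib sum_subtractf)
    moreover have "\<bar>\<Sum>i<s. (zc (x - y) i - ell (x - y) i) * a i\<bar> \<le> (\<Sum>i<s. C * \<bar>a i\<bar>)"
      using C[OF self_mem_delone_hull[OF delone] xy]
      by (intro order_trans[OF sum_abs] sum_mono) (auto simp: abs_mult intro: mult_right_mono)
    ultimately show ?thesis
      using K[OF xy] by linarith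
  qed
  ultimately show ?thesis
    by (rule zero_if_bounded_on_differences[where f = "\<lambda>t. \<Sum>i<s. ell t i * a i"])
qed

text \<open>The defect t - phi (ell t) is linear, and on differences of \<Lambda> it equals phi (zc
  - ell), which is bounded; a linear map bounded on a relatively dense set is zero.\<close>

lemma phi_ell: "phi (ell t) = t"
proof (rule euclidean_eqI)
  fix e :: 'a assume e: "e \<in> Basis"
  obtain C where "C > 0" and C: "\<And>N x y i. N \<in> Hull \<Longrightarrow> x \<in> N \<Longrightarrow> y \<in> N \<Longrightarrow>
      \<bar>zc (x - y) i - ell (x - y) i\<bar> \<le> C"
    using ell_bounded by meson
  have \<Lambda>: "\<Lambda> \<in> Hull"
    using delone by (rule self_mem_delone_hull)
  have "phi (ell (x + y)) = phi (ell x) + phi (ell y)" for x y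
    by (simp add: ell_add phi_add)
  moreover have "phi (ell (c *\<^sub>R x)) = c *\<^sub>R phi (ell x)" for c x
    by (simp add: linear_scale[OF linear_ell] phi_def scaleR_sum_right)
  ultimately have "linear (\<lambda>t. (t - phi (ell t)) \<bullet> e)"
    by (intro linearI) (simp_all add: inner_diff_left inner_add_left right_diff_distrib)
  moreover have "\<bar>(x - y - phi (ell (x - y))) \<bullet> e\<bar> \<le> (\<Sum>i<s. C * \<bar>v i \<bullet> e\<bar>)"
    if xy: "x \<in> \<Lambda>" "y \<in> \<Lambda>" for x y
  proof -
    have "x - y - phi (ell (x - y)) = phi (\<lambda>i. zc (x - y) i - ell (x - y) i)"
      by (simp add: phi_diff phi_zc hull_difference_L[OF \<Lambda> xy])
    then have "(x - y - phi (ell (x - y))) \<bullet> e = (\<Sum>i<s. (zc (x - y) i - ell (x - y) i) * (v i \<bullet> e))"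
      by (simp add: phi_def inner_sum_left)
    also have "\<bar>\<dots>\<bar> \<le> (\<Sum>i<s. C * \<bar>v i \<bullet> e\<bar>)"
      using C[OF \<Lambda> xy] by (intro order_trans[OF sum_abs] sum_mono) (auto simp: abs_mult intro: mult_right_mono)
    finally show ?thesis .
  qed
  ultimately have "(t - phi (ell t)) \<bullet> e = 0"
    by (rule zero_if_bounded_on_differences[where f = "\<lambda>t. (t - phi (ell t)) \<bullet> e"])
  then show "phi (ell t) \<bullet> e = t \<bullet> e"
    by (simp add: inner_diff_left)
qed

lemma b_kernel: "k < n \<Longrightarrow> b k \<in> euc s" "k < n \<Longrightarrow> phi (b k) = 0"
  using onb by (auto simp: orthonormal_basis_def address_kernel_def phi_def)

lemma comb_euc: "comb a \<in> euc s"
  using b_kernel(1) by (auto simp: comb_def mem_euc)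

lemma comb_diff: "comb (\<lambda>k. x k - y k) = (\<lambda>i. comb x i - comb y i)"
  and comb_uminus: "comb (\<lambda>k. - x k) = (\<lambda>i. - comb x i)"
  by (simp_all add: comb_def left_diff_distrib sum_subtractf sum_negf)

lemma phi_comb: "phi (comb a) = 0"
proof -
  have "phi (comb a) = (\<Sum>i<s. \<Sum>k<n. a k *\<^sub>R (b k i *\<^sub>R v i))"
    by (simp add: phi_def comb_def scaleR_sum_left)
  also have "\<dots> = (\<Sum>k<n. a k *\<^sub>R phi (b k))"
    by (subst sum.swap) (simp add: phi_def scaleR_sum_right)
  finally show ?thesis
    using b_kernel(2) by simp
qed

lemma coords_comb: "k < n \<Longrightarrow> coords (comb a) k = a k"
proof -
  assume k: "k < n"
  have "coords (comb a) k = (\<Sum>i<s. \<Sum>j<n. a j * (b j i * b k i))"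
    using k by (simp add: coords_def orthonormal_coords_def comb_def sum_distrib_right mult.assoc)
  also have "\<dots> = (\<Sum>j<n. a j * (\<Sum>i<s. b j i * b k i))"
    by (subst sum.swap) (simp add: sum_distrib_left)
  also have "\<dots> = (\<Sum>j<n. a j * (if j = k then 1 else 0))"
    using onb k by (intro sum.cong) (auto simp: orthonormal_basis_def)
  also have "\<dots> = a k"
    using k by (simp add: if_distrib[where f = "\<lambda>x. _ * x"] cong: if_cong)
  finally show ?thesis .
qed

lemma comb_coords:
  assumes "u \<in> euc s" "phi u = 0"
  shows "comb (coords u) = u"
proof -
  have "u \<in> address_kernel s v"
    using assms by (simp add: address_kernel_def phi_def)
  then obtain c where "\<And>i. u i = (\<Sum>j<n. c j * b j i)"
    using onb unfolding orthonormal_basis_def by blast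
  then have u: "u = comb c"
    by (auto simp: comb_def)
  then have "comb (coords u) i = comb c i" for i
    using coords_comb[of _ c] by (auto simp: comb_def intro!: sum.cong)
  then show ?thesis
    using u by blast
qed

lemma coords_euc: "coords u \<in> euc n"
  by (simp add: coords_def orthonormal_coords_def mem_euc)

lemma coords_diff: "coords (\<lambda>i. x i - y i) = (\<lambda>k. coords x k - coords y k)"
  by (auto simp: coords_def orthonormal_coords_def left_diff_distrib sum_subtractf)

text \<open>The star map is defined on basis vectors and extended by integer combinations; linearity
  of \<open>ell\<close> collapses the combination to one kernel vector.\<close>

lemma S_eq_coords:
  assumes g: "g \<in> L"
  shows "S g = coords (\<lambda>i. ell g i - zc g i)"
proof
  fix k
  show "S g k = coords (\<lambda>i. ell g i - zc g i) k"
  proof (cases "k < n")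
    case True
    have gs: "(\<Sum>j<s. zc g j *\<^sub>R v j) = g"
      using phi_zc[OF g] by (simp add: phi_def)
    have "S g k = (\<Sum>j<s. \<Sum>i<s. zc g j * ((ell (v j) i - (if i = j then 1 else 0)) * b k i))"
      using True by (simp add: S_def lagarias_star_def basis_star_def orthonormal_coords_def sum_distrib_left)
    also have "\<dots> = (\<Sum>i<s. (\<Sum>j<s. zc g j * (ell (v j) i - (if i = j then 1 else 0))) * b k i)"
      by (subst sum.swap) (simp add: sum_distrib_right mult.assoc)
    also have "\<dots> = (\<Sum>i<s. (ell g i - zc g i) * b k i)"
    proof (intro sum.cong refl)
      fix i assume i: "i \<in> {..<s}"
      have "(\<Sum>j<s. zc g j * (ell (v j) i - (if i = j then 1 else 0)))
          = (\<Sum>j<s. zc g j * ell (v j) i) - (\<Sum>j<s. zc g j * (if i = j then 1 else 0))"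
        by (simp add: right_diff_distrib sum_subtractf)
      also have "(\<Sum>j<s. zc g j * ell (v j) i) = ell g i"
        using ell_sum[of "zc g" v "{..<s}" i] by (simp add: gs)
      also have "(\<Sum>j<s. zc g j * (if i = j then 1 else 0)) = zc g i"
        using i by (simp add: if_distrib[where f = "\<lambda>x. _ * x"] cong: if_cong)
      finally show "(\<Sum>j<s. zc g j * (ell (v j) i - (if i = j then 1 else 0))) * b k i
          = (ell g i - zc g i) * b k i"
        by simp
    qed
    finally show ?thesis
      using True by (simp add: coords_def orthonormal_coords_def)
  next
    case False
    then show ?thesis
      by (simp add: S_def lagarias_star_def basis_star_def orthonormal_coords_def coords_def)
  qed
qed

lemma S_euc: "S g \<in> euc n"
  by (simp add: S_def lagarias_star_def basis_star_def orthonormal_coords_def mem_euc)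

text \<open>The vector ell g - zc g lies in the kernel because \<open>phi\<close> sends both terms
  to \<open>g\<close>. Read as zc g = ell g - comb (S g), it recovers the integer coordinates from
  position and star.\<close>

lemma comb_S: "g \<in> L \<Longrightarrow> comb (S g) = (\<lambda>i. ell g i - zc g i)"
  unfolding S_eq_coords
  by (intro comb_coords euc_diff ell_euc zc_euc) (simp_all add: phi_diff phi_ell phi_zc)

lemma S_diff: "x \<in> L \<Longrightarrow> y \<in> L \<Longrightarrow> S (x - y) = (\<lambda>k. S x k - S y k)"
  by (simp add: S_eq_coords L_diff zc_diff ell_diff coords_def orthonormal_coords_def fun_eq_iff
      left_diff_distrib sum_subtractf)

lemma S_zero: "S 0 = (\<lambda>k. 0)"
  using S_diff[of 0 0] by simp

lemma S_uminus: "x \<in> L \<Longrightarrow> S (- x) = (\<lambda>k. - S x k)"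
  using S_diff[of 0 x] by (simp add: S_zero)

lemma S_add: "x \<in> L \<Longrightarrow> y \<in> L \<Longrightarrow> S (x + y) = (\<lambda>k. S x k + S y k)"
  using S_diff[of x "- y"] by (simp add: S_uminus L_uminus)

section \<open>Linear bounds between integer coordinates, positions and stars\<close>

lemma coords_le:
  "\<exists>K>0. \<forall>u C k. 0 \<le> C \<longrightarrow> (\<forall>i<s. \<bar>u i\<bar> \<le> C) \<longrightarrow> \<bar>coords u k\<bar> \<le> K * C"
proof -
  define K where "K = 1 + (\<Sum>k<n. \<Sum>i<s. \<bar>b k i\<bar>)"
  have K: "K > 0"
    unfolding K_def by (intro add_pos_nonneg sum_nonneg) auto
  have "\<bar>coords u k\<bar> \<le> K * C" if C: "0 \<le> C" "\<And>i. i < s \<Longrightarrow> \<bar>u i\<bar> \<le> C" for u C k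
  proof (cases "k < n")
    case True
    have "\<bar>coords u k\<bar> \<le> (\<Sum>i<s. C * \<bar>b k i\<bar>)"
      unfolding coords_def orthonormal_coords_def using True C
      by (auto simp: abs_mult intro!: order_trans[OF sum_abs] sum_mono mult_right_mono)
    also have "\<dots> = C * (\<Sum>i<s. \<bar>b k i\<bar>)"
      by (simp add: sum_distrib_left)
    also have "(\<Sum>i<s. \<bar>b k i\<bar>) \<le> (\<Sum>k<n. \<Sum>i<s. \<bar>b k i\<bar>)"
      using True by (intro member_le_sum) (auto intro: sum_nonneg)
    then have "C * (\<Sum>i<s. \<bar>b k i\<bar>) \<le> C * K"
      using C(1) by (intro mult_left_mono) (auto simp: K_def)
    finally show ?thesis
      by (simp add: mult.commute)
  next
    case False
    then show ?thesis
      using K C(1) by (simp add: coords_def orthonormal_coords_def)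
  qed
  then show ?thesis
    using K by blast
qed

lemma S_bounded:
  "\<exists>C>0. \<forall>N\<in>Hull. \<forall>x\<in>N. \<forall>y\<in>N. \<forall>k. \<bar>S (x - y) k\<bar> \<le> C"
proof -
  obtain C where C: "C > 0" "\<And>N x y i. N \<in> Hull \<Longrightarrow> x \<in> N \<Longrightarrow> y \<in> N \<Longrightarrow>
      \<bar>zc (x - y) i - ell (x - y) i\<bar> \<le> C"
    using ell_bounded by meson
  obtain K where K: "K > 0" "\<And>u C k. 0 \<le> C \<Longrightarrow> (\<And>i. i < s \<Longrightarrow> \<bar>u i\<bar> \<le> C) \<Longrightarrow> \<bar>coords u k\<bar> \<le> K * C"
    using coords_le by meson
  have "\<bar>S (x - y) k\<bar> \<le> K * C" if "N \<in> Hull" "x \<in> N" "y \<in> N" for N x y k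
    unfolding S_eq_coords[OF hull_difference_L[OF that]]
    using C that by (intro K(2)) (auto simp: abs_minus_commute)
  then show ?thesis
    using C(1) K(1) by (intro exI[of _ "K * C"]) simp
qed

lemma comb_le:
  "\<exists>K>0. \<forall>a C i. 0 \<le> C \<longrightarrow> (\<forall>k<n. \<bar>a k\<bar> \<le> C) \<longrightarrow> \<bar>comb a i\<bar> \<le> K * C"
proof -
  define K where "K = 1 + (\<Sum>i<s. \<Sum>k<n. \<bar>b k i\<bar>)"
  have K: "K > 0"
    unfolding K_def by (intro add_pos_nonneg sum_nonneg) auto
  have "\<bar>comb a i\<bar> \<le> K * C" if C: "0 \<le> C" "\<And>k. k < n \<Longrightarrow> \<bar>a k\<bar> \<le> C" for a C i
  proof (cases "i < s")
    case True
    have "\<bar>comb a i\<bar> \<le> (\<Sum>k<n. C * \<bar>b k i\<bar>)"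
      unfolding comb_def using C
      by (auto simp: abs_mult intro!: order_trans[OF sum_abs] sum_mono mult_right_mono)
    also have "\<dots> = C * (\<Sum>k<n. \<bar>b k i\<bar>)"
      by (simp add: sum_distrib_left)
    also have "(\<Sum>k<n. \<bar>b k i\<bar>) \<le> (\<Sum>i<s. \<Sum>k<n. \<bar>b k i\<bar>)"
      using True by (intro member_le_sum) (auto intro: sum_nonneg)
    then have "C * (\<Sum>k<n. \<bar>b k i\<bar>) \<le> C * K"
      using C(1) by (intro mult_left_mono) (auto simp: K_def)
    finally show ?thesis
      by (simp add: mult.commute)
  next
    case False
    then show ?thesis
      using K C(1) comb_euc[of a] by (simp add: mem_euc)
  qed
  then show ?thesis
    using K by blast
qed

lemma ell_le: "\<exists>K>0. \<forall>t i. \<bar>ell t i\<bar> \<le> K * norm t"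
proof -
  have "\<exists>K>0. \<forall>t. \<bar>ell t i\<bar> \<le> norm t * K" for i
    using bounded_linear.pos_bounded[of "\<lambda>t. ell t i"] linear_ell[of i]
    by (auto simp: linear_conv_bounded_linear)
  then obtain K where K: "\<And>i. K i > 0" "\<And>i t. \<bar>ell t i\<bar> \<le> norm t * K i"
    by metis
  define K' where "K' = 1 + (\<Sum>i<s. K i)"
  have K': "K' > 0"
    unfolding K'_def using K(1) by (intro add_pos_nonneg sum_nonneg) (auto intro: less_imp_le)
  have "\<bar>ell t i\<bar> \<le> K' * norm t" for t i
  proof (cases "i < s")
    case True
    have "K i \<le> (\<Sum>i<s. K i)"
      using True K(1) by (intro member_le_sum) (auto intro: less_imp_le)
    then have "norm t * K i \<le> norm t * K'"
      by (intro mult_left_mono) (auto simp: K'_def)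
    then show ?thesis
      using K(2)[of t i] by (simp add: mult.commute)
  next
    case False
    then show ?thesis
      using K' ell_euc[of t] by (simp add: mem_euc)
  qed
  then show ?thesis
    using K' by blast
qed

text \<open>The graph of \<open>S\<close> is the image of \<open>\<int>\<^sup>s\<close> under an injective linear map.\<close>

lemma graph_separated:
  "\<exists>e>0. \<forall>g\<in>L. norm g < e \<longrightarrow> (\<forall>k<n. \<bar>S g k\<bar> < e) \<longrightarrow> g = 0"
proof -
  obtain K where K: "K > 0" "\<And>t i. \<bar>ell t i\<bar> \<le> K * norm t"
    using ell_le by meson
  obtain K' where K': "K' > 0" "\<And>a C i. 0 \<le> C \<Longrightarrow> (\<And>k. k < n \<Longrightarrow> \<bar>a k\<bar> \<le> C) \<Longrightarrow> \<bar>comb a i\<bar> \<le> K' * C"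
    using comb_le by meson
  \<comment> \<open>With this value each integer coordinate of \<open>g\<close> has modulus below 1
    and is therefore 0.\<close>
  define e where "e = 1 / (2 * (K + K'))"
  have e: "e > 0" "(K + K') * e < 1"
    using K(1) K'(1) by (simp_all add: e_def)
  have "g = 0" if g: "g \<in> L" "norm g < e" "\<And>k. k < n \<Longrightarrow> \<bar>S g k\<bar> < e" for g
  proof -
    have "zcoord s v g i = 0" for i
    proof -
      have "zc g i = ell g i - comb (S g) i"
        using comb_S[OF g(1)] by simp
      moreover have "\<bar>ell g i\<bar> \<le> K * e"
        using K(1) g(2) by (intro order_trans[OF K(2)] mult_left_mono) auto
      moreover have "\<bar>comb (S g) i\<bar> \<le> K' * e"
        using e(1) g(3) by (intro K'(2)) (auto intro: less_imp_le)
      moreover have "K * e + K' * e < 1"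
        using e(2) by (simp add: distrib_right)
      ultimately have "\<bar>zc g i\<bar> < 1"
        by linarith
      then show ?thesis
        by linarith
    qed
    then show "g = 0"
      using phi_zc[OF g(1)] by (simp add: phi_def)
  qed
  then show ?thesis
    using e(1) by blast
qed

end

section \<open>Corners and compactness\<close>

lemma mem_translate_iff: "x \<in> translate w V \<longleftrightarrow> (\<lambda>i. x i - w i) \<in> V"
  unfolding translate_def
proof
  assume "(\<lambda>i. x i - w i) \<in> V"
  then show "x \<in> (\<lambda>x i. w i + x i) ` V"
    by (rule image_eqI[rotated]) auto
qed auto

lemma sup_lipschitz_translate: "w \<in> euc n \<Longrightarrow> sup_lipschitz n n (\<lambda>x i. w i + x i) 1"
  by (auto simp: sup_lipschitz_def euc_add)

lemma homeomorphic_map_translate: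
  assumes "w \<in> euc n"
  shows "homeomorphic_map (Euc n) (Euc n) (\<lambda>x i. w i + x i)"
proof -
  have "homeomorphic_maps (Euc n) (Euc n) (\<lambda>x i. w i + x i) (\<lambda>x i. - w i + x i)"
    unfolding homeomorphic_maps_def
    using assms euc_uminus[OF assms]
    by (intro conjI sup_lipschitz_continuous_map[OF sup_lipschitz_translate]) auto
  then show ?thesis
    by (rule homeomorphic_maps_imp_map)
qed

context address_data
begin

lemma countable_L: "countable L"
proof -
  have "g \<in> (\<lambda>c. phi (\<lambda>i. of_int (c i))) ` PiE {..<s} (\<lambda>_. UNIV)" if "g \<in> L" for g
  proof
    show "g = phi (\<lambda>i. of_int (restrict (zcoord s v g) {..<s} i))"
      using phi_zc[OF that] by (simp add: phi_def)
    show "restrict (zcoord s v g) {..<s} \<in> PiE {..<s} (\<lambda>_. UNIV)"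
      unfolding restrict_PiE_iff by simp
  qed
  then have "L \<subseteq> (\<lambda>c. phi (\<lambda>i. of_int (c i))) ` PiE {..<s} (\<lambda>_. UNIV)"
    by blast
  then show ?thesis
    by (rule countable_subset) (intro countable_image countable_PiE; simp)
qed

text \<open>Bounds on position and star bound the integer coordinates, by \<open>comb_S\<close>.
  This local finiteness later turns pointwise convergence of sets into agreement on balls.\<close>

lemma finite_bounded_star: "finite {g \<in> L. norm g \<le> R \<and> (\<forall>k<n. \<bar>S g k\<bar> \<le> C)}"
proof -
  obtain K where K: "K > 0" "\<And>t i. \<bar>ell t i\<bar> \<le> K * norm t"
    using ell_le by meson
  obtain K' where K': "K' > 0" "\<And>a C i. 0 \<le> C \<Longrightarrow> (\<forall>k<n. \<bar>a k\<bar> \<le> C) \<Longrightarrow> \<bar>comb a i\<bar> \<le> K' * C"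
    using comb_le by meson
  define B where "B = \<lceil>K * R + K' * \<bar>C\<bar>\<rceil>"
  have "g \<in> (\<lambda>c. phi (\<lambda>i. of_int (c i))) ` PiE {..<s} (\<lambda>_. {-B..B})"
    if g: "g \<in> L" "norm g \<le> R" "\<forall>k<n. \<bar>S g k\<bar> \<le> C" for g
  proof
    show "g = phi (\<lambda>i. of_int (restrict (zcoord s v g) {..<s} i))"
      using phi_zc[OF g(1)] by (simp add: phi_def)
    have "zcoord s v g i \<in> {-B..B}" for i
    proof -
      have "zc g i = ell g i - comb (S g) i"
        using comb_S[OF g(1)] by simp
      moreover have "\<bar>ell g i\<bar> \<le> K * R"
        using K(1) g(2) by (intro order_trans[OF K(2)] mult_left_mono) auto
      moreover have "\<bar>comb (S g) i\<bar> \<le> K' * \<bar>C\<bar>"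
        using g(3) by (intro K'(2)) (auto intro: order_trans)
      ultimately have "\<bar>zc g i\<bar> \<le> K * R + K' * \<bar>C\<bar>"
        by linarith
      then have "\<bar>zcoord s v g i\<bar> \<le> B"
        unfolding B_def by linarith
      then show ?thesis
        by auto
    qed
    then show "restrict (zcoord s v g) {..<s} \<in> PiE {..<s} (\<lambda>_. {-B..B})"
      by auto
  qed
  then have "{g \<in> L. norm g \<le> R \<and> (\<forall>k<n. \<bar>S g k\<bar> \<le> C)}
      \<subseteq> (\<lambda>c. phi (\<lambda>i. of_int (c i))) ` PiE {..<s} (\<lambda>_. {-B..B})"
    by blast
  then show ?thesis
    by (rule finite_subset) (intro finite_imageI finite_PiE; simp)
qed

text \<open>\<open>S\<close> is additive only on \<open>L\<close>, so corners make sense for these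
  sets; shifting any hull element by one of its own points lands here.\<close>

definition "HL = {N \<in> Hull. N \<subseteq> L}"

lemma HL_hull: "N \<in> HL \<Longrightarrow> N \<in> Hull"
  by (simp add: HL_def)

lemma HL_mem_L: "N \<in> HL \<Longrightarrow> g \<in> N \<Longrightarrow> g \<in> L"
  by (auto simp: HL_def)

lemma HL_nonempty: "N \<in> HL \<Longrightarrow> \<exists>g. g \<in> N"
  using delone_nonempty[of N] by (auto simp: HL_def delone_hull_iff)

lemma HL_shift:
  assumes "N \<in> HL" "g \<in> L"
  shows "shift N g \<in> HL"
proof -
  have "x \<in> L" if "x \<in> shift N g" for x
    using L_diff[of "x + g" g] that assms HL_mem_L[of N "x + g"] by (simp add: mem_shift)
  then show ?thesis
    using assms(1) by (auto simp: HL_def shift_in_delone_hull)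
qed

lemma shift_mem_HL:
  assumes "M \<in> Hull" "x \<in> M"
  shows "shift M x \<in> HL"
proof -
  have "y \<in> L" if "y \<in> shift M x" for y
    using hull_difference_L[OF assms(1) _ assms(2), of "y + x"] that by (simp add: mem_shift)
  then show ?thesis
    using assms(1) by (auto simp: HL_def shift_in_delone_hull)
qed

text \<open>The lower corner of the bounding box of \<open>S(N)\<close> is a translation covariant point attached to
  \<open>N\<close>; repetitivity makes it depend continuously on \<open>N\<close>.\<close>

definition corner :: "'a set \<Rightarrow> nat \<Rightarrow> real" where
  "corner N = (\<lambda>k. if k < n then Inf ((\<lambda>g. S g k) ` N) else 0)"

lemma corner_euc: "corner N \<in> euc n"
  by (simp add: corner_def mem_euc)

lemma bdd_below_star: "N \<in> HL \<Longrightarrow> bdd_below ((\<lambda>g. S g k) ` N)"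
proof -
  assume N: "N \<in> HL"
  obtain C where C: "\<And>N x y k. N \<in> Hull \<Longrightarrow> x \<in> N \<Longrightarrow> y \<in> N \<Longrightarrow> \<bar>S (x - y) k\<bar> \<le> C"
    using S_bounded by meson
  obtain y where y: "y \<in> N"
    using HL_nonempty[OF N] by blast
  have "S y k - C \<le> S x k" if "x \<in> N" for x
    using C[OF HL_hull[OF N] y that, of k] S_diff[OF HL_mem_L[OF N y] HL_mem_L[OF N that]]
    by (simp add: abs_le_iff)
  then show ?thesis
    by (intro bdd_belowI2)
qed

lemma corner_le: "N \<in> HL \<Longrightarrow> g \<in> N \<Longrightarrow> k < n \<Longrightarrow> corner N k \<le> S g k"
  by (simp add: corner_def cInf_lower bdd_below_star)

lemma corner_ge: "N \<in> HL \<Longrightarrow> k < n \<Longrightarrow> (\<And>g. g \<in> N \<Longrightarrow> c \<le> S g k) \<Longrightarrow> c \<le> corner N k"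
  using HL_nonempty[of N] by (auto simp: corner_def intro!: cInf_greatest)

lemma corner_shift:
  assumes N: "N \<in> HL" and u: "u \<in> L"
  shows "corner (shift N u) = (\<lambda>k. corner N k - S u k)"
proof (rule euc_eqI[OF corner_euc])
  show "(\<lambda>k. corner N k - S u k) \<in> euc n"
    by (intro euc_diff corner_euc S_euc)
  fix k assume k: "k < n"
  show "corner (shift N u) k = corner N k - S u k"
  proof (rule antisym)
    have "corner (shift N u) k + S u k \<le> S g k" if g: "g \<in> N" for g
      using corner_le[OF HL_shift[OF N u] _ k, of "g - u"] g S_diff[OF HL_mem_L[OF N g] u]
      by (simp add: mem_shift)
    then show "corner (shift N u) k \<le> corner N k - S u k"
      using corner_ge[OF N k, of "corner (shift N u) k + S u k"] by simp
    show "corner N k - S u k \<le> corner (shift N u) k"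
    proof (rule corner_ge[OF HL_shift[OF N u] k])
      fix g assume "g \<in> shift N u"
      then have g: "g + u \<in> N"
        by (simp add: mem_shift)
      then have "g \<in> L"
        using L_diff[OF HL_mem_L[OF N g] u] by simp
      then show "corner N k - S u k \<le> S g k"
        using corner_le[OF N g k] S_add[OF _ u] by simp
    qed
  qed
qed

text \<open>Choose \<open>x0\<close>, \<open>y0\<close> in \<Lambda> whose difference has k-th star
  coordinate within \<open>e\<close> of the supremum \<open>D\<close>. A copy x0 + u, y0 + u occurs
  near the origin of every \<open>N\<close>. No star of \<open>N\<close> lies more than
  \<open>D\<close> below that of x0 + u, so that of y0 + u is within \<open>e\<close> of the
  infimum. The radius does not depend on \<open>N\<close>.\<close>

lemma corner_attained_coordinate:
  assumes k: "k < n" and e: "e > 0"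
  shows "\<exists>R>0. \<forall>N\<in>HL. \<exists>g\<in>N. norm g \<le> R \<and> S g k \<le> corner N k + e"
proof -
  have \<Lambda>: "\<Lambda> \<in> Hull"
    using delone by (rule self_mem_delone_hull)
  define D where "D = Sup ((\<lambda>x. S x k) ` difference_set \<Lambda>)"
  have ne: "difference_set \<Lambda> \<noteq> {}"
    using delone_nonempty[OF delone] unfolding difference_set_def by blast
  obtain C where C: "\<And>N x y k. N \<in> Hull \<Longrightarrow> x \<in> N \<Longrightarrow> y \<in> N \<Longrightarrow> \<bar>S (x - y) k\<bar> \<le> C"
    using S_bounded by meson
  have bdd: "bdd_above ((\<lambda>x. S x k) ` difference_set \<Lambda>)"
    unfolding difference_set_def
    by (intro bdd_aboveI2[of _ _ C]) (use C[OF \<Lambda>] in \<open>auto simp: abs_le_iff\<close>)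
  have "\<exists>x\<in>(\<lambda>x. S x k) ` difference_set \<Lambda>. D - e < x"
    unfolding D_def using e ne bdd by (subst less_cSup_iff[symmetric]) auto
  then obtain x0 y0 where xy: "x0 \<in> \<Lambda>" "y0 \<in> \<Lambda>" "D - e < S (x0 - y0) k"
    by (auto simp: difference_set_def)
  define \<rho> where "\<rho> = norm x0 + norm y0 + 1"
  have \<rho>: "\<rho> > 0" "norm x0 \<le> \<rho>" "norm y0 \<le> \<rho>"
    by (auto simp: \<rho>_def intro: add_nonneg_pos)
  obtain M where M: "M > 0" "\<And>N N' t c. N \<in> Hull \<Longrightarrow> N' \<in> Hull \<Longrightarrow>
      \<exists>u\<in>cball c M. agree \<rho> (shift N t) (shift N' u)"
    using hull_repetitive[OF repetitive \<rho>(1)] by meson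
  have "\<exists>g\<in>N. norm g \<le> M + \<rho> \<and> S g k \<le> corner N k + e" if N: "N \<in> HL" for N
  proof -
    obtain u where u: "u \<in> cball 0 M" "agree \<rho> (shift \<Lambda> 0) (shift N u)"
      using M(2)[OF \<Lambda> HL_hull[OF N]] by blast
    have mem: "x0 + u \<in> N" "y0 + u \<in> N"
      using agreeD[OF u(2)] xy \<rho> by (auto simp: mem_shift)
    note inL = mem[THEN HL_mem_L[OF N]]
    have diff: "S (x0 - y0) k = S (x0 + u) k - S (y0 + u) k"
      using S_diff[OF inL] by simp
    have "S (x0 + u) k - D \<le> corner N k"
    proof (rule corner_ge[OF N k])
      fix g assume g: "g \<in> N"
      have "S (x0 + u - g) k \<le> D"
        unfolding D_def using hull_difference[OF HL_hull[OF N] mem(1) g] bdd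
        by (intro cSup_upper) auto
      then show "S (x0 + u) k - D \<le> S g k"
        using S_diff[OF inL(1) HL_mem_L[OF N g]] by simp
    qed
    then have "S (y0 + u) k \<le> corner N k + e"
      using diff xy(3) by linarith
    moreover have "norm (y0 + u) \<le> M + \<rho>"
      using norm_triangle_ineq[of y0 u] u(1) \<rho>(3) by simp
    ultimately show ?thesis
      using mem(2) by blast
  qed
  then show ?thesis
    using M(1) \<rho>(1) by (intro exI[of _ "M + \<rho>"]) auto
qed

lemma corner_attained:
  assumes e: "e > 0"
  shows "\<exists>R>0. \<forall>N\<in>HL. \<forall>k<n. \<exists>g\<in>N. norm g \<le> R \<and> S g k \<le> corner N k + e"
proof -
  have "\<forall>k. \<exists>R. k < n \<longrightarrow> R > 0 \<and> (\<forall>N\<in>HL. \<exists>g\<in>N. norm g \<le> R \<and> S g k \<le> corner N k + e)"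
    using corner_attained_coordinate[OF _ e] by meson
  then obtain R where R: "\<And>k. k < n \<Longrightarrow> R k > 0"
      "\<And>k N. k < n \<Longrightarrow> N \<in> HL \<Longrightarrow> \<exists>g\<in>N. norm g \<le> R k \<and> S g k \<le> corner N k + e"
    by metis
  have le: "R k \<le> 1 + (\<Sum>k<n. R k)" if "k < n" for k
    using member_le_sum[of k "{..<n}" R] R(1) that by (force intro: less_imp_le)
  have "1 + (\<Sum>k<n. R k) > 0"
    using R(1) by (intro add_pos_nonneg sum_nonneg) (auto intro: less_imp_le)
  moreover have "\<exists>g\<in>N. norm g \<le> 1 + (\<Sum>k<n. R k) \<and> S g k \<le> corner N k + e"
    if k: "k < n" and N: "N \<in> HL" for k N
  proof -
    obtain g where "g \<in> N" "norm g \<le> R k" "S g k \<le> corner N k + e"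
      using R(2)[OF k N] by blast
    then show ?thesis
      using le[OF k] by (meson order_trans)
  qed
  ultimately show ?thesis
    by blast
qed

text \<open>Points that nearly attain the infimum lie within radius \<open>R\<close>, hence belong
  to both sets.\<close>

lemma corner_close:
  assumes e: "e > 0"
  shows "\<exists>R>0. \<forall>N\<in>HL. \<forall>N'\<in>HL. agree R N N' \<longrightarrow> (\<forall>k. \<bar>corner N k - corner N' k\<bar> \<le> e)"
proof -
  obtain R where R: "R > 0" "\<And>N k. N \<in> HL \<Longrightarrow> k < n \<Longrightarrow> \<exists>g\<in>N. norm g \<le> R \<and> S g k \<le> corner N k + e"
    using corner_attained[OF e] by meson
  have half: "corner N' k \<le> corner N k + e"
    if N: "N \<in> HL" "N' \<in> HL" and a: "agree R N N'" and k: "k < n" for N N' k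
  proof -
    obtain g where g: "g \<in> N" "norm g \<le> R" "S g k \<le> corner N k + e"
      using R(2)[OF N(1) k] by blast
    then have "g \<in> N'"
      using agreeD[OF a] by blast
    then show ?thesis
      using corner_le[OF N(2) _ k] g(3) by fastforce
  qed
  have "\<bar>corner N k - corner N' k\<bar> \<le> e" if N: "N \<in> HL" "N' \<in> HL" and a: "agree R N N'" for N N' k
  proof (cases "k < n")
    case True
    then show ?thesis
      using half[OF N a True] half[OF N(2,1) agree_sym[OF a] True] by linarith
  qed (use e in \<open>simp add: corner_def\<close>)
  then show ?thesis
    using R(1) by blast
qed

text \<open>Repetitivity finds a patch of \<open>N\<close> inside \<open>N'\<close>. The shifted set
  then has nearly the corner of \<open>N\<close>, and covariance of the corner converts this into an
  estimate for \<open>S u\<close>.\<close>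

lemma approximate_by_shift:
  assumes N: "N \<in> HL" "N' \<in> HL" and e: "e > 0"
  shows "\<exists>u\<in>L. agree \<rho> N (shift N' u) \<and> (\<forall>k. \<bar>S u k - (corner N' k - corner N k)\<bar> \<le> e)"
proof -
  obtain R where R: "R > 0" "\<And>N N' k. N \<in> HL \<Longrightarrow> N' \<in> HL \<Longrightarrow> agree R N N' \<Longrightarrow> \<bar>corner N k - corner N' k\<bar> \<le> e"
    using corner_close[OF e] by meson
  obtain g where g: "g \<in> N"
    using HL_nonempty[OF N(1)] by blast
  \<comment> \<open>The patch must reach \<open>R\<close> for \<open>corner_close\<close>, \<rho>
    for the conclusion, and contain the point \<open>g\<close>, since g and g + u lying in
    \<open>L\<close> is what puts \<open>u\<close> into \<open>L\<close>.\<close>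
  define \<rho>' where "\<rho>' = R + \<bar>\<rho>\<bar> + norm g"
  have \<rho>': "\<rho>' > 0" "R \<le> \<rho>'" "\<rho> \<le> \<rho>'" "norm g \<le> \<rho>'"
    using R(1) norm_ge_zero[of g] abs_ge_self[of \<rho>] unfolding \<rho>'_def by linarith+
  obtain u where "agree \<rho>' (shift N 0) (shift N' u)"
    using hull_repetitive[OF repetitive \<rho>'(1)] N[THEN HL_hull] by blast
  then have u: "agree \<rho>' N (shift N' u)"
    by simp
  have "g + u \<in> N'"
    using agreeD[OF u \<rho>'(4)] g by (simp add: mem_shift)
  then have uL: "u \<in> L"
    using L_diff[of "g + u" g] HL_mem_L N g by fastforce
  have "\<bar>S u k - (corner N' k - corner N k)\<bar> \<le> e" for k
    using R(2)[OF N(1) HL_shift[OF N(2) uL] agree_mono[OF u \<rho>'(2)], of k]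
    by (simp add: corner_shift[OF N(2) uL])
  then show ?thesis
    using uL agree_mono[OF u \<rho>'(3)] by blast
qed

section \<open>Closures of star images, and sets that fill the interior of their window\<close>

definition "cl N = Euc n closure_of (S ` N)"

text \<open>A point g of \<open>N\<close> whose star is close to \<open>x\<close> reappears as g + u
  in \<open>N'\<close>, with star S g + S u, and S u is nearly the difference of the
  corners.\<close>

lemma cl_translate_subset:
  assumes N: "N \<in> HL" "N' \<in> HL" and x: "x \<in> cl N"
  shows "(\<lambda>k. (corner N' k - corner N k) + x k) \<in> cl N'"
  unfolding cl_def in_closure_of_Euclidean
proof (intro conjI allI impI)
  have xE: "x \<in> euc n"
    using x unfolding cl_def in_closure_of_Euclidean by blast
  then show "(\<lambda>k. (corner N' k - corner N k) + x k) \<in> euc n"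
    by (intro euc_add euc_diff corner_euc)
  fix e :: real assume e: "e > 0"
  then obtain g where g: "g \<in> N" "S g \<in> sup_ball n x (e / 2)"
    using x half_gt_zero[OF e] unfolding cl_def in_closure_of_Euclidean by blast
  obtain u where u: "u \<in> L" "agree (norm g) N (shift N' u)"
      "\<And>k. \<bar>S u k - (corner N' k - corner N k)\<bar> \<le> e / 2"
    using approximate_by_shift[OF N, of "e / 2"] e by (meson half_gt_zero)
  have "g + u \<in> N'"
    using agreeD[OF u(2)] g(1) by (simp add: mem_shift)
  moreover have "S (g + u) \<in> sup_ball n (\<lambda>k. (corner N' k - corner N k) + x k) e"
  proof (rule sup_ballI[OF S_euc])
    fix k assume "k < n"
    then have "\<bar>S g k - x k\<bar> < e / 2"
      using g(2) by (simp add: sup_ball_def)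
    then show "\<bar>S (g + u) k - ((corner N' k - corner N k) + x k)\<bar> < e"
      using u(3)[of k] unfolding S_add[OF HL_mem_L[OF N(1) g(1)] u(1)] by linarith
  qed
  ultimately show "\<exists>y\<in>S ` N'. y \<in> sup_ball n (\<lambda>k. (corner N' k - corner N k) + x k) e"
    by blast
qed

lemma cl_translate:
  assumes N: "N \<in> HL" "N' \<in> HL"
  shows "cl N' = translate (\<lambda>k. corner N' k - corner N k) (cl N)"
proof (intro equalityI subsetI)
  fix x assume "x \<in> cl N'"
  then have "(\<lambda>k. (corner N k - corner N' k) + x k) \<in> cl N"
    by (rule cl_translate_subset[OF N(2,1)])
  then show "x \<in> translate (\<lambda>k. corner N' k - corner N k) (cl N)"
    by (simp add: mem_translate_iff algebra_simps)
next
  fix x assume "x \<in> translate (\<lambda>k. corner N' k - corner N k) (cl N)"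
  then have "(\<lambda>k. x k - (corner N' k - corner N k)) \<in> cl N"
    by (simp add: mem_translate_iff)
  then show "x \<in> cl N'"
    using cl_translate_subset[OF N] by fastforce
qed

lemma closedin_cl: "closedin (Euc n) (cl N)"
  by (simp add: cl_def)

lemma S_mem_cl: "g \<in> N \<Longrightarrow> S g \<in> cl N"
  using closure_of_subset[of "S ` N" "Euc n"] S_euc by (auto simp: cl_def)

lemma star_le_corner:
  "\<exists>D>0. \<forall>N\<in>HL. \<forall>g\<in>N. \<forall>k<n. S g k \<le> corner N k + D"
proof -
  obtain D where D: "D > 0" "\<And>N x y k. N \<in> Hull \<Longrightarrow> x \<in> N \<Longrightarrow> y \<in> N \<Longrightarrow> \<bar>S (x - y) k\<bar> \<le> D"
    using S_bounded by meson
  have "S g k \<le> corner N k + D" if N: "N \<in> HL" and g: "g \<in> N" and k: "k < n" for N g k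
  proof -
    have "S g k - D \<le> corner N k"
    proof (rule corner_ge[OF N k])
      fix h assume h: "h \<in> N"
      show "S g k - D \<le> S h k"
        using D(2)[OF HL_hull[OF N] g h, of k] S_diff[OF HL_mem_L[OF N g] HL_mem_L[OF N h]]
        by (simp add: abs_le_iff)
    qed
    then show ?thesis
      by simp
  qed
  then show ?thesis
    using D(1) by blast
qed

lemma sup_bounded_cl: "N \<in> HL \<Longrightarrow> sup_bounded n (cl N)"
proof -
  assume N: "N \<in> HL"
  obtain D where D: "D > 0" "\<And>N g k. N \<in> HL \<Longrightarrow> g \<in> N \<Longrightarrow> k < n \<Longrightarrow> S g k \<le> corner N k + D"
    using star_le_corner by meson
  have "\<bar>S g k\<bar> \<le> (\<Sum>k<n. \<bar>corner N k\<bar>) + D" if g: "g \<in> N" and k: "k < n" for g k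
  proof -
    have "\<bar>corner N k\<bar> \<le> (\<Sum>k<n. \<bar>corner N k\<bar>)"
      using k by (intro member_le_sum) auto
    then show ?thesis
      using D(2)[OF N g k] corner_le[OF N g k] D(1) by linarith
  qed
  then have "sup_bounded n (S ` N)"
    unfolding sup_bounded_def by blast
  then show ?thesis
    unfolding cl_def by (rule sup_bounded_closure_of)
qed

text \<open>This is the lower inclusion of an inter-model set with window \<open>cl N\<close>; the
  upper inclusion always holds by \<open>S_mem_cl\<close>.\<close>

definition "full N \<longleftrightarrow> (\<forall>g\<in>L. S g \<in> Euc n interior_of (cl N) \<longrightarrow> g \<in> N)"

text \<open>Being full is tested point by point: \<open>g\<close> is carried to g + u in a shifted
  copy. Half of the room \<open>e\<close> around its star absorbs the error in S u, and the other
  half keeps the moved star interior to \<open>cl N'\<close>.\<close>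

lemma full_transfer:
  assumes N: "N \<in> HL" "N' \<in> HL" and full: "full N'"
  shows "full N"
  unfolding full_def
proof (intro ballI impI)
  fix g assume g: "g \<in> L" "S g \<in> Euc n interior_of (cl N)"
  then obtain e where e: "e > 0" "sup_ball n (S g) e \<subseteq> cl N"
    unfolding in_interior_of_Euclidean by blast
  obtain u where u: "u \<in> L" "agree (norm g) N (shift N' u)"
      "\<And>k. \<bar>S u k - (corner N' k - corner N k)\<bar> \<le> e / 2"
    using approximate_by_shift[OF N, of "e / 2"] e(1) by (meson half_gt_zero)
  have "sup_ball n (S (g + u)) (e / 2) \<subseteq> cl N'"
  proof
    fix y assume y: "y \<in> sup_ball n (S (g + u)) (e / 2)"
    have "(\<lambda>k. y k - (corner N' k - corner N k)) \<in> sup_ball n (S g) e"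
    proof (rule sup_ballI)
      show "(\<lambda>k. y k - (corner N' k - corner N k)) \<in> euc n"
        using y by (intro euc_diff corner_euc) (simp add: sup_ball_def)
      fix k assume "k < n"
      then have "\<bar>y k - S (g + u) k\<bar> < e / 2"
        using y by (simp add: sup_ball_def)
      then show "\<bar>y k - (corner N' k - corner N k) - S g k\<bar> < e"
        using u(3)[of k] unfolding S_add[OF g(1) u(1)] by linarith
    qed
    then have "(\<lambda>k. y k - (corner N' k - corner N k)) \<in> cl N"
      using e(2) by blast
    then show "y \<in> cl N'"
      unfolding cl_translate[OF N] by (simp add: mem_translate_iff)
  qed
  then have "S (g + u) \<in> Euc n interior_of (cl N')"
    unfolding in_interior_of_Euclidean using e(1) S_euc by (meson half_gt_zero)
  then have "g + u \<in> N'"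
    using full g(1) u(1) L_add by (simp add: full_def)
  then show "g \<in> N"
    using agreeD[OF u(2)] by (simp add: mem_shift)
qed

text \<open>A diagonal argument over the countable group \<open>L\<close>. Bounded corners confine
  all stars, so within a given radius only finitely many lattice points can occur, and membership
  stabilises on whole balls.\<close>

lemma HL_compact:
  assumes N: "\<And>m::nat. N m \<in> HL" and C: "\<And>m k. k < n \<Longrightarrow> \<bar>corner (N m) k\<bar> \<le> C"
  shows "\<exists>M\<in>HL. \<exists>r. strict_mono r \<and> (\<forall>R. \<forall>\<^sub>F m in sequentially. agree R M (N (r m)))"
proof -
  \<comment> \<open>Membership as a 0-1 valued function: a subsequence converging at every point of
    \<open>L\<close> makes each membership eventually constant.\<close>
  define f where "f = (\<lambda>m x. if x \<in> N m then 1 else 0 :: real)"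
  obtain r :: "nat \<Rightarrow> nat" where r: "strict_mono r" "\<And>x. x \<in> L \<Longrightarrow> \<exists>l. (\<lambda>m. f (r m) x) \<longlonglongrightarrow> l"
    by (rule function_convergent_subsequence[OF countable_L, of f 1]) (auto simp: f_def)
  have dich: "(\<forall>\<^sub>F m in sequentially. x \<in> N (r m)) \<or> (\<forall>\<^sub>F m in sequentially. x \<notin> N (r m))"
    if xL: "x \<in> L" for x
  proof -
    obtain l where l: "(\<lambda>m. f (r m) x) \<longlonglongrightarrow> l"
      using r(2) xL by blast
    show ?thesis
    proof (cases "l > 0")
      case True
      then have "\<forall>\<^sub>F m in sequentially. f (r m) x > 0"
        using l by (auto dest: order_tendstoD)
      then show ?thesis
        by (intro disjI1) (auto elim!: eventually_mono simp: f_def split: if_splits)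
    next
      case False
      then have "\<forall>\<^sub>F m in sequentially. f (r m) x < 1"
        using l by (intro order_tendstoD(2)) auto
      then show ?thesis
        by (intro disjI2) (auto elim!: eventually_mono simp: f_def split: if_splits)
    qed
  qed
  define M where "M = {x \<in> L. \<forall>\<^sub>F m in sequentially. x \<in> N (r m)}"
  obtain D where D: "D > 0" "\<And>N g k. N \<in> HL \<Longrightarrow> g \<in> N \<Longrightarrow> k < n \<Longrightarrow> S g k \<le> corner N k + D"
    using star_le_corner by meson
  have agree: "\<forall>\<^sub>F m in sequentially. agree R M (N (r m))" for R
  proof -
    \<comment> \<open>This finite set does not depend on the index and contains every point of norm
      at most \<open>R\<close> of every \<open>N m\<close>.\<close>
    define F where "F = {g \<in> L. norm g \<le> R \<and> (\<forall>k<n. \<bar>S g k\<bar> \<le> C + D)}"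
    have out: "x \<in> F" if x: "x \<in> N m" "norm x \<le> R" for x m
    proof -
      have "\<bar>S x k\<bar> \<le> C + D" if k: "k < n" for k
        using D(2)[OF N x(1) k] corner_le[OF N x(1) k] C[OF k, of m] D(1) by linarith
      then show ?thesis
        using x HL_mem_L[OF N] by (simp add: F_def)
    qed
    have "\<forall>\<^sub>F m in sequentially. \<forall>x\<in>F. x \<in> M \<longleftrightarrow> x \<in> N (r m)"
    proof (rule eventually_ball_finite)
      show "finite F"
        unfolding F_def by (rule finite_bounded_star)
      show "\<forall>x\<in>F. \<forall>\<^sub>F m in sequentially. x \<in> M \<longleftrightarrow> x \<in> N (r m)"
      proof
        fix x assume "x \<in> F"
        then have xL: "x \<in> L"
          by (simp add: F_def)
        show "\<forall>\<^sub>F m in sequentially. x \<in> M \<longleftrightarrow> x \<in> N (r m)"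
        proof (cases "x \<in> M")
          case True
          then show ?thesis
            by (simp add: M_def)
        next
          case False
          then have "\<forall>\<^sub>F m in sequentially. x \<notin> N (r m)"
            using dich[OF xL] xL by (auto simp: M_def)
          then show ?thesis
            using False by simp
        qed
      qed
    qed
    then show ?thesis
    proof (rule eventually_mono)
      fix m assume m: "\<forall>x\<in>F. x \<in> M \<longleftrightarrow> x \<in> N (r m)"
      have "x \<in> F" if x: "x \<in> M" "norm x \<le> R" for x
      proof -
        obtain j where "x \<in> N (r j)"
          using x(1) unfolding M_def by (auto simp: eventually_sequentially)
        then show ?thesis
          using out x(2) by blast
      qed
      then show "agree R M (N (r m))"
        unfolding agree_def using m out by blast
    qed
  qed
  have patches: "\<exists>u. agree \<rho> (shift \<Lambda> u) (shift M t)" if \<rho>: "\<rho> > 0" for \<rho> t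
  proof -
    obtain m where m: "agree (\<rho> + norm t) M (N (r m))"
      using agree[of "\<rho> + norm t"] unfolding eventually_sequentially by blast
    obtain u where u: "agree \<rho> (shift \<Lambda> u) (shift (N (r m)) t)"
      using HL_hull[OF N[of "r m"]] \<rho> unfolding delone_hull_iff by blast
    have "agree \<rho> (shift (N (r m)) t) (shift M t)"
      by (rule agree_shift[OF agree_sym[OF m]]) simp
    then show ?thesis
      using agree_trans[OF u] by blast
  qed
  have "M \<in> HL"
    unfolding HL_def delone_hull_iff using delone_locally_from[OF delone patches] patches
    by (auto simp: M_def)
  then show ?thesis
    using r(1) agree by blast
qed

end

section \<open>The address map\<close>

lemma mem_torus_class: "y \<in> torus_class s x \<longleftrightarrow> y \<in> euc s \<and> (\<forall>i. y i - x i \<in> \<int>)"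
  by (simp add: torus_class_def)

lemma torus_class_eq_iff:
  assumes "x \<in> euc s" "y \<in> euc s"
  shows "torus_class s x = torus_class s y \<longleftrightarrow> (\<forall>i. x i - y i \<in> \<int>)"
proof
  assume "torus_class s x = torus_class s y"
  moreover have "x \<in> torus_class s x"
    using assms by (simp add: mem_torus_class)
  ultimately show "\<forall>i. x i - y i \<in> \<int>"
    by (simp add: mem_torus_class)
next
  assume xy: "\<forall>i. x i - y i \<in> \<int>"
  have "z i - x i \<in> \<int> \<longleftrightarrow> z i - y i \<in> \<int>" for z :: "nat \<Rightarrow> real" and i
    using Ints_add[of "z i - x i" "x i - y i"] Ints_diff[of "z i - y i" "x i - y i"] xy by auto
  then show "torus_class s x = torus_class s y"
    by (simp add: torus_class_def)
qed

lemma torus_add_class: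
  assumes "x \<in> euc s" "y \<in> euc s"
  shows "torus_add (torus_class s x) (torus_class s y) = torus_class s (\<lambda>i. x i + y i)"
proof (intro equalityI subsetI)
  fix z assume "z \<in> torus_add (torus_class s x) (torus_class s y)"
  then obtain a b where z: "z = (\<lambda>i. a i + b i)" "a \<in> torus_class s x" "b \<in> torus_class s y"
    by (auto simp: torus_add_def)
  have "a i + b i - (x i + y i) \<in> \<int>" for i
    using z Ints_add[of "a i - x i" "b i - y i"] by (simp add: mem_torus_class algebra_simps)
  then show "z \<in> torus_class s (\<lambda>i. x i + y i)"
    using z by (simp add: mem_torus_class euc_add)
next
  fix z assume z: "z \<in> torus_class s (\<lambda>i. x i + y i)"
  then have "(\<lambda>i. z i - y i) \<in> torus_class s x"
    using assms by (auto simp: mem_torus_class algebra_simps intro: euc_diff)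
  moreover have "y \<in> torus_class s y"
    using assms by (simp add: mem_torus_class)
  moreover have "z = (\<lambda>i. (z i - y i) + y i)"
    by simp
  ultimately show "z \<in> torus_add (torus_class s x) (torus_class s y)"
    unfolding torus_add_def mem_Collect_eq
    by (intro exI[of _ "\<lambda>i. z i - y i"] exI[of _ y] conjI)
qed

lemma topspace_torus: "topspace (torus s) = torus_class s ` euc s"
  by (simp add: torus_def)

lemma openin_torus:
  "openin (torus s) U \<longleftrightarrow> U \<subseteq> torus_class s ` euc s \<and> openin (Euc s) {x \<in> euc s. torus_class s x \<in> U}"
  by (simp add: torus_def openin_quotient_topology)

text \<open>The quotient map is open: if x is congruent to a point z of the ball, moving both by the
  same small vector preserves the congruence and stays in the ball on the side of z.\<close>

lemma openin_torus_image_ball: "openin (torus s) (torus_class s ` sup_ball s p e)"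
  unfolding openin_torus
proof
  show "torus_class s ` sup_ball s p e \<subseteq> torus_class s ` euc s"
    by (auto simp: sup_ball_def)
  show "openin (Euc s) {x \<in> euc s. torus_class s x \<in> torus_class s ` sup_ball s p e}"
    unfolding openin_Euclidean_space_iff
  proof (intro conjI ballI)
    fix x assume "x \<in> {x \<in> euc s. torus_class s x \<in> torus_class s ` sup_ball s p e}"
    then obtain z where x: "x \<in> euc s" and z: "z \<in> sup_ball s p e" "torus_class s x = torus_class s z"
      by blast
    have zE: "z \<in> euc s"
      using z(1) by (simp add: sup_ball_def)
    obtain d where d: "d > 0" "sup_ball s z d \<subseteq> sup_ball s p e"
      using openin_sup_ball[of s p e] z(1) unfolding openin_Euclidean_space_iff by blast
    have "sup_ball s x d \<subseteq> {x \<in> euc s. torus_class s x \<in> torus_class s ` sup_ball s p e}"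
    proof
      fix y assume y: "y \<in> sup_ball s x d"
      define y' where "y' = (\<lambda>i. z i + (y i - x i))"
      have yE: "y \<in> euc s"
        using y by (simp add: sup_ball_def)
      then have y'E: "y' \<in> euc s"
        unfolding y'_def using x zE by (intro euc_add euc_diff)
      have "y' \<in> sup_ball s z d"
        using y y'E by (auto simp: sup_ball_def y'_def)
      then have "y' \<in> sup_ball s p e"
        using d(2) by blast
      moreover have "torus_class s y = torus_class s y'"
        using z(2) unfolding torus_class_eq_iff[OF yE y'E] torus_class_eq_iff[OF x zE]
        by (simp add: y'_def algebra_simps)
      ultimately show "y \<in> {x \<in> euc s. torus_class s x \<in> torus_class s ` sup_ball s p e}"
        using yE by blast
    qed
    then show "\<exists>e'>0. sup_ball s x e' \<subseteq> {x \<in> euc s. torus_class s x \<in> torus_class s ` sup_ball s p e}"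
      using d(1) by blast
  qed auto
qed

lemma Ints_if_approximable:
  fixes a :: real
  assumes "\<And>e. e > 0 \<Longrightarrow> \<exists>m\<in>\<int>. \<bar>a - m\<bar> < e"
  shows "a \<in> \<int>"
proof -
  have "a \<in> closure \<int>"
    unfolding closure_approachable using assms by (auto simp: dist_real_def abs_minus_commute)
  then show ?thesis
    by (simp add: closure_closed[OF closed_Ints])
qed

context address_data
begin

lemma integer_vector:
  assumes "m \<in> euc s" "\<And>i. m i \<in> \<int>"
  shows "phi m \<in> L" "zc (phi m) = m"
proof -
  have m: "m = (\<lambda>i. of_int \<lfloor>m i\<rfloor>)"
    using assms(2) by (simp add: fun_eq_iff)
  show "phi m \<in> L"
    by (subst m) (rule phi_int_mem_L)
  have "zcoord s v (phi (\<lambda>i. of_int \<lfloor>m i\<rfloor>)) = (\<lambda>i. \<lfloor>m i\<rfloor>)"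
    using assms(1) by (intro zcoord_phi) (simp add: mem_euc)
  then show "zc (phi m) = m"
    using m by metis
qed

text \<open>On \<open>HL\<close> the address is meant to be - comb (corner N). For general
  \<open>M\<close> with point \<open>x\<close>, the set M - x lies in \<open>HL\<close>, and
  shifting back by - x must add ell (- x), which dictates this formula.\<close>

definition lift :: "'a set \<Rightarrow> 'a \<Rightarrow> nat \<Rightarrow> real" where
  "lift M x = (\<lambda>i. - ell x i - comb (corner (shift M x)) i)"

definition addr :: "'a set \<Rightarrow> (nat \<Rightarrow> real) set" where
  "addr M = torus_class s (lift M (SOME x. x \<in> M))"

lemma lift_euc: "lift M x \<in> euc s"
  unfolding lift_def by (intro euc_diff euc_uminus ell_euc comb_euc)

lemma hull_nonempty: "M \<in> Hull \<Longrightarrow> \<exists>x. x \<in> M"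
  using delone_nonempty[of M] by (auto simp: delone_hull_iff)

text \<open>Changing the base point from \<open>x\<close> to \<open>y\<close> changes the lift by -
  zc (y - x), an integer vector.\<close>

lemma addr_eq:
  assumes M: "M \<in> Hull" and x: "x \<in> M"
  shows "addr M = torus_class s (lift M x)"
proof -
  define y where "y = (SOME x. x \<in> M)"
  have y: "y \<in> M"
    unfolding y_def using x by (rule someI)
  define g where "g = y - x"
  have g: "g \<in> L"
    unfolding g_def using M y x by (rule hull_difference_L)
  have "shift M y = shift (shift M x) g"
    by (simp add: shift_shift g_def)
  then have "comb (corner (shift M y)) = (\<lambda>i. comb (corner (shift M x)) i - (ell g i - zc g i))"
    using corner_shift[OF shift_mem_HL[OF M x] g] comb_S[OF g] by (simp add: comb_diff)
  moreover have "ell y = (\<lambda>i. ell x i + ell g i)"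
    using ell_add[of x g] by (simp add: g_def)
  ultimately have "lift M y i - lift M x i = - zc g i" for i
    by (simp add: lift_def)
  then show ?thesis
    unfolding addr_def y_def[symmetric] torus_class_eq_iff[OF lift_euc lift_euc] by simp
qed

lemma addr_HL:
  assumes N: "N \<in> HL"
  shows "addr N = torus_class s (\<lambda>i. - comb (corner N) i)"
proof -
  obtain x where x: "x \<in> N"
    using HL_nonempty[OF N] by blast
  have xL: "x \<in> L"
    using HL_mem_L[OF N x] .
  have "lift N x i - (- comb (corner N) i) = - zc x i" for i
    using comb_S[OF xL] by (simp add: lift_def corner_shift[OF N xL] comb_diff)
  then show ?thesis
    unfolding addr_eq[OF HL_hull[OF N] x]
      torus_class_eq_iff[OF lift_euc euc_uminus[OF comb_euc]] by simp
qed

lemma addr_shift: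
  assumes M: "M \<in> Hull"
  shows "addr (shift M t) = torus_add (addr M) (torus_class s (ell t))"
proof -
  obtain x where x: "x \<in> M"
    using hull_nonempty[OF M] by blast
  have "x - t \<in> shift M t"
    using x by (simp add: mem_shift)
  then have "addr (shift M t) = torus_class s (lift (shift M t) (x - t))"
    by (rule addr_eq[OF shift_in_delone_hull[OF M]])
  also have "lift (shift M t) (x - t) = (\<lambda>i. lift M x i + ell t i)"
    by (simp add: lift_def shift_shift ell_diff fun_eq_iff)
  finally show ?thesis
    unfolding addr_eq[OF M x] torus_add_class[OF lift_euc ell_euc] .
qed

lemma addr_mem_torus: "addr M \<in> topspace (torus s)"
  unfolding topspace_torus addr_def using lift_euc by blast

lemma hull_nbhdI:
  "M \<in> Hull \<Longrightarrow> agree R M N \<Longrightarrow> norm t < \<epsilon> \<Longrightarrow> shift M t \<in> hull_nbhd \<Lambda> N R \<epsilon>"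
  unfolding hull_nbhd_def Int_cball_eq_iff_agree by force

text \<open>For a nearby set M' - t the point \<open>x\<close> of \<open>M\<close> also lies in
  \<open>M'\<close>. The lift then changes by \<open>ell t\<close>, controlled by \<epsilon>, minus
  \<open>comb\<close> of the corner difference, controlled by \<open>R\<close>; each gets half of
  \<open>e\<close>.\<close>

lemma continuous_map_addr: "continuous_map (hull_topology \<Lambda>) (torus s) addr"
  unfolding continuous_map_def
proof (intro conjI allI impI)
  show "addr \<in> topspace (hull_topology \<Lambda>) \<rightarrow> topspace (torus s)"
    using addr_mem_torus by blast
  fix U assume U: "openin (torus s) U"
  have "\<exists>R \<epsilon>. 0 < \<epsilon> \<and> \<epsilon> < R / 2 \<and> hull_nbhd \<Lambda> M R \<epsilon> \<subseteq> {M \<in> Hull. addr M \<in> U}"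
    if M: "M \<in> Hull" "addr M \<in> U" for M
  proof -
    obtain x where x: "x \<in> M"
      using hull_nonempty[OF M(1)] by blast
    have "lift M x \<in> {x \<in> euc s. torus_class s x \<in> U}"
      using M(2) addr_eq[OF M(1) x] lift_euc by simp
    then obtain e where e: "e > 0" "sup_ball s (lift M x) e \<subseteq> {x \<in> euc s. torus_class s x \<in> U}"
      using U unfolding openin_torus openin_Euclidean_space_iff by blast
    obtain K where K: "K > 0" "\<And>t i. \<bar>ell t i\<bar> \<le> K * norm t"
      using ell_le by meson
    obtain K' where K': "K' > 0" "\<And>a C i. 0 \<le> C \<Longrightarrow> (\<forall>k<n. \<bar>a k\<bar> \<le> C) \<Longrightarrow> \<bar>comb a i\<bar> \<le> K' * C"
      using comb_le by meson
    define e' where "e' = e / (2 * K')"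
    have e': "e' > 0" "K' * e' = e / 2"
      using e(1) K'(1) by (simp_all add: e'_def)
    obtain R0 where R0: "R0 > 0" "\<And>N N' k. N \<in> HL \<Longrightarrow> N' \<in> HL \<Longrightarrow> agree R0 N N' \<Longrightarrow> \<bar>corner N k - corner N' k\<bar> \<le> e'"
      using corner_close[OF e'(1)] by meson
    define \<epsilon> where "\<epsilon> = min 1 (e / (2 * K))"
    have \<epsilon>: "\<epsilon> > 0" "K * \<epsilon> \<le> e / 2"
    proof -
      show "\<epsilon> > 0"
        using e(1) K(1) by (simp add: \<epsilon>_def)
      have "K * \<epsilon> \<le> K * (e / (2 * K))"
        using K(1) by (intro mult_left_mono) (auto simp: \<epsilon>_def)
      then show "K * \<epsilon> \<le> e / 2"
        using K(1) by simp
    qed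
    define R where "R = R0 + norm x + 2"
    have "\<epsilon> \<le> 1"
      by (simp add: \<epsilon>_def)
    then have "2 * \<epsilon> < R"
      using R0(1) norm_ge_zero[of x] unfolding R_def by linarith
    then have R: "\<epsilon> < R / 2" "R0 + norm x \<le> R" "norm x \<le> R"
      using R0(1) by (simp_all add: R_def)
    have "hull_nbhd \<Lambda> M R \<epsilon> \<subseteq> {M \<in> Hull. addr M \<in> U}"
    proof
      fix N assume "N \<in> hull_nbhd \<Lambda> M R \<epsilon>"
      then obtain M' t where N: "N = shift M' t" "M' \<in> Hull" "agree R M' M" "norm t < \<epsilon>"
        unfolding hull_nbhd_def Int_cball_eq_iff_agree by auto
      have x': "x \<in> M'"
        using agreeD[OF N(3) R(3)] x by blast
      have "agree R0 (shift M' x) (shift M x)"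
        by (rule agree_shift[OF N(3) R(2)])
      then have close: "\<bar>corner (shift M' x) k - corner (shift M x) k\<bar> \<le> e'" for k
        by (intro R0(2) shift_mem_HL M(1) N(2) x x')
      have eq: "lift N (x - t) i - lift M x i
          = ell t i - comb (\<lambda>k. corner (shift M' x) k - corner (shift M x) k) i" for i
        by (simp add: lift_def N(1) shift_shift ell_diff comb_diff)
      have ell_small: "\<bar>ell t i\<bar> < e / 2" for i
      proof -
        have "K * norm t < K * \<epsilon>"
          using N(4) K(1) by simp
        then show ?thesis
          using K(2)[of t i] \<epsilon>(2) by linarith
      qed
      have comb_small: "\<bar>comb (\<lambda>k. corner (shift M' x) k - corner (shift M x) k) i\<bar> \<le> e / 2" for i
        using K'(2)[of e' "\<lambda>k. corner (shift M' x) k - corner (shift M x) k" i] e' close by simp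
      have "\<bar>lift N (x - t) i - lift M x i\<bar> < e" for i
        unfolding eq using ell_small[of i] comb_small[of i] by linarith
      then have "lift N (x - t) \<in> sup_ball s (lift M x) e"
        by (intro sup_ballI lift_euc)
      then have "torus_class s (lift N (x - t)) \<in> U"
        using e(2) by blast
      moreover have hN: "N \<in> Hull"
        unfolding N(1) using N(2) by (rule shift_in_delone_hull)
      moreover have "x - t \<in> N"
        using x' by (simp add: N(1) mem_shift)
      ultimately show "N \<in> {M \<in> Hull. addr M \<in> U}"
        using addr_eq[OF hN, of "x - t"] by simp
    qed
    then show ?thesis
      using \<epsilon>(1) R(1) by blast
  qed
  then show "openin (hull_topology \<Lambda>) {M \<in> topspace (hull_topology \<Lambda>). addr M \<in> U}"
    unfolding openin_hull_topology topspace_hull_topology by auto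
qed

lemma address_homomorphism_addr: "address_homomorphism \<Lambda> s ell addr"
  unfolding address_homomorphism_def using continuous_map_addr addr_shift by blast

text \<open>Two lifts of one address differ by an integer vector. Applying \<open>phi\<close> to it
  gives - x, so \<open>x\<close> lies in \<open>L\<close>. Once both sets are in \<open>HL\<close>
  the difference lies in the kernel of \<open>phi\<close>, which contains no nonzero integer vector
  because integer coordinates are unique.\<close>

lemma addr_eq_HL:
  assumes M: "M \<in> Hull" and N: "N \<in> HL" and eq: "addr M = addr N"
  shows "M \<in> HL" "corner M = corner N"
proof -
  obtain x where x: "x \<in> M"
    using hull_nonempty[OF M] by blast
  define m where "m = (\<lambda>i. lift M x i - (- comb (corner N) i))"
  have m: "m \<in> euc s" "\<And>i. m i \<in> \<int>"
  proof -
    show "m \<in> euc s"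
      unfolding m_def by (intro euc_diff lift_euc euc_uminus comb_euc)
    show "m i \<in> \<int>" for i
      using eq unfolding addr_eq[OF M x] addr_HL[OF N]
        torus_class_eq_iff[OF lift_euc euc_uminus[OF comb_euc]] m_def by blast
  qed
  have "phi m = - x"
    unfolding m_def lift_def phi_diff phi_uminus phi_ell phi_comb by simp
  then have xL: "x \<in> L"
    using integer_vector(1)[OF m] L_uminus[of "- x"] by simp
  have "y \<in> L" if "y \<in> M" for y
    using L_add[OF hull_difference_L[OF M that x] xL] by simp
  then show MH: "M \<in> HL"
    using M by (auto simp: HL_def)
  define m' where "m' = (\<lambda>i. comb (corner N) i - comb (corner M) i)"
  have m': "m' \<in> euc s" "\<And>i. m' i \<in> \<int>"
  proof -
    show "m' \<in> euc s"
      unfolding m'_def by (intro euc_diff comb_euc)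
    have "\<forall>i. - comb (corner M) i - (- comb (corner N) i) \<in> \<int>"
      using eq unfolding addr_HL[OF MH] addr_HL[OF N]
        torus_class_eq_iff[OF euc_uminus[OF comb_euc] euc_uminus[OF comb_euc]] .
    then show "m' i \<in> \<int>" for i
      by (simp add: m'_def)
  qed
  have "phi m' = 0"
    unfolding m'_def phi_diff phi_comb by simp
  then have "m' = (\<lambda>i. 0)"
    using integer_vector(2)[OF m'] by (simp add: zc_zero)
  then have "comb (corner N) = comb (corner M)"
    by (simp add: m'_def fun_eq_iff)
  then show "corner M = corner N"
    using coords_comb by (intro euc_eqI[OF corner_euc corner_euc]) metis
qed

text \<open>With equal corners \<open>N\<close> is a limit of sets M - u with \<open>u\<close> in
  \<open>L\<close> and S u tending to 0. The values \<pi> (M - u) differ from \<pi> M by ell u,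
  which is comb (S u) modulo integers and tends to 0; continuity at \<open>N\<close>
  concludes.\<close>

lemma homomorphism_eq_if_corner_eq:
  assumes hom: "address_homomorphism \<Lambda> s ell \<pi>" and M: "M \<in> HL" and N: "N \<in> HL"
    and c: "corner M = corner N"
  shows "\<pi> M = \<pi> N"
proof -
  have cont: "continuous_map (hull_topology \<Lambda>) (torus s) \<pi>"
    and equi: "\<And>\<Lambda>' t. \<Lambda>' \<in> Hull \<Longrightarrow> \<pi> (shift \<Lambda>' t) = torus_add (\<pi> \<Lambda>') (torus_class s (ell t))"
    using hom by (auto simp: address_homomorphism_def)
  have "\<pi> M \<in> topspace (torus s)" "\<pi> N \<in> topspace (torus s)"
    using cont M N by (auto simp: continuous_map_def HL_def)
  then obtain p q where p: "p \<in> euc s" "\<pi> N = torus_class s p" and q: "q \<in> euc s" "\<pi> M = torus_class s q"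
    unfolding topspace_torus by blast
  obtain K where K: "K > 0" "\<And>a C i. 0 \<le> C \<Longrightarrow> (\<forall>k<n. \<bar>a k\<bar> \<le> C) \<Longrightarrow> \<bar>comb a i\<bar> \<le> K * C"
    using comb_le by meson
  have "q i - p i \<in> \<int>" for i
  proof (rule Ints_if_approximable)
    fix e :: real assume e: "e > 0"
    define U where "U = torus_class s ` sup_ball s p (e / 2)"
    have "openin (hull_topology \<Lambda>) {X \<in> topspace (hull_topology \<Lambda>). \<pi> X \<in> U}"
      unfolding U_def using cont openin_torus_image_ball by (rule openin_continuous_map_preimage)
    moreover have "N \<in> {X \<in> topspace (hull_topology \<Lambda>). \<pi> X \<in> U}"
      using N p e by (auto simp: HL_def U_def intro!: mem_sup_ball_self)
    ultimately obtain R \<epsilon> where R: "0 < \<epsilon>" "hull_nbhd \<Lambda> N R \<epsilon> \<subseteq> {X \<in> topspace (hull_topology \<Lambda>). \<pi> X \<in> U}"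
      unfolding openin_hull_topology by blast
    define e' where "e' = e / (2 * K)"
    have e': "e' > 0" "K * e' = e / 2"
      using e K(1) by (simp_all add: e'_def)
    obtain u where u: "u \<in> L" "agree R N (shift M u)" "\<And>k. \<bar>S u k - (corner M k - corner N k)\<bar> \<le> e'"
      using approximate_by_shift[OF N M e'(1), of R] by blast
    have "shift (shift M u) 0 \<in> hull_nbhd \<Lambda> N R \<epsilon>"
      using R(1) by (intro hull_nbhdI[OF shift_in_delone_hull[OF HL_hull[OF M]] agree_sym[OF u(2)]]) simp
    then have "\<pi> (shift M u) \<in> U"
      using R(2) by auto
    then have "torus_class s (\<lambda>i. q i + ell u i) \<in> U"
      using equi[OF HL_hull[OF M]] torus_add_class[OF q(1) ell_euc] by (simp add: q(2))
    then obtain z where z: "z \<in> sup_ball s p (e / 2)" "torus_class s (\<lambda>i. q i + ell u i) = torus_class s z"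
      unfolding U_def by blast
    have zE: "z \<in> euc s"
      using z(1) by (simp add: sup_ball_def)
    have int: "q i + ell u i - z i \<in> \<int>"
      using z(2) unfolding torus_class_eq_iff[OF euc_add[OF q(1) ell_euc] zE] by blast
    have "\<bar>z i - p i\<bar> < e / 2"
      using z(1) zE p(1) e by (cases "i < s") (auto simp: sup_ball_def mem_euc)
    moreover have "\<bar>comb (S u) i\<bar> \<le> e / 2"
      using K(2)[of e' "S u" i] e' u(3) c by simp
    moreover have "comb (S u) i = ell u i - zc u i"
      using comb_S[OF u(1)] by simp
    ultimately have "\<bar>q i - p i - ((q i + ell u i - z i) - zc u i)\<bar> < e"
      by linarith
    then show "\<exists>m\<in>\<int>. \<bar>q i - p i - m\<bar> < e"
      by (rule bexI[OF _ Ints_diff[OF int Ints_of_int]])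
  qed
  then show ?thesis
    unfolding p(2) q(2) torus_class_eq_iff[OF q(1) p(1)] by blast
qed

text \<open>Surjectivity yields \<open>M\<close> whose value is that of \<Lambda> moved by - comb y.
  A shift \<Lambda> - u approximates \<open>M\<close>, so - comb y - ell u is within a small error
  \<delta> of an integer vector \<open>m\<close>. For g = phi m one finds ell g - m = comb y + (ell
  (phi \<delta>) - \<delta>), whose coordinates are \<open>y\<close> up to a small term.\<close>

lemma star_dense_if_factor:
  assumes fac: "address_factor_map \<Lambda> s ell \<pi>" and y: "y \<in> euc n" and e: "e > 0"
  shows "\<exists>g\<in>L. S g \<in> sup_ball n y e"
proof -
  have cont: "continuous_map (hull_topology \<Lambda>) (torus s) \<pi>"
    and equi: "\<And>\<Lambda>' t. \<Lambda>' \<in> Hull \<Longrightarrow> \<pi> (shift \<Lambda>' t) = torus_add (\<pi> \<Lambda>') (torus_class s (ell t))"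
    and surj: "\<pi> ` Hull = torus_class s ` euc s"
    using fac by (auto simp: address_factor_map_def address_homomorphism_def topspace_torus)
  have \<Lambda>: "\<Lambda> \<in> Hull"
    using delone by (rule self_mem_delone_hull)
  then obtain q where q: "q \<in> euc s" "\<pi> \<Lambda> = torus_class s q"
    using surj by blast
  define p where "p = (\<lambda>i. q i - comb y i)"
  have p: "p \<in> euc s"
    unfolding p_def by (intro euc_diff q comb_euc)
  then have "torus_class s p \<in> \<pi> ` Hull"
    unfolding surj by blast
  then obtain M where M: "M \<in> Hull" "\<pi> M = torus_class s p"
    by auto
  obtain K where K: "K > 0" "\<And>t i. \<bar>ell t i\<bar> \<le> K * norm t"
    using ell_le by meson
  obtain K' where K': "K' > 0" "\<And>u C k. 0 \<le> C \<Longrightarrow> (\<forall>i<s. \<bar>u i\<bar> \<le> C) \<Longrightarrow> \<bar>coords u k\<bar> \<le> K' * C"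
    using coords_le by meson
  define V where "V = (\<Sum>i<s. norm (v i))"
  have V: "V \<ge> 0"
    unfolding V_def by (intro sum_nonneg) auto
  \<comment> \<open>An error of size d in \<delta> is enlarged to at most (K V + 1) d by forming ell
    (phi \<delta>) - \<delta>, and by a further factor \<open>K'\<close> when taking
    coordinates.\<close>
  define A where "A = K' * (K * V + 1)"
  define d where "d = e / (2 * A)"
  have KV: "A > 0"
    unfolding A_def using K(1) K'(1) V by (intro mult_pos_pos add_nonneg_pos) auto
  have d: "d > 0" "K' * ((K * V + 1) * d) < e"
  proof -
    show "d > 0"
      unfolding d_def using e KV by simp
    have "K' * ((K * V + 1) * d) = A * d"
      by (simp add: A_def)
    also have "\<dots> = e / 2"
      unfolding d_def using KV by simp
    finally show "K' * ((K * V + 1) * d) < e"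
      using e by simp
  qed
  define U where "U = torus_class s ` sup_ball s p d"
  have "openin (hull_topology \<Lambda>) {X \<in> topspace (hull_topology \<Lambda>). \<pi> X \<in> U}"
    unfolding U_def using cont openin_torus_image_ball by (rule openin_continuous_map_preimage)
  moreover have "M \<in> {X \<in> topspace (hull_topology \<Lambda>). \<pi> X \<in> U}"
    using M p d(1) by (auto simp: U_def intro!: mem_sup_ball_self)
  ultimately obtain R \<epsilon> where R: "0 < \<epsilon>" "\<epsilon> < R / 2" "hull_nbhd \<Lambda> M R \<epsilon> \<subseteq> {X \<in> topspace (hull_topology \<Lambda>). \<pi> X \<in> U}"
    unfolding openin_hull_topology by blast
  have "R > 0"
    using R by simp
  then obtain u where u: "agree R (shift \<Lambda> u) (shift M 0)"
    using M(1) unfolding delone_hull_iff by blast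
  have "shift (shift \<Lambda> u) 0 \<in> hull_nbhd \<Lambda> M R \<epsilon>"
    using u R(1) \<Lambda> by (intro hull_nbhdI shift_in_delone_hull) auto
  then have "\<pi> (shift \<Lambda> u) \<in> U"
    using R(3) by auto
  then have "torus_class s (\<lambda>i. q i + ell u i) \<in> U"
    using equi[OF \<Lambda>] torus_add_class[OF q(1) ell_euc] by (simp add: q(2))
  then obtain z where z: "z \<in> sup_ball s p d" "torus_class s z = torus_class s (\<lambda>i. q i + ell u i)"
    unfolding U_def by auto
  have zE: "z \<in> euc s"
    using z(1) by (simp add: sup_ball_def)
  define m where "m = (\<lambda>i. z i - (q i + ell u i))"
  have m: "m \<in> euc s" "\<And>i. m i \<in> \<int>"
    using z(2) unfolding torus_class_eq_iff[OF zE euc_add[OF q(1) ell_euc]] m_def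
    by (auto intro!: euc_diff euc_add zE q ell_euc)
  define g where "g = phi m"
  have g: "g \<in> L" "zc g = m"
    unfolding g_def by (rule integer_vector[OF m])+
  define \<delta> where "\<delta> = (\<lambda>i. z i - p i)"
  have \<delta>: "\<bar>\<delta> i\<bar> < d" if "i < s" for i
    using z(1) that by (simp add: sup_ball_def \<delta>_def)
  have m_eq: "m = (\<lambda>i. (\<delta> i - comb y i) - ell u i)"
    by (simp add: m_def \<delta>_def p_def fun_eq_iff)
  have "g = phi \<delta> - u"
    unfolding g_def m_eq phi_diff phi_comb phi_ell by simp
  then have "ell g = (\<lambda>i. ell (phi \<delta>) i - ell u i)"
    by (simp add: ell_diff)
  then have "(\<lambda>i. ell g i - zc g i) = (\<lambda>i. (ell (phi \<delta>) i - \<delta> i) - (- comb y i))"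
    using fun_cong[OF g(2)] by (simp add: m_eq fun_eq_iff)
  then have Sg: "S g k = coords (\<lambda>i. ell (phi \<delta>) i - \<delta> i) k - coords (\<lambda>i. - comb y i) k" for k
    unfolding S_eq_coords[OF g(1)] by (simp only: coords_diff)
  have "norm (phi \<delta>) \<le> (\<Sum>i<s. d * norm (v i))"
    unfolding phi_def using \<delta> by (intro sum_norm_le) (simp add: mult_right_mono less_imp_le)
  then have nphi: "norm (phi \<delta>) \<le> V * d"
    by (simp add: V_def sum_distrib_left mult.commute)
  have "\<bar>ell (phi \<delta>) i - \<delta> i\<bar> \<le> (K * V + 1) * d" if "i < s" for i
  proof -
    have "\<bar>ell (phi \<delta>) i\<bar> \<le> K * (V * d)"
      using K(1) nphi by (intro order_trans[OF K(2)] mult_left_mono) auto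
    then show ?thesis
      using \<delta>[OF that] by (simp add: algebra_simps)
  qed
  then have small: "\<bar>coords (\<lambda>i. ell (phi \<delta>) i - \<delta> i) k\<bar> < e" for k
    using K'(2)[of "(K * V + 1) * d" "\<lambda>i. ell (phi \<delta>) i - \<delta> i" k] d K(1) V by fastforce
  have "coords (\<lambda>i. - comb y i) k = - y k" if "k < n" for k
    using coords_comb[OF that, of "\<lambda>k. - y k"] by (simp add: comb_uminus)
  then have "S g \<in> sup_ball n y e"
    using small Sg by (intro sup_ballI S_euc) simp
  then show ?thesis
    using g(1) by blast
qed

end

section \<open>Singleton fibres and inter-model sets\<close>

lemma real_eq_if_close:
  fixes a b :: real
  assumes "\<And>e. e > 0 \<Longrightarrow> \<bar>a - b\<bar> \<le> e"
  shows "a = b"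
  using assms[of "\<bar>a - b\<bar> / 2"] by (cases "a = b") auto

lemma null_frontier_translate:
  assumes V: "V \<subseteq> euc n" "sup_bounded n V" and w: "w \<in> euc n"
    and null: "null_Euclidean n (Euc n frontier_of V)"
  shows "null_Euclidean n (Euc n frontier_of (translate w V))"
proof -
  let ?F = "Euc n frontier_of V"
  have "?F \<subseteq> Euc n closure_of V"
    by (simp add: frontier_of_def)
  then have bdd: "sup_bounded n ?F"
    using sup_bounded_closure_of[OF V(2)] sup_bounded_subset by blast
  have eq: "Euc n frontier_of (translate w V) = (\<lambda>x i. w i + x i) ` ?F"
    unfolding translate_def using homeomorphic_map_translate[OF w] V(1)
    by (rule homeomorphic_map_frontier_of)
  then have "closedin (Euc n) ((\<lambda>x i. w i + x i) ` ?F)"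
    by (metis closedin_frontier_of)
  then show ?thesis
    unfolding eq
    by (rule null_Euclidean_sup_lipschitz_image[OF closedin_frontier_of bdd null sup_lipschitz_translate[OF w]])
qed

context address_data
begin

lemma cl_subset_euc: "cl N \<subseteq> euc n"
  using closedin_cl closedin_subset by blast

lemma corner_diff_euc: "(\<lambda>k. corner N' k - corner N k) \<in> euc n"
  by (intro euc_diff corner_euc)

lemma interior_cl_translate:
  assumes "N \<in> HL" "N' \<in> HL"
  shows "Euc n interior_of (cl N') =
    translate (\<lambda>k. corner N' k - corner N k) (Euc n interior_of (cl N))"
  unfolding cl_translate[OF assms] translate_def
  by (rule homeomorphic_map_interior_of[OF homeomorphic_map_translate[OF corner_diff_euc] cl_subset_euc])

lemma frontier_cl_translate:
  assumes "N \<in> HL" "N' \<in> HL"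
  shows "Euc n frontier_of (cl N') =
    translate (\<lambda>k. corner N' k - corner N k) (Euc n frontier_of (cl N))"
  unfolding cl_translate[OF assms] translate_def
  by (rule homeomorphic_map_frontier_of[OF homeomorphic_map_translate[OF corner_diff_euc] cl_subset_euc])

lemma regular_closed_cl_transfer:
  assumes N: "N \<in> HL" "N' \<in> HL"
    and reg: "cl N = Euc n closure_of (Euc n interior_of (cl N))"
  shows "cl N' = Euc n closure_of (Euc n interior_of (cl N'))"
proof -
  let ?f = "\<lambda>x i. (corner N' i - corner N i) + x i"
  have "cl N' = ?f ` cl N"
    by (simp add: cl_translate[OF N] translate_def)
  also have "cl N = Euc n closure_of (Euc n interior_of (cl N))"
    by (rule reg)
  also have "?f ` \<dots> = Euc n closure_of (?f ` (Euc n interior_of (cl N)))"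
    by (rule homeomorphic_map_closure_of[OF homeomorphic_map_translate[OF corner_diff_euc], symmetric])
      (simp add: interior_of_subset_topspace)
  also have "?f ` (Euc n interior_of (cl N)) = Euc n interior_of (cl N')"
    by (simp add: interior_cl_translate[OF N] translate_def)
  finally show ?thesis .
qed

lemma null_frontier_cl_transfer:
  assumes N: "N \<in> HL" "N' \<in> HL" and null: "null_Euclidean n (Euc n frontier_of (cl N))"
  shows "null_Euclidean n (Euc n frontier_of (cl N'))"
  unfolding cl_translate[OF N]
  by (rule null_frontier_translate[OF cl_subset_euc sup_bounded_cl[OF N(1)] corner_diff_euc null])

text \<open>The corners corner N - S (h m) stay bounded, so a subsequence of the shifts converges in
  \<open>HL\<close>, and continuity of the corner identifies the corner of the limit. This realises
  prescribed corners and produces competitors in a given fibre.\<close>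

lemma limit_of_shifts:
  assumes N: "N \<in> HL" and h: "\<And>m. h m \<in> L" "\<And>m. S (h m) \<in> sup_ball n y (1 / real (Suc m))"
    and y: "y \<in> euc n"
  shows "\<exists>M\<in>HL. corner M = (\<lambda>k. corner N k - y k) \<and>
    (\<exists>r. strict_mono r \<and> (\<forall>R. \<forall>\<^sub>F m in sequentially. agree R M (shift N (h (r m)))))"
proof -
  \<comment> \<open>The final 1 absorbs the distance of S (h m) from \<open>y\<close>, which is
    below 1.\<close>
  define C where "C = (\<Sum>k<n. \<bar>corner N k\<bar> + \<bar>y k\<bar>) + 1"
  have "\<bar>corner (shift N (h m)) k\<bar> \<le> C" if k: "k < n" for m k
  proof -
    have "\<bar>S (h m) k - y k\<bar> < 1 / real (Suc m)"
      using h(2)[of m] k by (simp add: sup_ball_def)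
    moreover have "1 / real (Suc m) \<le> 1"
      by simp
    moreover have "\<bar>corner N k\<bar> + \<bar>y k\<bar> \<le> (\<Sum>k<n. \<bar>corner N k\<bar> + \<bar>y k\<bar>)"
      using k by (intro member_le_sum[of k "{..<n}" "\<lambda>k. \<bar>corner N k\<bar> + \<bar>y k\<bar>"]) auto
    ultimately show ?thesis
      unfolding corner_shift[OF N h(1)] C_def by linarith
  qed
  then obtain M r where M: "M \<in> HL" "strict_mono r"
      "\<And>R. \<forall>\<^sub>F m in sequentially. agree R M (shift N (h (r m)))"
    using HL_compact[of "\<lambda>m. shift N (h m)" C] HL_shift[OF N h(1)] by blast
  have "corner M k = corner N k - y k" if k: "k < n" for k
  proof (rule real_eq_if_close)
    fix e :: real assume e: "e > 0"
    then have "e / 2 > 0"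
      by simp
    then obtain R where R: "\<And>N N' k. N \<in> HL \<Longrightarrow> N' \<in> HL \<Longrightarrow> agree R N N' \<Longrightarrow> \<bar>corner N k - corner N' k\<bar> \<le> e / 2"
      using corner_close by meson
    obtain m0 where m0: "1 / real (Suc m0) < e / 2"
      using \<open>e / 2 > 0\<close> nat_approx_posE by (metis of_nat_Suc)
    obtain m1 where m1: "\<And>m. m \<ge> m1 \<Longrightarrow> agree R M (shift N (h (r m)))"
      using M(3)[of R] unfolding eventually_sequentially by blast
    define m where "m = max m0 m1"
    have "\<bar>corner M k - (corner N k - S (h (r m)) k)\<bar> \<le> e / 2"
      using R[OF M(1) HL_shift[OF N h(1)] m1, of m k] unfolding corner_shift[OF N h(1)]
      by (simp add: m_def)
    moreover have "\<bar>S (h (r m)) k - y k\<bar> < 1 / real (Suc (r m))"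
      using h(2)[of "r m"] k by (simp add: sup_ball_def)
    moreover have "m0 \<le> r m"
      using seq_suble[OF M(2), of m] by (simp add: m_def)
    then have "1 / real (Suc (r m)) \<le> 1 / real (Suc m0)"
      by (intro divide_left_mono) auto
    ultimately show "\<bar>corner M k - (corner N k - y k)\<bar> \<le> e"
      using m0 by linarith
  qed
  then have "corner M = (\<lambda>k. corner N k - y k)"
    by (intro euc_eqI[OF corner_euc euc_diff[OF corner_euc y]])
  then show ?thesis
    using M by blast
qed

lemma approximating_sequence:
  assumes "\<And>e. e > 0 \<Longrightarrow> \<exists>g\<in>A. S g \<in> sup_ball n y e"
  shows "\<exists>h. \<forall>m. h m \<in> A \<and> S (h m) \<in> sup_ball n y (1 / real (Suc m))"
  using assms by (intro choice allI) (meson divide_pos_pos of_nat_0_less_iff zero_less_Suc zero_less_one)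

text \<open>Shifts of \<open>N\<close> by elements whose stars tend to \<open>S g\<close>, with
  \<open>g\<close> in \<open>L\<close>, have a limit with the corner of N - g. Uniqueness forces
  this limit to be N - g, so whether 0 belongs to it is inherited from the sequence.\<close>

lemma full_if_unique_fibre:
  assumes fac: "address_factor_map \<Lambda> s ell \<pi>" and M0: "M0 \<in> Hull"
    and unique: "\<And>M. M \<in> Hull \<Longrightarrow> \<pi> M = \<pi> M0 \<Longrightarrow> M = M0"
  shows "\<exists>N\<in>HL. full N \<and> cl N = Euc n closure_of (Euc n interior_of (cl N))"
proof -
  have hom: "address_homomorphism \<Lambda> s ell \<pi>"
    using fac by (simp add: address_factor_map_def)
  then have equi: "\<pi> (shift \<Lambda>' t) = torus_add (\<pi> \<Lambda>') (torus_class s (ell t))" if "\<Lambda>' \<in> Hull" for \<Lambda>' t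
    using that by (simp add: address_homomorphism_def)
  obtain x where x: "x \<in> M0"
    using hull_nonempty[OF M0] by blast
  define N where "N = shift M0 x"
  have N: "N \<in> HL"
    unfolding N_def using M0 x by (rule shift_mem_HL)
  \<comment> \<open>Equivariance carries uniqueness from the fibre of \<open>M0\<close> to the fibre
    of every translate of \<open>N\<close> by an element of \<open>L\<close>.\<close>
  have unique': "M = shift N g" if M: "M \<in> HL" and g: "g \<in> L" and c: "corner M = corner (shift N g)" for M g
  proof -
    have "\<pi> M = \<pi> (shift N g)"
      by (rule homomorphism_eq_if_corner_eq[OF hom M HL_shift[OF N g] c])
    then have "\<pi> (shift M (- x - g)) = \<pi> (shift (shift N g) (- x - g))"
      using M N g by (simp add: equi HL_hull shift_in_delone_hull)
    also have "shift (shift N g) (- x - g) = M0"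
      by (simp add: N_def shift_shift)
    finally have "shift M (- x - g) = M0"
      using M by (intro unique shift_in_delone_hull HL_hull)
    then have "shift (shift M (- x - g)) (x + g) = shift M0 (x + g)"
      by simp
    then show ?thesis
      by (simp add: N_def shift_shift)
  qed
  have closed: "g \<in> N" if g: "g \<in> L" "S g \<in> cl N" for g
  proof -
    have "\<exists>h. \<forall>m. h m \<in> N \<and> S (h m) \<in> sup_ball n (S g) (1 / real (Suc m))"
      using g(2) unfolding cl_def in_closure_of_Euclidean by (intro approximating_sequence) blast
    then obtain h where h: "\<And>m. h m \<in> N" "\<And>m. S (h m) \<in> sup_ball n (S g) (1 / real (Suc m))"
      by blast
    obtain M r where M: "M \<in> HL" "corner M = (\<lambda>k. corner N k - S g k)"
        "\<And>R. \<forall>\<^sub>F m in sequentially. agree R M (shift N (h (r m)))"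
      using limit_of_shifts[OF N HL_mem_L[OF N h(1)] h(2) S_euc] by blast
    have "M = shift N g"
      by (rule unique'[OF M(1) g(1)]) (simp add: M(2) corner_shift[OF N g(1)])
    obtain m where "agree 0 M (shift N (h (r m)))"
      using M(3)[of 0] unfolding eventually_sequentially by blast
    then have "0 \<in> M"
      using h(1) by (simp add: agree_def mem_shift)
    then show ?thesis
      by (simp add: \<open>M = shift N g\<close> mem_shift)
  qed
  \<comment> \<open>Dual use of the same limit: lattice points outside \<open>N\<close> with stars
    tending to \<open>S g\<close> would exclude 0 from N - g, although \<open>g\<close> is in
    \<open>N\<close>.\<close>
  have isolated: "\<exists>d>0. \<forall>h\<in>L. S h \<in> sup_ball n (S g) d \<longrightarrow> h \<in> N" if g: "g \<in> N" for g
  proof (rule ccontr)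
    assume *: "\<not> (\<exists>d>0. \<forall>h\<in>L. S h \<in> sup_ball n (S g) d \<longrightarrow> h \<in> N)"
    have gL: "g \<in> L"
      using HL_mem_L[OF N g] .
    have "\<exists>h. \<forall>m. h m \<in> L - N \<and> S (h m) \<in> sup_ball n (S g) (1 / real (Suc m))"
      using * by (intro approximating_sequence) blast
    then obtain h where h: "\<And>m. h m \<in> L" "\<And>m. h m \<notin> N" "\<And>m. S (h m) \<in> sup_ball n (S g) (1 / real (Suc m))"
      by blast
    obtain M r where M: "M \<in> HL" "corner M = (\<lambda>k. corner N k - S g k)"
        "\<And>R. \<forall>\<^sub>F m in sequentially. agree R M (shift N (h (r m)))"
      using limit_of_shifts[OF N h(1) h(3) S_euc] by blast
    have "M = shift N g"
      by (rule unique'[OF M(1) gL]) (simp add: M(2) corner_shift[OF N gL])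
    then have "0 \<in> M"
      using g by (simp add: mem_shift)
    obtain m where "agree 0 M (shift N (h (r m)))"
      using M(3)[of 0] unfolding eventually_sequentially by blast
    then have "h (r m) \<in> N"
      using \<open>0 \<in> M\<close> by (simp add: agree_def mem_shift)
    then show False
      using h(2) by blast
  qed
  have "S ` N \<subseteq> Euc n interior_of (cl N)"
  proof clarify
    fix g assume "g \<in> N"
    then obtain d where d: "d > 0" "\<And>h. h \<in> L \<Longrightarrow> S h \<in> sup_ball n (S g) d \<Longrightarrow> h \<in> N"
      using isolated by meson
    \<comment> \<open>All lattice stars in this cube come from \<open>N\<close>, and they are dense
      in it.\<close>
    have "sup_ball n (S g) d \<subseteq> cl N"
    proof
      fix y assume y: "y \<in> sup_ball n (S g) d"
      then have yE: "y \<in> euc n"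
        by (simp add: sup_ball_def)
      obtain d' where d': "d' > 0" "sup_ball n y d' \<subseteq> sup_ball n (S g) d"
        using openin_sup_ball[of n "S g" d] y unfolding openin_Euclidean_space_iff by blast
      have "\<exists>z\<in>S ` N. z \<in> sup_ball n y e" if e: "e > 0" for e
      proof -
        have "min d' e > 0"
          using d'(1) e by simp
        then obtain h where h: "h \<in> L" "S h \<in> sup_ball n y (min d' e)"
          using star_dense_if_factor[OF fac yE] by blast
        then have "S h \<in> sup_ball n y d'" "S h \<in> sup_ball n y e"
          by (auto simp: sup_ball_def)
        then show ?thesis
          using d(2)[OF h(1)] d'(2) by blast
      qed
      then show "y \<in> cl N"
        unfolding cl_def in_closure_of_Euclidean using yE by blast
    qed
    then show "S g \<in> Euc n interior_of (cl N)"
      unfolding in_interior_of_Euclidean using d(1) S_euc by blast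
  qed
  then have "Euc n closure_of (S ` N) \<subseteq> Euc n closure_of (Euc n interior_of (cl N))"
    by (rule closure_of_mono)
  then have "cl N \<subseteq> Euc n closure_of (Euc n interior_of (cl N))"
    by (simp only: cl_def[symmetric])
  moreover have "Euc n closure_of (Euc n interior_of (cl N)) \<subseteq> cl N"
    by (intro closure_of_minimal interior_of_subset closedin_cl)
  moreover have "full N"
    unfolding full_def using closed interior_of_subset[of "Euc n" "cl N"] by blast
  ultimately show ?thesis
    using N by blast
qed

text \<open>Under \<open>u \<mapsto> (\<phi>(u), coords (\<ell>(\<phi>(u)) - u))\<close> the lattice \<open>\<int>\<^sup>s\<close> corresponds to the graph of
  \<open>S\<close>, with inverse \<open>(t, y) \<mapsto> \<ell>(t) - comb y\<close>.\<close>

lemma graph_coset_shift: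
  assumes g: "g \<in> L"
  shows "graph_coset L S (t - g, \<lambda>k. y k - S g k) = graph_coset L S (t, y)"
proof (intro equalityI subsetI)
  fix p assume "p \<in> graph_coset L S (t - g, \<lambda>k. y k - S g k)"
  then obtain h where h: "h \<in> L" "p = (t - g + h, \<lambda>k. y k - S g k + S h k)"
    by (auto simp: graph_coset_def)
  have "p = (t + (h - g), \<lambda>k. y k + S (h - g) k)"
    by (simp add: h(2) S_diff[OF h(1) g] fun_eq_iff)
  then show "p \<in> graph_coset L S (t, y)"
    using L_diff[OF h(1) g] by (auto simp: graph_coset_def)
next
  fix p assume "p \<in> graph_coset L S (t, y)"
  then obtain h where h: "h \<in> L" "p = (t + h, \<lambda>k. y k + S h k)"
    by (auto simp: graph_coset_def)
  have "p = (t - g + (h + g), \<lambda>k. y k - S g k + S (h + g) k)"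
    by (simp add: h(2) S_add[OF h(1) g])
  then show "p \<in> graph_coset L S (t - g, \<lambda>k. y k - S g k)"
    using L_add[OF h(1) g] unfolding graph_coset_def by (intro image_eqI[of _ _ "h + g"]) auto
qed

text \<open>A compact cube hits every coset: subtracting the integer part of ell t - comb y changes
  (t, y) by an element of the graph.\<close>

lemma compact_graph_quotient:
  "compact_space (quotient_topology (prod_topology euclidean (Euc n)) (graph_coset L S))"
proof -
  let ?X = "prod_topology euclidean (Euc n) :: ('a \<times> (nat \<Rightarrow> real)) topology"
  let ?q = "graph_coset L S"
  define f where "f = (\<lambda>u. (phi u, coords (\<lambda>i. ell (phi u) i - u i)))"
  define Q where "Q = {u \<in> euc s. \<forall>i<s. \<bar>u i\<bar> \<le> 1}"
  let ?K = "Euc s closure_of Q"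
  have "sup_bounded s Q"
    unfolding sup_bounded_def Q_def by blast
  then have K: "compactin (Euc s) ?K"
    by (simp add: compactin_Euclidean_space_iff sup_bounded_closure_of)
  have coord: "continuous_on (euc s) (\<lambda>u. u i)" for i
    by (rule continuous_on_subset[OF continuous_on_product_coordinates]) simp
  have phi: "continuous_on (euc s) phi"
    unfolding phi_def[abs_def] by (intro continuous_intros coord)
  have ell_phi: "continuous_on (euc s) (\<lambda>u. ell (phi u) i)" for i
    by (rule continuous_on_compose2[OF linear_continuous_on[of "\<lambda>t. ell t i" UNIV] phi])
      (simp_all add: linear_ell flip: linear_conv_bounded_linear)
  have "continuous_map (Euc s) ?X f"
    unfolding f_def
  proof (rule continuous_map_pairedI)
    show "continuous_map (Euc s) euclidean phi"
      using phi by (simp add: continuous_map_Euclidean_space_iff)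
    show "continuous_map (Euc s) (Euc n) (\<lambda>u. coords (\<lambda>i. ell (phi u) i - u i))"
      unfolding coords_def orthonormal_coords_def continuous_map_componentwise_Euclidean_space
        continuous_map_Euclidean_space_iff
      by (intro allI impI continuous_intros coord ell_phi)
  qed
  then have "compactin (quotient_topology ?X ?q) (?q ` f ` ?K)"
    using quotient_imp_continuous_map[OF quotient_map_quotient_topology[of ?X ?q]] K
    by (intro image_compactin)
  moreover have "?q ` f ` ?K = topspace (quotient_topology ?X ?q)"
  proof
    have "f ` ?K \<subseteq> topspace ?X"
      using coords_euc by (auto simp: f_def)
    then show "?q ` f ` ?K \<subseteq> topspace (quotient_topology ?X ?q)"
      unfolding topspace_quotient_topology by (rule image_mono)
    have "?q (t, y) \<in> ?q ` f ` ?K" if y: "y \<in> euc n" for t y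
    proof -
      define w where "w = (\<lambda>i. ell t i - comb y i)"
      define m where "m = (\<lambda>i. of_int \<lfloor>w i\<rfloor> :: real)"
      define u where "u = (\<lambda>i. w i - m i)"
      have wE: "w \<in> euc s"
        unfolding w_def by (intro euc_diff ell_euc comb_euc)
      then have m: "m \<in> euc s" "\<And>i. m i \<in> \<int>"
        by (auto simp: m_def mem_euc)
      define g where "g = phi m"
      have g: "g \<in> L" "zc g = m"
        unfolding g_def by (rule integer_vector[OF m])+
      have "\<bar>u i\<bar> \<le> 1" for i
        unfolding u_def m_def by linarith
      then have "u \<in> Q"
        using euc_diff[OF wE m(1)] by (simp add: Q_def u_def)
      then have uK: "u \<in> ?K"
        using closure_of_subset[of Q "Euc s"] by (auto simp: Q_def)
      have phi_u: "phi u = t - g"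
        unfolding u_def phi_diff by (simp add: w_def phi_diff phi_ell phi_comb g_def)
      have "(\<lambda>i. ell (phi u) i - u i) = (\<lambda>i. comb y i - (ell g i - zc g i))"
        unfolding phi_u using fun_cong[OF g(2)] by (simp add: ell_diff u_def w_def fun_eq_iff)
      then have "coords (\<lambda>i. ell (phi u) i - u i) = (\<lambda>k. coords (comb y) k - S g k)"
        unfolding S_eq_coords[OF g(1)] by (simp only: coords_diff)
      also have "\<dots> = (\<lambda>k. y k - S g k)"
        by (rule euc_eqI[OF euc_diff[OF coords_euc S_euc] euc_diff[OF y S_euc]]) (simp add: coords_comb)
      finally have "f u = (t - g, \<lambda>k. y k - S g k)"
        by (simp add: f_def phi_u)
      then have "?q (f u) = ?q (t, y)"
        by (simp add: graph_coset_shift[OF g(1)])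
      then show ?thesis
        using uK by (metis imageI)
    qed
    then show "topspace (quotient_topology ?X ?q) \<subseteq> ?q ` f ` ?K"
      by auto
  qed
  ultimately show ?thesis
    by (simp add: compact_space_def)
qed

lemma euclidean_CPS_star:
  assumes n: "n > 0" and dense: "\<And>y e. y \<in> euc n \<Longrightarrow> e > 0 \<Longrightarrow> \<exists>g\<in>L. S g \<in> sup_ball n y e"
  shows "euclidean_CPS n L S"
proof -
  let ?X = "prod_topology euclidean (Euc n) :: ('a \<times> (nat \<Rightarrow> real)) topology"
  let ?G = "(\<lambda>g. (g, S g)) ` L"
  have "Euc n closure_of (S ` L) = euc n"
    using dense closure_of_subset_topspace by (fastforce simp: in_closure_of_Euclidean)
  moreover have "subtopology ?X ?G = discrete_topology ?G"
  proof -
    obtain e where e: "e > 0" "\<And>g. g \<in> L \<Longrightarrow> norm g < e \<Longrightarrow> (\<forall>k<n. \<bar>S g k\<bar> < e) \<Longrightarrow> g = 0"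
      using graph_separated by meson
    have "openin (subtopology ?X ?G) {(g, S g)}" if g: "g \<in> L" for g
    proof -
      have "openin ?X (ball g e \<times> sup_ball n (S g) e)"
        by (simp add: openin_prod_Times_iff openin_sup_ball)
      moreover have "{(g, S g)} = (ball g e \<times> sup_ball n (S g) e) \<inter> ?G"
      proof (intro equalityI subsetI)
        fix p assume "p \<in> (ball g e \<times> sup_ball n (S g) e) \<inter> ?G"
        then obtain h where h: "h \<in> L" "p = (h, S h)" "dist g h < e" "S h \<in> sup_ball n (S g) e"
          by auto
        have "h - g = 0"
          using h by (intro e(2) L_diff g)
            (auto simp: S_diff g sup_ball_def dist_norm norm_minus_commute)
        then show "p \<in> {(g, S g)}"
          by (simp add: h(2))
      qed (use g e(1) S_euc in \<open>auto intro!: mem_sup_ball_self\<close>)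
      ultimately show ?thesis
        unfolding openin_subtopology by blast
    qed
    moreover have "?G \<subseteq> topspace ?X"
      using S_euc by auto
    ultimately have "discrete_topology ?G = subtopology ?X ?G"
      unfolding discrete_topology_unique by (auto simp: topspace_subtopology)
    then show ?thesis
      by simp
  qed
  moreover have "compact_space (quotient_topology ?X (graph_coset L S))"
    by (rule compact_graph_quotient)
  ultimately show ?thesis
    unfolding euclidean_CPS_def Let_def
    using n subgroup_L countable_L S_euc by (auto simp: S_add)
qed

text \<open>Fullness and regular closedness are obtained for one \<open>N\<close> and transferred,
  the former to a translate \<open>N0\<close> of \<Lambda>, the latter to \<open>\<Lambda>0\<close>.
  The window is thus the minimal window itself, moved onto that of \<open>N0\<close> by the
  difference of corners.\<close>

lemma regular_inter_model_set_if_factor: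
  assumes n: "n > 0" and fac: "address_factor_map \<Lambda> s ell \<pi>"
    and M0: "M0 \<in> Hull" "\<And>M. M \<in> Hull \<Longrightarrow> \<pi> M = \<pi> M0 \<Longrightarrow> M = M0"
    and \<Lambda>0: "\<Lambda>0 \<in> HL" and null: "null_Euclidean n (Euc n frontier_of (cl \<Lambda>0))"
  shows "regular_inter_model_set \<Lambda>"
proof -
  obtain N where N: "N \<in> HL" "full N"
      "cl N = Euc n closure_of (Euc n interior_of (cl N))"
    using full_if_unique_fibre[OF fac M0] by blast
  obtain x where x: "x \<in> \<Lambda>"
    using delone delone_nonempty by blast
  define N0 where "N0 = shift \<Lambda> x"
  have N0: "N0 \<in> HL"
    unfolding N0_def using self_mem_delone_hull[OF delone] x by (rule shift_mem_HL)
  have full: "full N0"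
    by (rule full_transfer[OF N0 N(1,2)])
  define w where "w = (\<lambda>k. corner N0 k - corner \<Lambda>0 k)"
  have w: "w \<in> euc n"
    unfolding w_def by (rule corner_diff_euc)
  have window: "window n (cl \<Lambda>0)"
    unfolding window_def compactin_Euclidean_space_iff
    using regular_closed_cl_transfer[OF N(1) \<Lambda>0 N(3)] closedin_cl sup_bounded_cl[OF \<Lambda>0] by simp
  have cl_eq: "translate w (cl \<Lambda>0) = cl N0"
    unfolding w_def by (rule cl_translate[OF \<Lambda>0 N0, symmetric])
  have int_eq: "translate w (Euc n interior_of (cl \<Lambda>0)) = Euc n interior_of (cl N0)"
    unfolding w_def by (rule interior_cl_translate[OF \<Lambda>0 N0, symmetric])
  have "euclidean_CPS n L S"
    using n star_dense_if_factor[OF fac] by (rule euclidean_CPS_star)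
  moreover have "shift (model_points L S (Euc n interior_of (cl N0))) (- x) \<subseteq> \<Lambda>"
  proof
    fix t assume "t \<in> shift (model_points L S (Euc n interior_of (cl N0))) (- x)"
    then have "t - x \<in> N0"
      using full by (simp add: mem_shift model_points_def full_def)
    then show "t \<in> \<Lambda>"
      by (simp add: N0_def mem_shift)
  qed
  moreover have "\<Lambda> \<subseteq> shift (model_points L S (cl N0)) (- x)"
  proof
    fix t assume "t \<in> \<Lambda>"
    then have "t - x \<in> N0"
      by (simp add: N0_def mem_shift)
    then show "t \<in> shift (model_points L S (cl N0)) (- x)"
      using HL_mem_L[OF N0] S_mem_cl by (simp add: mem_shift model_points_def)
  qed
  ultimately have "inter_model_data \<Lambda> n L S (cl \<Lambda>0) (- x) w"
    unfolding inter_model_data_def cl_eq int_eq using window w by blast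
  moreover have "null_Euclidean n (Euc n frontier_of (translate w (cl \<Lambda>0)))"
    unfolding cl_eq by (rule null_frontier_cl_transfer[OF \<Lambda>0 N0 null])
  ultimately show ?thesis
    unfolding regular_inter_model_set_def using delone by blast
qed

text \<open>The prescribed window coincides with \<open>cl N\<close> for the translate
  \<open>N\<close> of \<Lambda>. Limits of shifts then realise every corner, and a corner for which
  no star of \<open>L\<close> meets the translated boundary leaves no freedom for the set.\<close>

lemma factor_if_star_inter_model:
  assumes dense: "\<And>y e. y \<in> euc n \<Longrightarrow> e > 0 \<Longrightarrow> \<exists>g\<in>L. S g \<in> sup_ball n y e"
    and W: "closedin (Euc n) W" "W = Euc n closure_of (Euc n interior_of W)"
      "null_Euclidean n (Euc n frontier_of W)"
    and lower: "\<And>g. g \<in> L \<Longrightarrow> S g \<in> Euc n interior_of W \<Longrightarrow> g - t \<in> \<Lambda>"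
    and upper: "\<And>x. x \<in> \<Lambda> \<Longrightarrow> x + t \<in> L \<and> S (x + t) \<in> W"
    and \<Lambda>0: "\<Lambda>0 \<in> HL"
  shows "address_factor_map \<Lambda> s ell addr"
    and "\<exists>w\<in>topspace (torus s). \<exists>!M. M \<in> Hull \<and> addr M = w"
    and "null_Euclidean n (Euc n frontier_of (cl \<Lambda>0))"
proof -
  define N where "N = shift \<Lambda> (- t)"
  have N: "N \<in> HL"
    using shift_in_delone_hull[OF self_mem_delone_hull[OF delone], of "- t"] upper[of "_ - t"]
    by (auto simp: HL_def N_def mem_shift)
  have SN: "S ` N \<subseteq> W"
    using upper[of "_ - t"] by (auto simp: N_def mem_shift)
  have clN: "cl N = W"
  proof
    show "cl N \<subseteq> W"
      unfolding cl_def using SN W(1) by (rule closure_of_minimal)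
    \<comment> \<open>Stars of \<open>L\<close> near an interior point all come from
      \<open>N\<close>, so density puts the interior into the closed set \<open>cl N\<close>;
      regular closedness of \<open>W\<close> then gives all of \<open>W\<close>.\<close>
    have "Euc n interior_of W \<subseteq> cl N"
    proof
      fix y assume y: "y \<in> Euc n interior_of W"
      then obtain d where d: "d > 0" "sup_ball n y d \<subseteq> Euc n interior_of W"
        using openin_interior_of[of "Euc n" W] unfolding openin_Euclidean_space_iff by blast
      have yE: "y \<in> euc n"
        using y by (simp add: in_interior_of_Euclidean)
      have "\<exists>z\<in>S ` N. z \<in> sup_ball n y e" if e: "e > 0" for e
      proof -
        have "min d e > 0"
          using d(1) e by simp
        then obtain g where g: "g \<in> L" "S g \<in> sup_ball n y (min d e)"
          using dense[OF yE] by blast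
        then have "S g \<in> sup_ball n y d" "S g \<in> sup_ball n y e"
          by (auto simp: sup_ball_def)
        moreover from this have "g \<in> N"
          using lower[OF g(1)] d(2) by (auto simp: N_def mem_shift)
        ultimately show ?thesis
          by blast
      qed
      then show "y \<in> cl N"
        unfolding cl_def in_closure_of_Euclidean using yE by blast
    qed
    then show "W \<subseteq> cl N"
      using closure_of_minimal[OF _ closedin_cl] W(2) by metis
  qed
  have full: "full N"
    unfolding full_def clN using lower by (simp add: N_def mem_shift)
  have exists: "\<exists>M\<in>HL. corner M = y" if y: "y \<in> euc n" for y
  proof -
    define z where "z = (\<lambda>k. corner N k - y k)"
    have z: "z \<in> euc n"
      unfolding z_def by (intro euc_diff corner_euc y)
    have "\<exists>h. \<forall>m. h m \<in> L \<and> S (h m) \<in> sup_ball n z (1 / real (Suc m))"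
      using dense[OF z] by (rule approximating_sequence)
    then obtain h where "\<And>m. h m \<in> L" "\<And>m. S (h m) \<in> sup_ball n z (1 / real (Suc m))"
      by blast
    from limit_of_shifts[OF N this z] show ?thesis
      by (auto simp: z_def)
  qed
  have surj: "torus_class s p \<in> addr ` Hull" if p: "p \<in> euc s" for p
  proof -
    \<comment> \<open>The splitting p = ell (phi p) + comb a separates what a translation supplies
      from what the corner must supply.\<close>
    define a where "a = coords (\<lambda>i. p i - ell (phi p) i)"
    have a: "comb a = (\<lambda>i. p i - ell (phi p) i)"
      unfolding a_def by (intro comb_coords euc_diff p ell_euc) (simp add: phi_diff phi_ell)
    obtain M where M: "M \<in> HL" "corner M = (\<lambda>k. - a k)"
      using exists[OF euc_uminus[OF coords_euc]] unfolding a_def by blast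
    have "addr (shift M (phi p)) = torus_class s (\<lambda>i. comb a i + ell (phi p) i)"
      unfolding addr_shift[OF HL_hull[OF M(1)]] addr_HL[OF M(1)] M(2) comb_uminus
      by (simp add: torus_add_class comb_euc ell_euc)
    also have "(\<lambda>i. comb a i + ell (phi p) i) = p"
      by (simp add: a)
    finally show ?thesis
      using shift_in_delone_hull[OF HL_hull[OF M(1)]] by (metis image_eqI)
  qed
  show "address_factor_map \<Lambda> s ell addr"
    unfolding address_factor_map_def using address_homomorphism_addr surj addr_mem_torus
    by (auto simp: topspace_torus)
  show "null_Euclidean n (Euc n frontier_of (cl \<Lambda>0))"
    by (rule null_frontier_cl_transfer[OF N \<Lambda>0]) (simp add: clN W(3))
  define F where "F = Euc n frontier_of W"
  have F: "closedin (Euc n) F" "sup_bounded n F" "F \<subseteq> euc n"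
  proof -
    show "closedin (Euc n) F"
      by (simp add: F_def closedin_frontier_of)
    then show "F \<subseteq> euc n"
      by (rule closedin_subset)
    show "sup_bounded n F"
      using sup_bounded_cl[OF N] unfolding F_def clN
      by (rule sup_bounded_subset) (simp add: frontier_of_def closure_of_closedin[OF W(1)])
  qed
  define r where "r = (\<lambda>g x k. (S g k + corner N k) - x k)"
  have r_euc: "r g x \<in> euc n" if "x \<in> euc n" for g x
    unfolding r_def by (intro euc_diff euc_add S_euc corner_euc that)
  have r_lip: "sup_lipschitz n n (r g) 1" for g
    using r_euc by (auto simp: sup_lipschitz_def) (auto simp: r_def abs_minus_commute)
  have r_closed: "closedin (Euc n) (r g ` F)" for g
  proof -
    have "r g ` F = {x \<in> euc n. r g x \<in> F}"
    proof (intro equalityI subsetI)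
      fix x assume "x \<in> {x \<in> euc n. r g x \<in> F}"
      moreover have "x = r g (r g x)"
        by (simp add: r_def)
      ultimately show "x \<in> r g ` F"
        by blast
    qed (use r_euc F(3) in \<open>auto simp: r_def\<close>)
    then show ?thesis
      using closedin_continuous_map_preimage[OF sup_lipschitz_continuous_map[OF r_lip] F(1)] by simp
  qed
  have "null_Euclidean n (r g ` F)" for g
    using F(1,2) W(3) r_lip r_closed unfolding F_def by (rule null_Euclidean_sup_lipschitz_image)
  then obtain y where y: "y \<in> euc n" "\<And>g. g \<in> L \<Longrightarrow> y \<notin> r g ` F"
    using exists_outside_null_sets[OF countable_L, of n "\<lambda>g. r g ` F"] by blast
  obtain M where M: "M \<in> HL" "corner M = y"
    using exists[OF y(1)] by blast
  \<comment> \<open>With no star of \<open>L\<close> on the boundary, fullness decides membership of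
    every lattice point, so the corner \<open>y\<close> determines the set.\<close>
  have cut: "M' = {g \<in> L. S g \<in> cl M'}" if M': "M' \<in> HL" "corner M' = y" for M'
  proof (intro equalityI subsetI)
    fix g assume "g \<in> {g \<in> L. S g \<in> cl M'}"
    then have g: "g \<in> L" "S g \<in> cl M'"
      by simp_all
    have "S g \<notin> Euc n frontier_of (cl M')"
    proof
      assume "S g \<in> Euc n frontier_of (cl M')"
      then have "(\<lambda>k. S g k - (y k - corner N k)) \<in> F"
        unfolding frontier_cl_translate[OF N M'(1)] clN M'(2) F_def mem_translate_iff .
      moreover have "y = r g (\<lambda>k. S g k - (y k - corner N k))"
        by (simp add: r_def)
      ultimately show False
        using y(2)[OF g(1)] by blast
    qed
    then have "S g \<in> Euc n interior_of (cl M')"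
      using g(2) by (simp add: frontier_of_def closure_of_closedin[OF closedin_cl])
    then show "g \<in> M'"
      using full_transfer[OF M'(1) N full] g(1) by (simp add: full_def)
  qed (use HL_mem_L[OF M'(1)] S_mem_cl in auto)
  have "M' = M" if M': "M' \<in> Hull" "addr M' = addr M" for M'
  proof -
    have M'H: "M' \<in> HL" "corner M' = y"
      using addr_eq_HL[OF M'(1) M(1) M'(2)] M(2) by simp_all
    have "cl M' = cl M"
      unfolding cl_translate[OF N M'H(1)] cl_translate[OF N M(1)] M'H(2) M(2) ..
    then show ?thesis
      using cut[OF M'H] cut[OF M] by simp
  qed
  then show "\<exists>w\<in>topspace (torus s). \<exists>!M. M \<in> Hull \<and> addr M = w"
    using addr_mem_torus[of M] HL_hull[OF M(1)] by (intro bexI[of _ "addr M"] ex1I[of _ M]) auto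
qed

end

section \<open>Comparison of cut and project schemes\<close>

text \<open>Gaussian elimination, by induction on the equations: one equation is used to remove one
  unknown.\<close>

lemma homogeneous_system_nontrivial_solution:
  fixes a :: "'k \<Rightarrow> 'j \<Rightarrow> real"
  assumes "finite K" "finite J" "card K < card J"
  shows "\<exists>x. (\<exists>j\<in>J. x j \<noteq> 0) \<and> (\<forall>k\<in>K. (\<Sum>j\<in>J. a k j * x j) = 0)"
  using assms
proof (induction K arbitrary: J a rule: finite_induct)
  case empty
  then have "J \<noteq> {}"
    by auto
  then show ?case
    by (intro exI[of _ "\<lambda>_. 1"]) auto
next
  case (insert k0 K)
  show ?case
  proof (cases "\<forall>j\<in>J. a k0 j = 0")
    case True
    have "card K < card J"
      using insert by simp
    then obtain x where "\<exists>j\<in>J. x j \<noteq> 0" "\<forall>k\<in>K. (\<Sum>j\<in>J. a k j * x j) = 0"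
      using insert.IH[OF insert.prems(1)] by blast
    then show ?thesis
      using True by (intro exI[of _ x]) auto
  next
    case False
    then obtain j0 where j0: "j0 \<in> J" "a k0 j0 \<noteq> 0"
      by blast
    define J' where "J' = J - {j0}"
    \<comment> \<open>The remaining coefficients after substituting the value of the unknown
      \<open>j0\<close> taken from equation \<open>k0\<close>.\<close>
    define a' where "a' = (\<lambda>k j. a k j - a k j0 * a k0 j / a k0 j0)"
    have J': "finite J'" "card K < card J'"
      using insert j0 by (simp_all add: J'_def)
    obtain x where x: "\<exists>j\<in>J'. x j \<noteq> 0" "\<forall>k\<in>K. (\<Sum>j\<in>J'. a' k j * x j) = 0"
      using insert.IH[OF J', of a'] by blast
    define c where "c = - (\<Sum>j\<in>J'. a k0 j * x j) / a k0 j0"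
    define x' where "x' = (\<lambda>j. if j = j0 then c else x j)"
    have split: "(\<Sum>j\<in>J. a k j * x' j) = a k j0 * c + (\<Sum>j\<in>J'. a k j * x j)" for k
    proof -
      have "(\<Sum>j\<in>J. a k j * x' j) = a k j0 * x' j0 + (\<Sum>j\<in>J'. a k j * x' j)"
        unfolding J'_def using insert.prems(1) j0(1) by (rule sum.remove)
      also have "(\<Sum>j\<in>J'. a k j * x' j) = (\<Sum>j\<in>J'. a k j * x j)"
        by (intro sum.cong) (auto simp: x'_def J'_def)
      finally show ?thesis
        by (simp add: x'_def)
    qed
    have "(\<Sum>j\<in>J. a k j * x' j) = 0" if k: "k \<in> insert k0 K" for k
    proof (cases "k = k0")
      case True
      then show ?thesis
        unfolding split using j0(2) by (simp add: c_def)
    next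
      case False
      then have "0 = (\<Sum>j\<in>J'. a' k j * x j)"
        using x(2) k by simp
      also have "\<dots> = (\<Sum>j\<in>J'. a k j * x j) - (a k j0 / a k0 j0) * (\<Sum>j\<in>J'. a k0 j * x j)"
        by (simp add: a'_def left_diff_distrib sum_subtractf sum_distrib_left mult.assoc)
      also have "\<dots> = a k j0 * c + (\<Sum>j\<in>J'. a k j * x j)"
        by (simp add: c_def)
      finally show ?thesis
        unfolding split by simp
    qed
    moreover have "\<exists>j\<in>J. x' j \<noteq> 0"
      using x(1) by (auto simp: x'_def J'_def)
    ultimately show ?thesis
      by blast
  qed
qed

text \<open>Pigeonhole: a bounded region meets finitely many small cells of the joint space, and
  separation allows one point per cell.\<close>

lemma finite_bounded_separated:
  fixes \<sigma> :: "'a::euclidean_space \<Rightarrow> nat \<Rightarrow> real"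
  assumes e: "e > 0" and sep: "\<And>x y. x \<in> A \<Longrightarrow> y \<in> A \<Longrightarrow> norm (x - y) < e \<Longrightarrow>
      (\<forall>k<m. \<bar>\<sigma> x k - \<sigma> y k\<bar> < e) \<Longrightarrow> x = y"
    and B: "\<And>x. x \<in> A \<Longrightarrow> norm x \<le> B" "\<And>x k. x \<in> A \<Longrightarrow> k < m \<Longrightarrow> \<bar>\<sigma> x k\<bar> \<le> B"
  shows "finite A"
proof -
  \<comment> \<open>Dividing by the dimension makes the sum of the coordinate differences, and hence
    the norm, smaller than \<open>e\<close>.\<close>
  define h where "h = e / DIM('a)"
  have h: "h > 0" "h \<le> e"
    using e by (simp_all add: h_def divide_le_eq mult_le_cancel_left1 Suc_leI)
  define f where "f = (\<lambda>x. (\<lambda>i\<in>Basis. \<lfloor>(x \<bullet> i) / h\<rfloor>, \<lambda>k\<in>{..<m}. \<lfloor>\<sigma> x k / h\<rfloor>))"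
  define I where "I = {\<lfloor>- (B / h)\<rfloor>..\<lfloor>B / h\<rfloor>}"
  have I: "\<lfloor>z / h\<rfloor> \<in> I" if "\<bar>z\<bar> \<le> B" for z
  proof -
    have "- (B / h) \<le> z / h" "z / h \<le> B / h"
      using that h(1) by (auto simp: abs_le_iff field_simps)
    then show ?thesis
      by (auto simp: I_def intro: floor_mono)
  qed
  have "inj_on f A"
  proof (rule inj_onI)
    fix x y assume xy: "x \<in> A" "y \<in> A" "f x = f y"
    have 1: "\<lfloor>(x \<bullet> i) / h\<rfloor> = \<lfloor>(y \<bullet> i) / h\<rfloor>" if "i \<in> Basis" for i
      using fun_cong[of _ _ i, OF arg_cong[OF xy(3), of fst]] that by (simp add: f_def)
    have 2: "\<lfloor>\<sigma> x k / h\<rfloor> = \<lfloor>\<sigma> y k / h\<rfloor>" if "k < m" for k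
      using fun_cong[of _ _ k, OF arg_cong[OF xy(3), of snd]] that by (simp add: f_def)
    have "norm (x - y) \<le> (\<Sum>i\<in>Basis. \<bar>(x - y) \<bullet> i\<bar>)"
      by (rule norm_le_l1)
    also have "\<dots> < (\<Sum>i\<in>(Basis::'a set). h)"
      using same_floor_close[OF h(1) 1] by (intro sum_strict_mono) (auto simp: inner_diff_left)
    also have "\<dots> = e"
      by (simp add: h_def)
    finally show "x = y"
      using same_floor_close[OF h(1) 2] h(2) by (intro sep xy(1,2)) (auto intro: less_le_trans)
  qed
  moreover have "f x \<in> PiE Basis (\<lambda>_. I) \<times> PiE {..<m} (\<lambda>_. I)" if "x \<in> A" for x
    unfolding f_def mem_Times_iff fst_conv snd_conv restrict_PiE_iff
    using I B(2)[OF that] order_trans[OF Basis_le_norm B(1)[OF that]] by blast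
  then have "f ` A \<subseteq> PiE Basis (\<lambda>_. I) \<times> PiE {..<m} (\<lambda>_. I)"
    by blast
  moreover have "finite (PiE (Basis::'a set) (\<lambda>_. I) \<times> PiE {..<m} (\<lambda>_. I))"
    by (intro finite_cartesian_product finite_PiE) (auto simp: I_def)
  ultimately show ?thesis
    by (meson finite_imageD finite_subset)
qed

section \<open>The lattice and star map of an arbitrary scheme that presents
  \<open>\<Lambda>\<close>\<close>

locale inter_model_address = address_data +
  fixes m :: nat and \<Gamma> :: "'a set" and \<sigma> :: "'a \<Rightarrow> nat \<Rightarrow> real" and W :: "(nat \<Rightarrow> real) set"
    and t :: 'a and w :: "nat \<Rightarrow> real"
  assumes inter: "inter_model_data \<Lambda> m \<Gamma> \<sigma> W t w"
begin

lemmas inter_unfolded = inter[unfolded inter_model_data_def euclidean_CPS_def window_def Let_def]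

lemma m_pos: "m > 0"
  using inter_unfolded by (elim conjE)

lemma subgroup_\<Gamma>: "add_subgroup \<Gamma>"
  using inter_unfolded by (elim conjE)

lemma \<sigma>_image: "\<sigma> ` \<Gamma> \<subseteq> euc m"
  using inter_unfolded by (elim conjE)

lemma \<sigma>_additive: "\<forall>g\<in>\<Gamma>. \<forall>h\<in>\<Gamma>. \<forall>k. \<sigma> (g + h) k = \<sigma> g k + \<sigma> h k"
  using inter_unfolded by (elim conjE)

lemma \<sigma>_closure: "Euc m closure_of (\<sigma> ` \<Gamma>) = euc m"
  using inter_unfolded by (elim conjE)

lemma \<sigma>_discrete: "subtopology (prod_topology euclidean (Euc m)) ((\<lambda>g. (g, \<sigma> g)) ` \<Gamma>)
    = discrete_topology ((\<lambda>g. (g, \<sigma> g)) ` \<Gamma>)"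
  using inter_unfolded by (elim conjE)

lemma W_compact: "compactin (Euc m) W"
  using inter_unfolded by (elim conjE)

lemma W_regular: "W = Euc m closure_of (Euc m interior_of W)"
  using inter_unfolded by (elim conjE)

lemma w_euc: "w \<in> euc m"
  using inter_unfolded by (elim conjE)

lemma lower: "shift (model_points \<Gamma> \<sigma> (translate w (Euc m interior_of W))) t \<subseteq> \<Lambda>"
  using inter_unfolded by (elim conjE)

lemma upper: "\<Lambda> \<subseteq> shift (model_points \<Gamma> \<sigma> (translate w W)) t"
  using inter_unfolded by (elim conjE)

lemma \<sigma>_euc: "g \<in> \<Gamma> \<Longrightarrow> \<sigma> g \<in> euc m"
  using \<sigma>_image by blast

lemma \<sigma>_add: "g \<in> \<Gamma> \<Longrightarrow> h \<in> \<Gamma> \<Longrightarrow> \<sigma> (g + h) k = \<sigma> g k + \<sigma> h k"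
  using \<sigma>_additive by simp

lemma \<sigma>_dense: "y \<in> euc m \<Longrightarrow> e > 0 \<Longrightarrow> \<exists>g\<in>\<Gamma>. \<sigma> g \<in> sup_ball m y e"
  using \<sigma>_closure in_closure_of_Euclidean[of y m "\<sigma> ` \<Gamma>"] by auto

lemma \<sigma>_zero: "\<sigma> 0 k = 0"
  using \<sigma>_add[of 0 0 k] add_subgroup_zero[OF subgroup_\<Gamma>] by simp

lemma \<sigma>_diff: "g \<in> \<Gamma> \<Longrightarrow> h \<in> \<Gamma> \<Longrightarrow> \<sigma> (g - h) k = \<sigma> g k - \<sigma> h k"
  using \<sigma>_add[of "g - h" h k] add_subgroup_diff[OF subgroup_\<Gamma>, of g h] by simp

lemma \<sigma>_uminus: "g \<in> \<Gamma> \<Longrightarrow> \<sigma> (- g) k = - \<sigma> g k"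
  using \<sigma>_diff[of 0 g k] add_subgroup_zero[OF subgroup_\<Gamma>] by (simp add: \<sigma>_zero)

lemma \<sigma>_scale_nat: "g \<in> \<Gamma> \<Longrightarrow> \<sigma> (real N *\<^sub>R g) k = real N * \<sigma> g k"
  by (induction N)
    (simp_all add: \<sigma>_zero \<sigma>_add add_subgroup_scale_nat[OF subgroup_\<Gamma>] scaleR_add_left distrib_right)

lemma \<sigma>_scale_int: "g \<in> \<Gamma> \<Longrightarrow> \<sigma> (of_int z *\<^sub>R g) k = of_int z * \<sigma> g k"
  by (cases z rule: int_cases2)
    (simp_all add: \<sigma>_scale_nat \<sigma>_uminus add_subgroup_scale_nat[OF subgroup_\<Gamma>])

lemma \<sigma>_sum: "(\<And>i. i \<in> I \<Longrightarrow> f i \<in> \<Gamma>) \<Longrightarrow> \<sigma> (sum f I) k = (\<Sum>i\<in>I. \<sigma> (f i) k)"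
  by (induction I rule: infinite_finite_induct)
    (simp_all add: \<sigma>_zero \<sigma>_add add_subgroup_sum[OF subgroup_\<Gamma>])

text \<open>Discreteness of the graph at the origin; subtraction in \<Gamma> makes it a uniform
  separation.\<close>

lemma \<sigma>_separated: "\<exists>e>0. \<forall>g\<in>\<Gamma>. norm g < e \<longrightarrow> (\<forall>k<m. \<bar>\<sigma> g k\<bar> < e) \<longrightarrow> g = 0"
proof -
  let ?X = "prod_topology euclidean (Euc m) :: ('a \<times> (nat \<Rightarrow> real)) topology"
  let ?G = "(\<lambda>g. (g, \<sigma> g)) ` \<Gamma>"
  have \<sigma>0: "\<sigma> 0 = (\<lambda>k. 0)"
    using \<sigma>_zero by blast
  have "openin (subtopology ?X ?G) {(0, \<sigma> 0)}"
    unfolding \<sigma>_discrete using add_subgroup_zero[OF subgroup_\<Gamma>] by simp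
  then obtain T where T: "openin ?X T" "{(0, \<sigma> 0)} = T \<inter> ?G"
    unfolding openin_subtopology by blast
  then have "(0, \<sigma> 0) \<in> T"
    by blast
  then obtain U V where UV: "open U" "openin (Euc m) V" "0 \<in> U" "\<sigma> 0 \<in> V" "U \<times> V \<subseteq> T"
    using T(1)[unfolded openin_prod_topology_alt, rule_format, of 0 "\<sigma> 0"] by auto
  obtain e1 where e1: "e1 > 0" "ball 0 e1 \<subseteq> U"
    using UV(1,3) unfolding open_contains_ball by blast
  obtain e2 where e2: "e2 > 0" "sup_ball m (\<sigma> 0) e2 \<subseteq> V"
    using UV(2,4) unfolding openin_Euclidean_space_iff by blast
  have "g = 0" if g: "g \<in> \<Gamma>" "norm g < min e1 e2" "\<forall>k<m. \<bar>\<sigma> g k\<bar> < min e1 e2" for g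
  proof -
    have "g \<in> U"
      using e1(2) g(2) by auto
    moreover have "\<sigma> g \<in> V"
      using e2(2) g(3) \<sigma>_euc[OF g(1)] by (auto simp: \<sigma>0 sup_ball_def)
    ultimately have "(g, \<sigma> g) \<in> T \<inter> ?G"
      using UV(5) g(1) by blast
    then show ?thesis
      unfolding T(2)[symmetric] by simp
  qed
  then show ?thesis
    using e1(1) e2(1) by (intro exI[of _ "min e1 e2"]) auto
qed

definition "V = translate w W"

lemma V_int: "translate w (Euc m interior_of W) = Euc m interior_of V"
  unfolding V_def translate_def using compactin_subset_topspace[OF W_compact]
  by (intro homeomorphic_map_interior_of[OF homeomorphic_map_translate[OF w_euc], symmetric])

lemma W_subset: "W \<subseteq> euc m"
  by (rule compactin_subset_topspace[OF W_compact])

lemma V_subset: "V \<subseteq> euc m"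
  using W_subset w_euc by (auto simp: V_def translate_def intro: euc_add)

lemma V_compact: "compactin (Euc m) V"
  unfolding V_def translate_def
  using W_compact homeomorphic_imp_continuous_map[OF homeomorphic_map_translate[OF w_euc]]
  by (rule image_compactin)

lemma V_regular: "V = Euc m closure_of (Euc m interior_of V)"
proof -
  have "V = (\<lambda>x i. w i + x i) ` (Euc m closure_of (Euc m interior_of W))"
    unfolding V_def translate_def using W_regular by simp
  also have "\<dots> = Euc m closure_of ((\<lambda>x i. w i + x i) ` (Euc m interior_of W))"
    by (rule homeomorphic_map_closure_of[OF homeomorphic_map_translate[OF w_euc], symmetric])
      (simp add: interior_of_subset_topspace)
  finally show ?thesis
    unfolding V_int[symmetric] translate_def .
qed

lemma lower_V: "g \<in> \<Gamma> \<Longrightarrow> \<sigma> g \<in> Euc m interior_of V \<Longrightarrow> g - t \<in> \<Lambda>"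
  using lower unfolding V_int by (auto simp: mem_shift model_points_def)

lemma upper_V: "x \<in> \<Lambda> \<Longrightarrow> x + t \<in> \<Gamma> \<and> \<sigma> (x + t) \<in> V"
  using upper unfolding V_def[symmetric] by (auto simp: mem_shift model_points_def)

lemma difference_\<Gamma>: "x \<in> \<Lambda> \<Longrightarrow> y \<in> \<Lambda> \<Longrightarrow> x - y \<in> \<Gamma>"
  using add_subgroup_diff[OF subgroup_\<Gamma>, of "x + t" "y + t"] upper_V by simp

text \<open>An element with small star is a difference of two points of \<Lambda>, since adding it
  to a point with star near the middle of a ball in the window keeps the star interior. A general
  \<open>g\<close> is N q + (g - N q), where the star of \<open>q\<close> approximates that of
  \<open>g\<close> divided by N; both \<open>q\<close> and the remainder have small stars.\<close>

lemma L_eq: "L = \<Gamma>"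
proof
  show "L \<subseteq> \<Gamma>"
    unfolding L_def using difference_\<Gamma>
    by (intro generated_subgroup_minimal subgroup_\<Gamma>) (auto simp: difference_set_def)
  obtain x where "x \<in> \<Lambda>"
    using delone delone_nonempty by blast
  then have "V \<noteq> {}"
    using upper_V by blast
  then have "Euc m interior_of V \<noteq> {}"
    using V_regular by (metis closure_of_empty)
  then obtain p where p: "p \<in> Euc m interior_of V"
    by blast
  then obtain d where d: "d > 0" "sup_ball m p d \<subseteq> Euc m interior_of V"
    using openin_interior_of[of "Euc m" V] unfolding openin_Euclidean_space_iff by blast
  \<comment> \<open>One half for the distance from the star of \<open>h\<close> to \<open>p\<close>,
    the other for the star added to it.\<close>
  define e where "e = d / 2"
  have e: "e > 0"
    using d(1) by (simp add: e_def)
  have "p \<in> euc m"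
    using p by (simp add: in_interior_of_Euclidean)
  then obtain h where h: "h \<in> \<Gamma>" "\<sigma> h \<in> sup_ball m p e"
    using \<sigma>_dense e by blast
  have small: "g \<in> L" if g: "g \<in> \<Gamma>" "\<And>k. k < m \<Longrightarrow> \<bar>\<sigma> g k\<bar> < e" for g
  proof -
    have hg: "h + g \<in> \<Gamma>"
      by (rule add_subgroup_add[OF subgroup_\<Gamma> h(1) g(1)])
    have "\<sigma> h \<in> sup_ball m p d"
      using h(2) sup_ball_mono[of e d m p] d(1) by (auto simp: e_def)
    moreover have "\<sigma> (h + g) \<in> sup_ball m p d"
    proof (rule sup_ballI[OF \<sigma>_euc[OF hg]])
      fix k assume k: "k < m"
      then have "\<bar>\<sigma> h k - p k\<bar> < e"
        using h(2) by (simp add: sup_ball_def)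
      then show "\<bar>\<sigma> (h + g) k - p k\<bar> < d"
        using g(2)[OF k] unfolding \<sigma>_add[OF h(1) g(1)] e_def by linarith
    qed
    ultimately have "h - t \<in> \<Lambda>" "h + g - t \<in> \<Lambda>"
      using d(2) lower_V h(1) hg by blast+
    then have "(h + g - t) - (h - t) \<in> L"
      using self_mem_delone_hull[OF delone] by (intro hull_difference_L)
    then show ?thesis
      by simp
  qed
  show "\<Gamma> \<subseteq> L"
  proof
    fix g assume g: "g \<in> \<Gamma>"
    define B where "B = (\<Sum>k<m. \<bar>\<sigma> g k\<bar>)"
    have B: "\<bar>\<sigma> g k\<bar> \<le> B" if "k < m" for k
      unfolding B_def using that by (intro member_le_sum) auto
    obtain N :: nat where N: "B < real N * (e / 2)"
      using reals_Archimedean3[of "e / 2"] e by auto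
    have "B \<ge> 0"
      unfolding B_def by (intro sum_nonneg) auto
    then have N0: "real N > 0"
      using N e by (cases "N = 0") auto
    define y where "y = (\<lambda>k. 1 / real N * \<sigma> g k)"
    have "y \<in> euc m"
      unfolding y_def using \<sigma>_euc[OF g] by (rule euc_scale)
    moreover have "e / (2 * real N) > 0"
      using e N0 by simp
    ultimately obtain q where q: "q \<in> \<Gamma>" "\<sigma> q \<in> sup_ball m y (e / (2 * real N))"
      using \<sigma>_dense by blast
    have close: "\<bar>\<sigma> q k - y k\<bar> < e / (2 * real N)" if "k < m" for k
      using q(2) that by (simp add: sup_ball_def)
    have Nq: "real N *\<^sub>R q \<in> \<Gamma>"
      by (rule add_subgroup_scale_nat[OF subgroup_\<Gamma> q(1)])
    have "q \<in> L"
    proof (rule small[OF q(1)])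
      fix k assume k: "k < m"
      have "e / (2 * real N) \<le> e / 2"
        using e N0 by (intro divide_left_mono) auto
      moreover have "\<bar>y k\<bar> < e / 2"
        using B[OF k] N N0 by (simp add: y_def abs_mult divide_less_eq mult.commute)
      ultimately show "\<bar>\<sigma> q k\<bar> < e"
        using close[OF k] by linarith
    qed
    moreover have "g - real N *\<^sub>R q \<in> L"
    proof (rule small)
      show "g - real N *\<^sub>R q \<in> \<Gamma>"
        by (rule add_subgroup_diff[OF subgroup_\<Gamma> g Nq])
      fix k assume k: "k < m"
      have "\<sigma> (g - real N *\<^sub>R q) k = - (real N * (\<sigma> q k - y k))"
        using N0 by (simp add: \<sigma>_diff[OF g Nq] \<sigma>_scale_nat[OF q(1)] y_def right_diff_distrib)
      then have "\<bar>\<sigma> (g - real N *\<^sub>R q) k\<bar> = real N * \<bar>\<sigma> q k - y k\<bar>"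
        by (simp add: abs_mult)
      also have "\<dots> < real N * (e / (2 * real N))"
        using close[OF k] N0 by (intro mult_strict_left_mono)
      also have "\<dots> \<le> e"
        using N0 e by simp
      finally show "\<bar>\<sigma> (g - real N *\<^sub>R q) k\<bar> < e" .
    qed
    ultimately have "real N *\<^sub>R q + (g - real N *\<^sub>R q) \<in> L"
      by (intro L_add add_subgroup_scale_nat[OF subgroup_L])
    then show "g \<in> L"
      by simp
  qed
qed

lemma \<sigma>_zc: "g \<in> L \<Longrightarrow> \<sigma> g k = (\<Sum>j<s. zc g j * \<sigma> (v j) k)"
proof -
  assume g: "g \<in> L"
  have vL: "v j \<in> \<Gamma>" if "j < s" for j
    using v_mem_L[OF that] L_eq by simp
  have "\<sigma> g k = \<sigma> (phi (zc g)) k"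
    by (simp add: phi_zc[OF g])
  also have "\<dots> = (\<Sum>j<s. \<sigma> (zc g j *\<^sub>R v j) k)"
    unfolding phi_def using vL by (intro \<sigma>_sum add_subgroup_scale_int[OF subgroup_\<Gamma>]) auto
  also have "\<dots> = (\<Sum>j<s. zc g j * \<sigma> (v j) k)"
    using vL by (intro sum.cong) (auto simp: \<sigma>_scale_int)
  finally show ?thesis .
qed

text \<open>Compactness of the window bounds \<sigma> on differences of \<Lambda>, and \<sigma> is a
  linear form in the integer coordinates, so this form vanishes on the image of
  \<open>ell\<close>.\<close>

lemma \<sigma>_ell: "k < m \<Longrightarrow> (\<Sum>j<s. ell x j * \<sigma> (v j) k) = 0"
proof -
  assume k: "k < m"
  obtain C where C: "\<And>y. y \<in> V \<Longrightarrow> \<bar>y k\<bar> \<le> C"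
    using V_compact k unfolding compactin_Euclidean_space_iff sup_bounded_def by blast
  show ?thesis
  proof (rule zero_if_bounded_on_coordinates)
    fix x y assume xy: "x \<in> \<Lambda>" "y \<in> \<Lambda>"
    have "\<sigma> (x - y) k = \<sigma> (x + t) k - \<sigma> (y + t) k"
      using \<sigma>_diff[of "x + t" "y + t" k] upper_V[OF xy(1)] upper_V[OF xy(2)] by simp
    moreover have "\<bar>\<sigma> (x + t) k\<bar> \<le> C" "\<bar>\<sigma> (y + t) k\<bar> \<le> C"
      using C upper_V xy by blast+
    ultimately have "\<bar>\<sigma> (x - y) k\<bar> \<le> 2 * C"
      by linarith
    then show "\<bar>\<Sum>j<s. zc (x - y) j * \<sigma> (v j) k\<bar> \<le> 2 * C"
      using \<sigma>_zc[of "x - y" k] difference_\<Gamma>[OF xy] L_eq by simp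
  qed
qed

text \<open>Both star maps factor through \<open>\<real>\<^sup>s / \<ell>(\<real>\<^sup>d)\<close>, hence differ by the matrix \<open>T\<close>.\<close>

definition T :: "nat \<Rightarrow> nat \<Rightarrow> real" where
  "T k i = - (\<Sum>j<s. b i j * \<sigma> (v j) k)"

lemma comb_\<sigma>: "(\<Sum>j<s. comb x j * \<sigma> (v j) k) = - (\<Sum>i<n. T k i * x i)"
proof -
  have "(\<Sum>j<s. comb x j * \<sigma> (v j) k) = (\<Sum>j<s. \<Sum>i<n. x i * (b i j * \<sigma> (v j) k))"
    by (simp add: comb_def sum_distrib_right mult.assoc)
  also have "\<dots> = (\<Sum>i<n. x i * (\<Sum>j<s. b i j * \<sigma> (v j) k))"
    by (subst sum.swap) (simp add: sum_distrib_left)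
  also have "\<dots> = - (\<Sum>i<n. T k i * x i)"
    by (simp add: T_def sum_negf mult.commute)
  finally show ?thesis .
qed

text \<open>In zc g = ell g - comb (S g) the first term contributes nothing by
  \<open>\<sigma>_ell\<close>.\<close>

lemma \<sigma>_eq_T: "g \<in> L \<Longrightarrow> k < m \<Longrightarrow> \<sigma> g k = (\<Sum>i<n. T k i * S g i)"
proof -
  assume g: "g \<in> L" and k: "k < m"
  have "(\<Sum>j<s. comb (S g) j * \<sigma> (v j) k) = (\<Sum>j<s. ell g j * \<sigma> (v j) k) - (\<Sum>j<s. zc g j * \<sigma> (v j) k)"
    unfolding comb_S[OF g] by (simp add: left_diff_distrib sum_subtractf)
  then show ?thesis
    unfolding comb_\<sigma> by (simp add: \<sigma>_ell[OF k] \<sigma>_zc[OF g])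
qed

text \<open>A nonzero kernel vector of \<open>T\<close> would produce infinitely many lattice points
  \<open>\<phi>(\<lfloor>N u\<rfloor>)\<close> in a bounded region.\<close>

lemma T_injective:
  assumes x: "\<And>k. k < m \<Longrightarrow> (\<Sum>i<n. T k i * x i) = 0" and i: "i < n"
  shows "x i = 0"
proof (rule ccontr)
  assume "x i \<noteq> 0"
  define u where "u = comb x"
  have u: "phi u = 0" "u \<in> euc s" "\<And>k. k < m \<Longrightarrow> (\<Sum>j<s. u j * \<sigma> (v j) k) = 0"
    using x by (simp_all add: u_def phi_comb comb_euc comb_\<sigma>)
  obtain i0 where i0: "u i0 \<noteq> 0"
  proof (rule ccontr)
    assume "\<not> thesis"
    then have "u = (\<lambda>i. 0)"
      using that by blast
    then have "coords u i = 0"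
      by (simp add: coords_def orthonormal_coords_def)
    then show False
      using \<open>x i \<noteq> 0\<close> coords_comb[OF i, of x] by (simp add: u_def)
  qed
  \<comment> \<open>Since \<open>phi\<close> and the forms of \<sigma> vanish on \<open>u\<close>,
    the point \<open>g N\<close> and its star depend only on the rounding error \<open>r N\<close>,
    which is at most 1 in each coordinate.\<close>
  define c where "c = (\<lambda>N::nat. \<lambda>i. \<lfloor>real N * u i\<rfloor>)"
  define r where "r = (\<lambda>N i. of_int (c N i) - real N * u i)"
  have r: "\<bar>r N j\<bar> \<le> 1" for N j
    unfolding r_def c_def by linarith
  define g where "g = (\<lambda>N. phi (\<lambda>i. of_int (c N i)))"
  have gL: "g N \<in> L" for N
    unfolding g_def by (rule phi_int_mem_L)
  have zcg: "zcoord s v (g N) = c N" for N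
    unfolding g_def using u(2) by (intro zcoord_phi) (simp add: c_def mem_euc)
  have c_eq: "of_int (c N j) = r N j + real N * u j" for N j
    by (simp add: r_def)
  have g_eq: "g N = phi (r N)" for N
    unfolding g_def c_eq phi_add phi_scale by (simp add: u(1))
  have \<sigma>g: "\<sigma> (g N) k = (\<Sum>j<s. r N j * \<sigma> (v j) k)" if "k < m" for N k
  proof -
    have "\<sigma> (g N) k = (\<Sum>j<s. r N j * \<sigma> (v j) k) + real N * (\<Sum>j<s. u j * \<sigma> (v j) k)"
      unfolding \<sigma>_zc[OF gL] zcg c_eq by (simp add: distrib_right sum.distrib sum_distrib_left mult.assoc)
    then show ?thesis
      using u(3)[OF that] by simp
  qed
  define B where "B = (\<Sum>j<s. norm (v j)) + (\<Sum>k<m. \<Sum>j<s. \<bar>\<sigma> (v j) k\<bar>)"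
  obtain e where e: "e > 0" "\<And>g. g \<in> \<Gamma> \<Longrightarrow> norm g < e \<Longrightarrow> (\<forall>k<m. \<bar>\<sigma> g k\<bar> < e) \<Longrightarrow> g = 0"
    using \<sigma>_separated by meson
  have "finite (range g)"
  proof (rule finite_bounded_separated[OF e(1)])
    fix a b assume "a \<in> range g" "b \<in> range g" and ab: "norm (a - b) < e" "\<forall>k<m. \<bar>\<sigma> a k - \<sigma> b k\<bar> < e"
    then have "a \<in> \<Gamma>" "b \<in> \<Gamma>"
      using gL L_eq by auto
    then have "a - b = 0"
      using ab by (intro e(2) add_subgroup_diff[OF subgroup_\<Gamma>]) (simp_all add: \<sigma>_diff)
    then show "a = b"
      by simp
  next
    fix a assume "a \<in> range g"
    then obtain N where a: "a = g N"
      by blast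
    have "norm (g N) \<le> (\<Sum>j<s. norm (v j))"
      unfolding g_eq phi_def using r by (intro sum_norm_le) (simp add: mult_left_le_one_le)
    moreover have "0 \<le> (\<Sum>k<m. \<Sum>j<s. \<bar>\<sigma> (v j) k\<bar>)"
      by (intro sum_nonneg) auto
    ultimately show "norm a \<le> B"
      unfolding B_def a by linarith
    fix k assume k: "k < m"
    have "\<bar>\<sigma> (g N) k\<bar> \<le> (\<Sum>j<s. \<bar>\<sigma> (v j) k\<bar>)"
      unfolding \<sigma>g[OF k] using r
      by (intro order_trans[OF sum_abs] sum_mono) (simp add: abs_mult mult_left_le_one_le)
    also have "\<dots> \<le> (\<Sum>k<m. \<Sum>j<s. \<bar>\<sigma> (v j) k\<bar>)"
      using k by (intro member_le_sum) (auto intro: sum_nonneg)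
    finally show "\<bar>\<sigma> a k\<bar> \<le> B"
      unfolding B_def a using sum_nonneg[of "{..<s}" "\<lambda>j. norm (v j)"] by simp
  qed
  \<comment> \<open>Finitely many points have bounded integer coordinates, while coordinate
    \<open>i0\<close> of \<open>g N\<close> stays within 1 of N u(i0), which is unbounded in
    N.\<close>
  then have "finite ((\<lambda>a. \<bar>real_of_int (zcoord s v a i0)\<bar>) ` range g)"
    by (rule finite_imageI)
  then have "bdd_above ((\<lambda>a. \<bar>real_of_int (zcoord s v a i0)\<bar>) ` range g)"
    by (rule bdd_above_finite)
  then obtain K where K': "\<And>N. \<bar>real_of_int (zcoord s v (g N) i0)\<bar> \<le> K"
    unfolding bdd_above_def by auto
  have K: "real N * \<bar>u i0\<bar> \<le> K + 1" for N
  proof -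
    have "\<bar>real N * u i0\<bar> \<le> K + 1"
      using K'[of N] r[of N i0] unfolding zcg c_eq by linarith
    then show ?thesis
      by (simp add: abs_mult)
  qed
  obtain N :: nat where "K + 1 < real N * \<bar>u i0\<bar>"
    using reals_Archimedean3[of "\<bar>u i0\<bar>"] i0 by auto
  then show False
    using K[of N] by linarith
qed

text \<open>More columns than rows would contradict injectivity of \<open>T\<close>. More rows than
  columns would give a nonzero \<open>f\<close> orthogonal to the range of \<open>T\<close>, hence
  to all stars \<sigma> g, contrary to their density.\<close>

lemma n_eq_m: "n = m"
proof (rule antisym)
  show "n \<le> m"
  proof (rule ccontr)
    assume "\<not> n \<le> m"
    then obtain x where "\<exists>i\<in>{..<n}. x i \<noteq> 0" "\<forall>k\<in>{..<m}. (\<Sum>i<n. T k i * x i) = 0"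
      using homogeneous_system_nontrivial_solution[of "{..<m}" "{..<n}" T] by auto
    then show False
      using T_injective[of x] by auto
  qed
  show "m \<le> n"
  proof (rule ccontr)
    assume "\<not> m \<le> n"
    then obtain f where f: "\<exists>k\<in>{..<m}. f k \<noteq> 0" "\<forall>i\<in>{..<n}. (\<Sum>k<m. T k i * f k) = 0"
      using homogeneous_system_nontrivial_solution[of "{..<n}" "{..<m}" "\<lambda>i k. T k i"] by auto
    have orth: "(\<Sum>k<m. f k * \<sigma> g k) = 0" if g: "g \<in> L" for g
    proof -
      have "(\<Sum>k<m. f k * \<sigma> g k) = (\<Sum>k<m. \<Sum>i<n. S g i * (T k i * f k))"
        by (intro sum.cong) (auto simp: \<sigma>_eq_T[OF g] sum_distrib_left mult_ac)
      also have "\<dots> = (\<Sum>i<n. S g i * (\<Sum>k<m. T k i * f k))"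
        by (subst sum.swap) (simp add: sum_distrib_left)
      also have "\<dots> = 0"
        using f(2) by simp
      finally show ?thesis .
    qed
    \<comment> \<open>\<open>f\<close> itself as a point of the internal space: stars that
      approximate it are orthogonal to \<open>f\<close>, which forces the square sum of
      \<open>f\<close> to be 0.\<close>
    define y where "y = (\<lambda>k. if k < m then f k else 0)"
    have y: "y \<in> euc m"
      by (simp add: y_def mem_euc)
    define F where "F = 1 + (\<Sum>k<m. \<bar>f k\<bar>)"
    have F: "F > 0"
      unfolding F_def by (intro add_pos_nonneg sum_nonneg) auto
    have "(\<Sum>k<m. f k * f k) = 0"
    proof (rule real_eq_if_close)
      fix e :: real assume e: "e > 0"
      then obtain g where g: "g \<in> \<Gamma>" "\<sigma> g \<in> sup_ball m y (e / F)"
        using \<sigma>_dense[OF y] F by (meson divide_pos_pos)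
      have "(\<Sum>k<m. f k * f k) = (\<Sum>k<m. f k * (f k - \<sigma> g k))"
        using orth[of g] g(1) L_eq by (simp add: right_diff_distrib sum_subtractf)
      also have "\<bar>\<dots>\<bar> \<le> (\<Sum>k<m. \<bar>f k\<bar> * (e / F))"
      proof (intro order_trans[OF sum_abs] sum_mono)
        fix k assume "k \<in> {..<m}"
        then have "\<bar>f k - \<sigma> g k\<bar> \<le> e / F"
          using g(2) by (auto simp: sup_ball_def y_def abs_minus_commute intro: less_imp_le)
        then show "\<bar>f k * (f k - \<sigma> g k)\<bar> \<le> \<bar>f k\<bar> * (e / F)"
          unfolding abs_mult by (rule mult_left_mono) simp
      qed
      also have "\<dots> = (\<Sum>k<m. \<bar>f k\<bar>) * (e / F)"
        by (rule sum_distrib_right[symmetric])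
      also have "\<dots> \<le> F * (e / F)"
        using e F by (intro mult_right_mono) (auto simp: F_def)
      finally show "\<bar>(\<Sum>k<m. f k * f k) - 0\<bar> \<le> e"
        using F by simp
    qed
    then have "\<forall>k<m. f k = 0"
      by (subst (asm) sum_nonneg_eq_0_iff) auto
    then show False
      using f(1) by auto
  qed
qed

text \<open>\<open>T\<close> is square and injective. Adjoining the column - y gives a system with
  one unknown more than equations; injectivity forces the extra unknown of a nontrivial solution to
  be nonzero, and dividing by it solves for \<open>y\<close>.\<close>

lemma T_surjective: "\<exists>x. \<forall>k<n. (\<Sum>i<n. T k i * x i) = y k"
proof -
  define a where "a = (\<lambda>k j. if j < n then T k j else - y k)"
  obtain x where x: "\<exists>j\<in>{..n}. x j \<noteq> 0" "\<forall>k\<in>{..<n}. (\<Sum>j\<le>n. a k j * x j) = 0"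
    using homogeneous_system_nontrivial_solution[of "{..<n}" "{..n}" a] by auto
  have eq: "(\<Sum>i<n. T k i * x i) = y k * x n" if "k < n" for k
  proof -
    have "(\<Sum>j\<le>n. a k j * x j) = (\<Sum>j<n. T k j * x j) - y k * x n"
      by (simp add: lessThan_Suc_atMost[symmetric] a_def)
    then show ?thesis
      using x(2) that by simp
  qed
  have "x n \<noteq> 0"
  proof
    assume 0: "x n = 0"
    have "x i = 0" if i: "i < n" for i
    proof (rule T_injective[OF _ i])
      show "(\<Sum>i<n. T k i * x i) = 0" if "k < m" for k
        using eq[of k] 0 that n_eq_m by simp
    qed
    then have "x j = 0" if "j \<le> n" for j
      using that 0 by (cases "j = n") auto
    then show False
      using x(1) by auto
  qed
  then have "(\<Sum>i<n. T k i * (x i / x n)) = y k" if "k < n" for k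
    using eq[OF that] by (simp flip: sum_divide_distrib add: field_simps)
  then show ?thesis
    by (intro exI[of _ "\<lambda>i. x i / x n"] allI impI)
qed

definition F :: "(nat \<Rightarrow> real) \<Rightarrow> nat \<Rightarrow> real" where
  "F x = (\<lambda>k. if k < n then \<Sum>i<n. T k i * x i else 0)"

lemma F_euc: "F x \<in> euc n"
  by (simp add: F_def mem_euc)

lemma F_S: "g \<in> L \<Longrightarrow> F (S g) = \<sigma> g"
proof (rule euc_eqI[OF F_euc])
  assume g: "g \<in> L"
  show "\<sigma> g \<in> euc n"
    unfolding n_eq_m using g L_eq by (intro \<sigma>_euc) simp
  show "F (S g) k = \<sigma> g k" if "k < n" for k
    using that \<sigma>_eq_T[OF g, of k] unfolding n_eq_m[symmetric] by (simp add: F_def)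
qed

text \<open>Solving for the unit vectors gives a right inverse; injectivity of \<open>T\<close>
  makes it two-sided. Its Lipschitz constant carries null sets and density back to the Lagarias
  scheme.\<close>

lemma F_inverse:
  "\<exists>G C. sup_lipschitz n n G C \<and> homeomorphic_maps (Euc n) (Euc n) F G"
proof -
  have "\<exists>x. \<forall>k<n. (\<Sum>i<n. T k i * x i) = (if k = j then 1 else 0)" for j
    using T_surjective[of "\<lambda>k. if k = j then 1 else 0"] .
  then obtain P where P: "\<And>j k. k < n \<Longrightarrow> (\<Sum>i<n. T k i * P j i) = (if k = j then 1 else 0)"
    by metis
  define G where "G = (\<lambda>y i. if i < n then 0 + (\<Sum>j<n. P j i * y j) else 0)"
  obtain C where C: "sup_lipschitz n n G C"
    using sup_lipschitz_affine[OF euc_zero, of n n "\<lambda>i j. P j i"] unfolding G_def by blast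
  have "F = (\<lambda>x k. if k < n then 0 + (\<Sum>i<n. T k i * x i) else 0)"
    by (simp add: F_def fun_eq_iff)
  then obtain C' where C': "sup_lipschitz n n F C'"
    using sup_lipschitz_affine[OF euc_zero, of n n T] by auto
  have FG: "F (G y) = y" if y: "y \<in> euc n" for y
  proof (rule euc_eqI[OF F_euc y])
    fix k assume k: "k < n"
    have "F (G y) k = (\<Sum>i<n. \<Sum>j<n. y j * (T k i * P j i))"
      using k by (simp add: F_def G_def sum_distrib_left mult_ac)
    also have "\<dots> = (\<Sum>j<n. y j * (\<Sum>i<n. T k i * P j i))"
      by (subst sum.swap) (simp add: sum_distrib_left)
    also have "\<dots> = y k"
      using k by (simp add: P if_distrib[where f = "\<lambda>x. _ * x"] cong: if_cong)
    finally show "F (G y) k = y k" .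
  qed
  have GF: "G (F x) = x" if x: "x \<in> euc n" for x
  proof (rule euc_eqI[OF _ x])
    show GE: "G (F x) \<in> euc n"
      by (simp add: G_def mem_euc)
    fix i assume i: "i < n"
    have FF: "F (G (F x)) = F x"
      by (rule FG[OF F_euc])
    have "G (F x) i - x i = 0"
    proof (rule T_injective[OF _ i])
      fix k assume "k < m"
      then have "k < n"
        by (simp add: n_eq_m)
      then show "(\<Sum>i<n. T k i * (G (F x) i - x i)) = 0"
        using fun_cong[OF FF, of k] unfolding F_def[of "G (F x)"] F_def[of x]
        by (simp add: F_def right_diff_distrib sum_subtractf)
    qed
    then show "G (F x) i = x i"
      by simp
  qed
  show ?thesis
    using C sup_lipschitz_continuous_map[OF C] sup_lipschitz_continuous_map[OF C'] FG GF
    by (intro exI[of _ G] exI[of _ C]) (simp add: homeomorphic_maps_def)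
qed

text \<open>The linear homeomorphism \<open>G\<close> turns \<sigma> into \<open>S\<close> and the
  window \<open>V\<close> into a window for \<open>S\<close>, preserving interior, boundary and null
  boundary, so the result for the Lagarias scheme applies.\<close>

lemma factor_if_inter_model:
  assumes null: "null_Euclidean m (Euc m frontier_of V)" and \<Lambda>0: "\<Lambda>0 \<in> HL"
  shows "n > 0" and "address_factor_map \<Lambda> s ell addr"
    and "\<exists>w\<in>topspace (torus s). \<exists>!M. M \<in> Hull \<and> addr M = w"
    and "null_Euclidean n (Euc n frontier_of (cl \<Lambda>0))"
proof -
  note [simp] = n_eq_m[symmetric]
  show "n > 0"
    using m_pos by simp
  obtain G C where G: "sup_lipschitz n n G C" "homeomorphic_maps (Euc n) (Euc n) F G"
    using F_inverse by blast
  have hom: "homeomorphic_map (Euc n) (Euc n) G"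
    using G(2) homeomorphic_maps_sym homeomorphic_maps_imp_map by blast
  have GF: "G (F x) = x" if "x \<in> euc n" for x
    using G(2) that by (simp add: homeomorphic_maps_def)
  have FG: "F (G y) = y" if "y \<in> euc n" for y
    using G(2) that by (simp add: homeomorphic_maps_def)
  have V: "V \<subseteq> euc n" "compactin (Euc n) V"
      "V = Euc n closure_of (Euc n interior_of V)"
    using V_subset V_compact V_regular by simp_all
  have V': "closedin (Euc n) V" "sup_bounded n V"
    using V(2) by (simp_all add: compactin_Euclidean_space_iff)
  define W' where "W' = G ` V"
  have int: "Euc n interior_of W' = G ` (Euc n interior_of V)"
    unfolding W'_def by (rule homeomorphic_map_interior_of[OF hom V(1)])
  have fr: "Euc n frontier_of W' = G ` (Euc n frontier_of V)"
    unfolding W'_def by (rule homeomorphic_map_frontier_of[OF hom V(1)])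
  have "W' = G ` (Euc n closure_of (Euc n interior_of V))"
    unfolding W'_def using V(3) by simp
  also have "\<dots> = Euc n closure_of (G ` (Euc n interior_of V))"
    by (rule homeomorphic_map_closure_of[OF hom, symmetric]) (simp add: interior_of_subset_topspace)
  finally have W'_reg: "W' = Euc n closure_of (Euc n interior_of W')"
    unfolding int .
  have W'_closed: "closedin (Euc n) W'"
    by (subst W'_reg) simp
  have frV: "sup_bounded n (Euc n frontier_of V)"
    using V'(2) by (rule sup_bounded_subset) (simp add: frontier_of_def closure_of_closedin[OF V'(1)])
  have W'_null: "null_Euclidean n (Euc n frontier_of W')"
    unfolding fr
    by (rule null_Euclidean_sup_lipschitz_image[OF closedin_frontier_of frV _ G(1)])
      (use null closedin_frontier_of in \<open>auto simp flip: fr\<close>)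
  have dense: "\<exists>g\<in>L. S g \<in> sup_ball n y e" if y: "y \<in> euc n" and e: "e > 0" for y e
  proof -
    have C: "C > 0"
      using G(1) by (simp add: sup_lipschitz_def)
    have "e / (2 * C) > 0"
      using e C by simp
    then obtain g where g: "g \<in> \<Gamma>" "\<sigma> g \<in> sup_ball n (F y) (e / (2 * C))"
      using \<sigma>_dense[of "F y"] F_euc by auto
    have gL: "g \<in> L"
      using g(1) L_eq by simp
    have "S g \<in> sup_ball n y e"
    proof (rule sup_ballI[OF S_euc])
      fix k assume k: "k < n"
      have "\<bar>G (\<sigma> g) k - G (F y) k\<bar> \<le> C * (e / (2 * C))"
        by (rule sup_lipschitzD[OF G(1) _ F_euc _ _ k])
          (use g(2) e C in \<open>auto simp: sup_ball_def intro: less_imp_le\<close>)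
      also have "\<dots> < e"
        using C e by simp
      also have "G (\<sigma> g) = S g"
        using GF[OF S_euc, of g] F_S[OF gL] by simp
      finally show "\<bar>S g k - y k\<bar> < e"
        by (simp add: GF[OF y])
    qed
    then show ?thesis
      using gL by blast
  qed
  have lower': "g - t \<in> \<Lambda>" if g: "g \<in> L" "S g \<in> Euc n interior_of W'" for g
  proof -
    obtain y where y: "y \<in> Euc n interior_of V" "S g = G y"
      using g(2) unfolding int by blast
    have "y \<in> euc n"
      using y(1) by (simp add: in_interior_of_Euclidean)
    then have "\<sigma> g = y"
      using F_S[OF g(1)] FG y(2) by simp
    then show ?thesis
      using y(1) g(1) L_eq by (intro lower_V) simp_all
  qed
  have upper': "x + t \<in> L \<and> S (x + t) \<in> W'" if x: "x \<in> \<Lambda>" for x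
  proof -
    have xL: "x + t \<in> L" and "\<sigma> (x + t) \<in> V"
      using upper_V[OF x] L_eq by simp_all
    moreover have "S (x + t) = G (\<sigma> (x + t))"
      using GF[OF S_euc, of "x + t"] F_S[OF xL] by simp
    ultimately show ?thesis
      by (simp add: W'_def)
  qed
  note factor = factor_if_star_inter_model[OF dense W'_closed W'_reg W'_null lower' upper' \<Lambda>0]
  show "address_factor_map \<Lambda> s ell addr"
    by (rule factor(1))
  show "\<exists>w\<in>topspace (torus s). \<exists>!M. M \<in> Hull \<and> addr M = w"
    by (rule factor(2))
  show "null_Euclidean n (Euc n frontier_of (cl \<Lambda>0))"
    by (rule factor(3))
qed

end

section \<open>The equivalence for repetitive Meyer sets\<close>

theorem theorem3:
  fixes \<Lambda> \<Lambda>\<^sub>0 :: "(real ^ 'd) set"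
    and v :: "nat \<Rightarrow> real ^ 'd"
    and ell :: "real ^ 'd \<Rightarrow> nat \<Rightarrow> real"
    and b :: "nat \<Rightarrow> nat \<Rightarrow> real"
    and s n :: nat
  assumes "meyer \<Lambda>" and "repetitive \<Lambda>"
    and "s = zrank (generated_subgroup (difference_set \<Lambda>))"
    and "zbasis s v (generated_subgroup (difference_set \<Lambda>))"
    and "address_linear_map \<Lambda> s v ell"
    and "n = s - CARD('d)"
    and "orthonormal_basis s n b (address_kernel s v)"
    and "\<Lambda>\<^sub>0 \<in> transversal \<Lambda>"
  shows "regular_inter_model_set \<Lambda> \<longleftrightarrow>
     s > CARD('d) \<and>
     (\<exists>\<pi>. address_factor_map \<Lambda> s ell \<pi> \<and>
        (\<exists>w \<in> topspace (torus s). \<exists>!\<Lambda>'. \<Lambda>' \<in> delone_hull \<Lambda> \<and> \<pi> \<Lambda>' = w)) \<and>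
     null_Euclidean n (Euclidean_space n frontier_of (minimal_window s n v ell b \<Lambda>\<^sub>0))"
proof -
  interpret address_data \<Lambda> v ell b s n
    using assms by unfold_locales (simp_all add: meyer_def)
  \<comment> \<open>Since 0 belongs to it, each of its points is a difference of two of its points
    and so lies in \<open>L\<close>.\<close>
  have \<Lambda>0: "\<Lambda>\<^sub>0 \<in> HL"
    using assms(8) shift_mem_HL[of "\<Lambda>\<^sub>0" 0] by (simp add: transversal_def)
  have window_eq: "minimal_window s n v ell b \<Lambda>\<^sub>0 = cl \<Lambda>\<^sub>0"
    by (simp add: minimal_window_def cl_def S_def)
  show ?thesis
  proof
    assume "regular_inter_model_set \<Lambda>"
    then obtain m \<Gamma> \<sigma> W t w where data: "inter_model_data \<Lambda> m \<Gamma> \<sigma> W t w"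
      and null: "null_Euclidean m (Euc m frontier_of (translate w W))"
      unfolding regular_inter_model_set_def by blast
    interpret inter_model_address \<Lambda> v ell b s n m \<Gamma> \<sigma> W t w
      using data by unfold_locales
    note factor = factor_if_inter_model[OF null[folded V_def] \<Lambda>0]
    show "s > CARD('d) \<and>
     (\<exists>\<pi>. address_factor_map \<Lambda> s ell \<pi> \<and>
        (\<exists>w \<in> topspace (torus s). \<exists>!\<Lambda>'. \<Lambda>' \<in> delone_hull \<Lambda> \<and> \<pi> \<Lambda>' = w)) \<and>
     null_Euclidean n (Euc n frontier_of (minimal_window s n v ell b \<Lambda>\<^sub>0))"
      unfolding window_eq
    proof (intro conjI exI[of _ addr] factor(2-4))
      \<comment> \<open>Subtraction on naturals truncates at 0, so \<open>n > 0\<close> is the same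
        as \<open>s > CARD('d)\<close>.\<close>
      show "s > CARD('d)"
        using factor(1) assms(6) by simp
    qed
  next
    assume *: "s > CARD('d) \<and>
     (\<exists>\<pi>. address_factor_map \<Lambda> s ell \<pi> \<and>
        (\<exists>w \<in> topspace (torus s). \<exists>!\<Lambda>'. \<Lambda>' \<in> delone_hull \<Lambda> \<and> \<pi> \<Lambda>' = w)) \<and>
     null_Euclidean n (Euc n frontier_of (minimal_window s n v ell b \<Lambda>\<^sub>0))"
    from *[THEN conjunct2, THEN conjunct1] obtain \<pi> where \<pi>: "address_factor_map \<Lambda> s ell \<pi> \<and>
        (\<exists>w \<in> topspace (torus s). \<exists>!\<Lambda>'. \<Lambda>' \<in> delone_hull \<Lambda> \<and> \<pi> \<Lambda>' = w)" ..
    from \<pi>[THEN conjunct2] obtain w where w: "\<exists>!\<Lambda>'. \<Lambda>' \<in> delone_hull \<Lambda> \<and> \<pi> \<Lambda>' = w" ..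
    then obtain M where M: "M \<in> delone_hull \<Lambda> \<and> \<pi> M = w" by (rule ex1E)
    show "regular_inter_model_set \<Lambda>"
    proof (rule regular_inter_model_set_if_factor[OF _ _ _ _ \<Lambda>0])
      show "n > 0"
        using * assms(6) by simp
      show "address_factor_map \<Lambda> s ell \<pi>"
        using \<pi> by simp
      show "M \<in> delone_hull \<Lambda>"
        using M by simp
      show "M' = M" if "M' \<in> delone_hull \<Lambda>" "\<pi> M' = \<pi> M" for M'
        using w M that by (metis (no_types, lifting))
      show "null_Euclidean n (Euc n frontier_of (cl \<Lambda>\<^sub>0))"
        using * unfolding window_eq by simp
    qed
  qed
qed

end
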